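(* Let $\alpha\in(\tfrac12,1)$, $s=s_n=n^{1-\alpha}$, let $\lambda=\lambda_n\in[1,n]$ be a sequence such that $\theta:=\lim_{n\to\infty}\frac{\lambda}{2n}$ exists, let $A=A_n>0$ be a sequence, let $C^*>0$ be a fixed constant, and let $$C_{\mathrm{max}}(\alpha)=16(1-\theta)\left(1-\sqrt{1-\alpha}\right)^2.$$ Consider testing $H_0:\boldsymbol\beta=\mathbf 0$ against $H_1:\boldsymbol\beta\in\Xi(s_n,A_n)$ on the basis of $\mathbf Y\sim\mathbb P_{\boldsymbol\beta,\lambda}$. (i) Assume $\lambda\gg\log n$. If $C^*>C_{\mathrm{max}}(\alpha)$ and $\tanh(A)\ge\sqrt{\frac{C^*\log n}{\lambda}}$ for all $n$, then the Maximum Degree Test is asymptotically powerful; that is, there is a sequence of thresholds $k_n$ such that the tests rejecting if and only if $\max_{1\le i\le n}d_i>k_n$ are asymptotically powerful against $\Xi(s_n,A_n)$. (ii) Assume $\lambda\gg\log^3 n$. If $C^*<C_{\mathrm{max}}(\alpha)$ and $\tanh(A)\le\sqrt{\frac{C^*\log n}{\lambda}}$ for all $n$, then the Maximum Degree Test is asymptotically powerless; that is, for every sequence of thresholds $k_n$, the tests rejecting if and only if $\max_{1\le i\le n}d_i>k_n$ are asymptotically powerless against $\Xi(s_n,A_n)$.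
   Context: Notation: $a_n\gg b_n$ means $a_n/b_n\to\infty$. Model. For $\boldsymbol\beta\in\mathbb R^n$ and $\lambda\in[1,n]$ (known, allowed to depend on $n$), $\mathbb P_{\boldsymbol\beta,\lambda}$ is the law of the symmetric adjacency matrix $\mathbf Y=(Y_{ij})_{1\le i,j\le n}$ with $Y_{ii}=0$, $Y_{ij}=Y_{ji}$, and $(Y_{ij})_{i<j}$ independent Bernoulli variables with success probabilities $p_{ij}=\frac{\lambda}{n}\frac{e^{\beta_i+\beta_j}}{1+e^{\beta_i+\beta_j}}$. The degree of vertex $i$ is $d_i=\sum_{j\ne i}Y_{ij}$. Parameter space. $\Xi(s,A)=\{\boldsymbol\beta\in[0,\infty)^n: |S(\boldsymbol\beta)|=s,\ \beta_i\ge A \text{ for } i\in S(\boldsymbol\beta)\}$, where $S(\boldsymbol\beta)=\{i:\beta_i\ne0\}$. Here $s_n=n^{1-\alpha}$ is understood as an integer. Tests. A test $T_n$ is a measurable $\{0,1\}$-valued function of $\mathbf Y$ (value $1$ means rejecting $H_0$). Its risk is $\mathrm{Risk}_n(T_n,\Xi(s_n,A_n))=\mathbb P_{\mathbf 0,\lambda}(T_n=1)+\sup_{\boldsymbol\beta\in\Xi(s_n,A_n)}\mathbb P_{\boldsymbol\beta,\lambda}(T_n=0)$. A sequence $T_n$ is asymptotically powerful if $\limsup_{n\to\infty}\mathrm{Risk}_n(T_n,\Xi(s_n,A_n))=0$, and asymptotically powerless if $\liminf_{n\to\infty}\mathrm{Risk}_n(T_n,\Xi(s_n,A_n))=1$.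 *)

theory Defs
  imports "HOL-Probability.Probability"
begin

text \<open>
  A vector in \<open>\<real>\<^sup>n\<close> is a function \<open>nat \<Rightarrow> real\<close> indexed by \<open>{1..n}\<close> and vanishing outside it;
  an \<open>n \<times> n\<close> matrix is likewise a function \<open>nat \<Rightarrow> nat \<Rightarrow> nat\<close> with entries in \<open>{0, 1}\<close>.
\<close>

definition edge_prob :: "nat \<Rightarrow> real \<Rightarrow> (nat \<Rightarrow> real) \<Rightarrow> nat \<Rightarrow> nat \<Rightarrow> real" where
  "edge_prob n lam \<beta> i j =
     lam / real n * (exp (\<beta> i + \<beta> j) / (1 + exp (\<beta> i + \<beta> j)))"

definition vertex_pairs :: "nat \<Rightarrow> (nat \<times> nat) set" where
  "vertex_pairs n = {(i, j). 1 \<le> i \<and> i < j \<and> j \<le> n}"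

definition adjacency_matrix :: "(nat \<times> nat \<Rightarrow> bool) \<Rightarrow> nat \<Rightarrow> nat \<Rightarrow> nat" where
  "adjacency_matrix E i j = (if i = j then 0 else of_bool (E (min i j, max i j)))"

text \<open>
  The measure \<open>Pi_pmf\<close> draws the entries above the diagonal independently and sets
  \<open>E (i, j) = False\<close> off \<open>vertex_pairs n\<close>. For \<open>0 \<le> lam \<le> n\<close> all the edge probabilities are in
  \<open>[0, 1]\<close>, so \<open>bernoulli_pmf\<close> is not clipped.
\<close>

definition beta_model :: "nat \<Rightarrow> real \<Rightarrow> (nat \<Rightarrow> real) \<Rightarrow> (nat \<Rightarrow> nat \<Rightarrow> nat) pmf" where
  "beta_model n lam \<beta> =
     map_pmf adjacency_matrix
       (Pi_pmf (vertex_pairs n) False (\<lambda>(i, j). bernoulli_pmf (edge_prob n lam \<beta> i j)))"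

definition vertex_degree :: "nat \<Rightarrow> (nat \<Rightarrow> nat \<Rightarrow> nat) \<Rightarrow> nat \<Rightarrow> nat" where
  "vertex_degree n Y i = (\<Sum>j\<in>{1..n} - {i}. Y i j)"

definition supp :: "(nat \<Rightarrow> real) \<Rightarrow> nat set" where
  "supp \<beta> = {i. \<beta> i \<noteq> 0}"

definition Xi :: "nat \<Rightarrow> nat \<Rightarrow> real \<Rightarrow> (nat \<Rightarrow> real) set" where
  "Xi n s A = {\<beta>. supp \<beta> \<subseteq> {1..n} \<and> (\<forall>i. 0 \<le> \<beta> i) \<and> card (supp \<beta>) = s \<and>
                  (\<forall>i\<in>supp \<beta>. A \<le> \<beta> i)}"

text \<open>A test maps the observed matrix to \<open>1\<close> (reject) or \<open>0\<close>; all tests are measurable for a pmf.\<close>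

definition risk :: "nat \<Rightarrow> real \<Rightarrow> ((nat \<Rightarrow> nat \<Rightarrow> nat) \<Rightarrow> nat) \<Rightarrow> (nat \<Rightarrow> real) set \<Rightarrow> real" where
  "risk n lam T B =
     measure_pmf.prob (beta_model n lam (\<lambda>_. 0)) {Y. T Y = 1} +
     (SUP \<beta>\<in>B. measure_pmf.prob (beta_model n lam \<beta>) {Y. T Y = 0})"

definition asymp_powerful ::
    "(nat \<Rightarrow> real) \<Rightarrow> (nat \<Rightarrow> nat) \<Rightarrow> (nat \<Rightarrow> real) \<Rightarrow>
     (nat \<Rightarrow> (nat \<Rightarrow> nat \<Rightarrow> nat) \<Rightarrow> nat) \<Rightarrow> bool" where
  "asymp_powerful lam s A T \<longleftrightarrow>
     limsup (\<lambda>n. ereal (risk n (lam n) (T n) (Xi n (s n) (A n)))) = 0"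

definition asymp_powerless ::
    "(nat \<Rightarrow> real) \<Rightarrow> (nat \<Rightarrow> nat) \<Rightarrow> (nat \<Rightarrow> real) \<Rightarrow>
     (nat \<Rightarrow> (nat \<Rightarrow> nat \<Rightarrow> nat) \<Rightarrow> nat) \<Rightarrow> bool" where
  "asymp_powerless lam s A T \<longleftrightarrow>
     liminf (\<lambda>n. ereal (risk n (lam n) (T n) (Xi n (s n) (A n)))) = 1"

definition max_degree_test :: "nat \<Rightarrow> real \<Rightarrow> (nat \<Rightarrow> nat \<Rightarrow> nat) \<Rightarrow> nat" where
  "max_degree_test n k Y = (if real (Max (vertex_degree n Y ` {1..n})) > k then 1 else 0)"

definition C_max :: "real \<Rightarrow> real \<Rightarrow> real" where
  "C_max \<alpha> \<theta> = 16 * (1 - \<theta>) * (1 - sqrt (1 - \<alpha>))\<^sup>2"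

text \<open>The relation \<open>a\<^sub>n \<ggreater> b\<^sub>n\<close> between sequences.\<close>

definition dominates :: "(nat \<Rightarrow> real) \<Rightarrow> (nat \<Rightarrow> real) \<Rightarrow> bool" where
  "dominates a b \<longleftrightarrow> filterlim (\<lambda>n. a n / b n) at_top sequentially"

end

theory Submission
  imports Defs
begin

text \<open>
  Write \<open>p = \<lambda> / (2n)\<close>, \<open>L = log n\<close>. Under the null hypothesis the degrees fluctuate around \<open>n p\<close>
  with variance \<open>V = n p (1 - p)\<close>, and the maximum is \<open>n p + sqrt (2 V L)\<close> to leading order.
  A signal moves the mean degree by \<open>sqrt (C L / \<lambda>) \<lambda> / 4\<close>, and the \<open>s = n\<^sup>1\<^sup>-\<^sup>\<alpha>\<close> signal vertices fluctuate up
  to \<open>sqrt (2 (1 - \<alpha>) V L)\<close> above their mean; equating the two gives \<open>C\<^sub>m\<^sub>a\<^sub>x\<close>.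

  Upper tails come from a Chernoff bound, binomial lower tails from exponential tilting. Independence
  is obtained by counting only the edges from a vertex set \<open>S\<close> to its complement. For the signal set
  this loses about \<open>\<lambda> s / n\<close> edges per vertex, which is \<open>o(sqrt (\<lambda> L))\<close> because \<open>\<alpha> > 1/2\<close>. For the null
  maximum \<open>S\<close> has size \<open>\<eta> n\<close> and the degrees inside \<open>S\<close> are bounded below by a Chernoff bound.

  For the second part, remove edges from the alternative to obtain the null model. The vertex
  outside the signal set that maximizes the degree has at most \<open>B = 2 L + 2 \<lambda> s / n\<close> signal
  neighbours, and each of these edges is removed with probability at most \<open>sqrt (C L / \<lambda>)\<close>, so it
  keeps all its edges with probability tending to 1; this uses \<open>\<lambda> \<ggreater> L\<^sup>3\<close>.
\<close>

section \<open>Elementary inequalities\<close>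

text \<open>All comparisons are made on the scale \<open>R = sqrt (\<lambda> L)\<close>. As
  \<open>V\<close> is asymptotically \<open>\<lambda> (1 - \<theta>) / 2\<close>, a fluctuation
  \<open>sqrt (2 c V L)\<close> becomes \<open>sqrt (c (1 - \<theta>))\<close>. A single vertex
  passes this level with probability about n^(-c), so c = 1 and c = 1 - \<alpha> are critical for n
  and for s vertices. The mean shift becomes \<open>sqrt C / 4\<close>, since
  \<open>n p = \<lambda> / 2\<close> is multiplied by \<open>tanh (A / 2)\<close>, about
  \<open>tanh A / 2\<close>. Two obstacles are the size of the alternative class and the arbitrary
  threshold. Exceeding a threshold is an increasing event. Hence in the first part every alternative
  may be replaced by a graph with constant edge probability between signal and null vertices and no
  other edges; in the second part the risk is at most 1, and a single planted alternative suffices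
  for the lower bound. An arbitrary threshold is compared with a level strictly between the signal
  and the null maximum: below it the null is already rejected, above it signal vertices do not cause
  rejection and only the other vertices matter.\<close>

text \<open>The Lagrange remainder is at most \<open>\<bar>y\<bar> ^ 3 / 2\<close> because
  \<open>exp 1 \<le> 3\<close>. The relative error \<open>1 + \<bar>y\<bar>\<close> keeps the
  Chernoff exponents Gaussian to leading order for small tilts.\<close>

lemma exp_le_quadratic_cubic:
  fixes y :: real
  assumes "\<bar>y\<bar> \<le> 1"
  shows "exp y \<le> 1 + y + y\<^sup>2 / 2 * (1 + \<bar>y\<bar>)"
proof -
  obtain t where t: "\<bar>t\<bar> \<le> \<bar>y\<bar>" and e: "exp y = (\<Sum>m<3. y ^ m / fact m) + exp t / fact 3 * y ^ 3"
    using Maclaurin_exp_le[of y 3] by blast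
  have "exp t \<le> exp 1" using t assms by simp
  also have "exp 1 \<le> (3::real)" using exp_le by simp
  finally have "exp t \<le> 3" .
  have "exp t / fact 3 * y ^ 3 \<le> exp t / fact 3 * \<bar>y\<bar> ^ 3"
    by (intro mult_left_mono) (auto simp: power_abs[symmetric])
  also have "\<dots> \<le> 3 / fact 3 * \<bar>y\<bar> ^ 3"
    using \<open>exp t \<le> 3\<close> by (intro mult_right_mono divide_right_mono) auto
  also have "\<dots> = y\<^sup>2 / 2 * \<bar>y\<bar>"
    by (simp add: fact_numeral power3_eq_cube power2_eq_square abs_mult_self)
  finally show ?thesis
    using e by (simp add: numeral_eq_Suc distrib_left)
qed

text \<open>The difference of the two sides vanishes at 0 and has derivative
  \<open>y ^ 3 / (1 + y)\<close>, so 0 is its minimum.\<close>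

lemma ln_one_plus_le_cubic:
  fixes x :: real
  assumes "x > -1"
  shows "ln (1 + x) \<le> x - x\<^sup>2 / 2 + x ^ 3 / 3"
proof -
  define f where "f = (\<lambda>x::real. x - x\<^sup>2 / 2 + x ^ 3 / 3 - ln (1 + x))"
  have d: "(f has_real_derivative (y ^ 3 / (1 + y))) (at y)" if "y > -1" for y
    unfolding f_def using that
    by (auto intro!: derivative_eq_intros simp: field_simps power2_eq_square power3_eq_cube)
  have "f x \<ge> f 0"
  proof (cases "x \<ge> 0")
    case True
    show ?thesis
      by (rule DERIV_nonneg_imp_nondecreasing[OF True])
        (use d in \<open>force intro!: exI divide_nonneg_nonneg\<close>)
  next
    case False
    then have "x \<le> 0" by simp
    then show ?thesis
    proof (rule DERIV_nonpos_imp_nonincreasing)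
      fix y assume "x \<le> y" "y \<le> 0"
      then have "y ^ 3 / (1 + y) \<le> 0" using assms
        by (intro divide_nonpos_nonneg) (auto simp: power3_eq_cube mult_nonneg_nonpos mult_nonpos_nonpos)
      then show "\<exists>z. (f has_real_derivative z) (at y) \<and> z \<le> 0"
        using d[of y] assms \<open>x \<le> y\<close> by auto
    qed
  qed
  then show ?thesis by (simp add: f_def)
qed

text \<open>The left side is the relative entropy of Bernoulli \<open>q + D\<close> with respect to
  Bernoulli \<open>q\<close>, the cost per trial of the tilt used below. Its leading term is
  Gaussian with variance \<open>q * (1 - q)\<close>.\<close>

lemma bernoulli_kl_le:
  fixes q D \<eta> :: real
  assumes q: "0 < q" "q < 1" and D: "0 \<le> D" and \<eta>: "D / (q * (1 - q)) \<le> \<eta>" "\<eta> \<le> 1 / 2"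
  shows "(q + D) * ln ((q + D) / q) + (1 - q - D) * ln ((1 - q - D) / (1 - q))
          \<le> D\<^sup>2 / (2 * (q * (1 - q))) * (1 + \<eta>)"
proof -
  define r where "r = 1 - q"
  define u where "u = D / q"
  define w where "w = - D / r"
  have r: "0 < r" "r < 1" using q by (auto simp: r_def)
  have qr: "q * r \<le> q" "q * r \<le> r" "0 < q * r" using q r by auto
  have "D / q \<le> D / (q * r)" using D q r qr by (intro divide_left_mono) auto
  then have u: "0 \<le> u" "u \<le> \<eta>" using \<eta> D q by (auto simp: u_def r_def)
  have "D / r \<le> D / (q * r)" using D q r qr by (intro divide_left_mono) auto
  then have w: "w \<le> 0" "- w \<le> \<eta>" using \<eta> D r by (auto simp: w_def r_def)
  have e0: "0 \<le> \<eta>" using u by simp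
  have qu: "q + D = q * (1 + u)" "(q + D) / q = 1 + u" using q by (auto simp: u_def field_simps)
  have rw: "1 - q - D = r * (1 + w)" "(1 - q - D) / (1 - q) = 1 + w"
    using r by (auto simp: w_def r_def field_simps)
  have lu: "ln (1 + u) \<le> u - u\<^sup>2 / 2 + u ^ 3 / 3" using u by (intro ln_one_plus_le_cubic) auto
  have lw: "ln (1 + w) \<le> w - w\<^sup>2 / 2 + w ^ 3 / 3" using w \<eta> by (intro ln_one_plus_le_cubic) auto
  have u2: "u\<^sup>2 * (u\<^sup>2 * 2 / 3) \<le> u\<^sup>2 * \<eta>"
  proof (rule mult_left_mono)
    have "u * u \<le> \<eta> * 1" using u \<eta> e0 by (intro mult_mono) auto
    then show "u\<^sup>2 * 2 / 3 \<le> \<eta>" using e0 by (simp add: power2_eq_square)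
  qed auto
  have w2: "w\<^sup>2 * (- w / 3 + w\<^sup>2 * 2 / 3) \<le> w\<^sup>2 * \<eta>"
  proof (rule mult_left_mono)
    have "(- w) * (- w) \<le> \<eta> * (1/2)" using w \<eta> e0 by (intro mult_mono) auto
    then show "- w / 3 + w\<^sup>2 * 2 / 3 \<le> \<eta>" using w e0 by (simp add: power2_eq_square)
  qed auto
  have Du: "q * u = D" "r * w = - D" using q r by (auto simp: u_def w_def)
  have "(q + D) * ln ((q + D) / q) + (1 - q - D) * ln ((1 - q - D) / (1 - q))
      = q * ((1 + u) * ln (1 + u)) + r * ((1 + w) * ln (1 + w))"
    unfolding qu(2) rw(2) by (simp add: qu(1) rw(1))
  also have "\<dots> \<le> q * ((1 + u) * (u - u\<^sup>2 / 2 + u ^ 3 / 3)) + r * ((1 + w) * (w - w\<^sup>2 / 2 + w ^ 3 / 3))"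
    using q r u w \<eta> lu lw by (intro add_mono mult_left_mono) auto
  \<comment> \<open>The linear terms cancel because \<open>q * u = D\<close> and
    \<open>r * w = - D\<close>. The cubic term in \<open>u\<close> has the favourable sign and is
    dropped; the one in \<open>w\<close> is absorbed into \<open>\<eta>\<close>.\<close>
  also have "\<dots> = q * u + r * w + q * (u\<^sup>2 / 2 - u ^ 3 / 6 + u\<^sup>2 * (u\<^sup>2 * 2 / 3) / 2)
                + r * (w\<^sup>2 / 2 + w\<^sup>2 * (- w / 3 + w\<^sup>2 * 2 / 3) / 2)"
    by (simp add: field_simps power2_eq_square power3_eq_cube)
  also have "\<dots> \<le> 0 + q * (u\<^sup>2 / 2 - 0 + u\<^sup>2 * \<eta> / 2) + r * (w\<^sup>2 / 2 + w\<^sup>2 * \<eta> / 2)"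
  proof -
    have 1: "u\<^sup>2 / 2 - u ^ 3 / 6 + u\<^sup>2 * (u\<^sup>2 * 2 / 3) / 2 \<le> u\<^sup>2 / 2 - 0 + u\<^sup>2 * \<eta> / 2"
      using u2 u by (intro add_mono diff_mono divide_right_mono) auto
    have 2: "w\<^sup>2 / 2 + w\<^sup>2 * (- w / 3 + w\<^sup>2 * 2 / 3) / 2 \<le> w\<^sup>2 / 2 + w\<^sup>2 * \<eta> / 2"
      using w2 by (intro add_mono divide_right_mono) auto
    show ?thesis
      using mult_left_mono[OF 1, of q] mult_left_mono[OF 2, of r] q r Du by linarith
  qed
  also have "\<dots> = (q * u\<^sup>2 + r * w\<^sup>2) / 2 * (1 + \<eta>)"
    by (simp add: field_simps)
  also have "q * u\<^sup>2 + r * w\<^sup>2 = D\<^sup>2 / (q * r)"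
  proof -
    have "q * u\<^sup>2 + r * w\<^sup>2 = D\<^sup>2 / q + D\<^sup>2 / r"
      using q r by (simp add: u_def w_def power2_eq_square)
    also have "\<dots> = D\<^sup>2 * (q + r) / (q * r)" using q r by (simp add: field_simps)
    finally show ?thesis by (simp add: r_def)
  qed
  finally show ?thesis by (simp add: r_def mult_ac)
qed

section \<open>Products of Bernoulli laws\<close>

lemma prob_bind_pmf:
  "measure_pmf.prob (bind_pmf M f) X = measure_pmf.expectation M (\<lambda>x. measure_pmf.prob (f x) X)"
proof -
  have "measure_pmf.prob (bind_pmf M f) X = enn2real (\<integral>\<^sup>+x. emeasure (f x) X \<partial>M)"
    by (simp add: measure_def)
  also have "(\<integral>\<^sup>+x. emeasure (f x) X \<partial>M) = (\<integral>\<^sup>+x. ennreal (measure_pmf.prob (f x) X) \<partial>M)"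
    by (simp add: measure_pmf.emeasure_eq_measure)
  also have "enn2real \<dots> = measure_pmf.expectation M (\<lambda>x. measure_pmf.prob (f x) X)"
    by (subst integral_eq_nn_integral) auto
  finally show ?thesis .
qed

lemma prob_pair_pmf:
  "measure_pmf.prob (pair_pmf M N) X =
     measure_pmf.expectation M (\<lambda>x. measure_pmf.prob N {y. (x, y) \<in> X})"
  unfolding pair_pmf_def map_pmf_def[symmetric] by (simp add: prob_bind_pmf vimage_def)

lemma expectation_mono_pmf:
  fixes f g :: "'a \<Rightarrow> real"
  assumes "\<And>x. x \<in> set_pmf M \<Longrightarrow> f x \<le> g x" "\<And>x. \<bar>f x\<bar> \<le> B" "\<And>x. \<bar>g x\<bar> \<le> B"
  shows "measure_pmf.expectation M f \<le> measure_pmf.expectation M g"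
  by (rule integral_mono_AE)
    (use assms in \<open>auto intro!: measure_pmf.integrable_const_bound[where B = B] simp: AE_measure_pmf_iff\<close>)

text \<open>One-sided implications suffice to say that \<open>P\<close> depends only on
  \<open>F\<close> and \<open>Q\<close> only on \<open>G\<close>, since agreement is symmetric.
  Splitting the index set into \<open>A \<inter> F\<close> and \<open>A - F\<close> turns the law
  into a product measure.\<close>

lemma prob_Pi_pmf_indep:
  assumes A: "finite A" and disj: "F \<inter> G = {}"
    and P: "\<And>f g. (\<And>e. e \<in> F \<Longrightarrow> f e = g e) \<Longrightarrow> P f \<Longrightarrow> P g"
    and Q: "\<And>f g. (\<And>e. e \<in> G \<Longrightarrow> f e = g e) \<Longrightarrow> Q f \<Longrightarrow> Q g"
  shows "measure_pmf.prob (Pi_pmf A d p) {f. P f \<and> Q f} =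
         measure_pmf.prob (Pi_pmf A d p) {f. P f} * measure_pmf.prob (Pi_pmf A d p) {f. Q f}"
proof -
  define B where "B = A \<inter> F"
  define C where "C = A - F"
  have BC: "finite B" "finite C" "B \<inter> C = {}" "A = B \<union> C" using A by (auto simp: B_def C_def)
  define M where "M = Pi_pmf B d p"
  define N where "N = Pi_pmf C d p"
  define h where "h = (\<lambda>(f::'a\<Rightarrow>'b, g) x. if x \<in> B then f x else g x)"
  have Pi: "Pi_pmf A d p = map_pmf h (pair_pmf M N)"
    unfolding M_def N_def h_def BC(4) by (rule Pi_pmf_union) (use BC in auto)
  have M: "\<And>f e. f \<in> set_pmf M \<Longrightarrow> e \<notin> B \<Longrightarrow> f e = d"
    and N: "\<And>f e. f \<in> set_pmf N \<Longrightarrow> e \<notin> C \<Longrightarrow> f e = d"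
    using set_Pi_pmf_subset[of B d p] set_Pi_pmf_subset[of C d p] BC by (auto simp: M_def N_def)
  have hP: "P (h (f, g)) \<longleftrightarrow> P f" if "f \<in> set_pmf M" "g \<in> set_pmf N" for f g
  proof -
    have "h (f, g) e = f e" if "e \<in> F" for e
      using M[OF \<open>f \<in> _\<close>] N[OF \<open>g \<in> _\<close>] that by (auto simp: h_def B_def C_def)
    then show ?thesis using P[of "h (f,g)" f] P[of f "h (f,g)"] by metis
  qed
  have hQ: "Q (h (f, g)) \<longleftrightarrow> Q g" if "f \<in> set_pmf M" "g \<in> set_pmf N" for f g
  proof -
    have "h (f, g) e = g e" if "e \<in> G" for e
      using that disj by (auto simp: h_def B_def C_def)
    then show ?thesis using Q[of "h (f,g)" g] Q[of g "h (f,g)"] by metis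
  qed
  \<comment> \<open>The events need to agree only on the support, where coordinates off
    \<open>A\<close> are fixed to \<open>d\<close>; \<open>hP\<close> relies on this.\<close>
  have cnv: "measure_pmf.prob (Pi_pmf A d p) X = measure_pmf.prob (pair_pmf M N) Y"
    if "\<And>f g. f \<in> set_pmf M \<Longrightarrow> g \<in> set_pmf N \<Longrightarrow> h (f, g) \<in> X \<longleftrightarrow> (f, g) \<in> Y" for X Y
  proof -
    have "x \<notin> set_pmf (pair_pmf M N)" if "x \<in> (h -` X) - Y \<or> x \<in> Y - h -` X" for x
      using that \<open>\<And>f g. f \<in> set_pmf M \<Longrightarrow> g \<in> set_pmf N \<Longrightarrow> h (f, g) \<in> X \<longleftrightarrow> (f, g) \<in> Y\<close>
      by (cases x) auto
    then show ?thesis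
      unfolding Pi measure_map_pmf by (intro measure_prob_cong_0) (auto simp only: set_pmf_iff)
  qed
  have prd: "measure_pmf.prob (pair_pmf M N) (X \<times> Y) = measure_pmf.prob M X * measure_pmf.prob N Y" for X Y
  proof -
    have "measure_pmf.prob N {y. (x, y) \<in> X \<times> Y} = indicator X x * measure_pmf.prob N Y" for x
      by (cases "x \<in> X") auto
    then show ?thesis unfolding prob_pair_pmf by simp
  qed
  have "measure_pmf.prob (Pi_pmf A d p) {f. P f \<and> Q f} = measure_pmf.prob (pair_pmf M N) ({f. P f} \<times> {g. Q g})"
    by (rule cnv) (use hP hQ in auto)
  moreover have "measure_pmf.prob (Pi_pmf A d p) {f. P f} = measure_pmf.prob (pair_pmf M N) ({f. P f} \<times> UNIV)"
    by (rule cnv) (use hP hQ in auto)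
  moreover have "measure_pmf.prob (Pi_pmf A d p) {f. Q f} = measure_pmf.prob (pair_pmf M N) (UNIV \<times> {g. Q g})"
    by (rule cnv) (use hP hQ in auto)
  ultimately show ?thesis by (simp add: prd)
qed

lemma prob_Pi_pmf_indep_family:
  assumes A: "finite A" and S: "finite S" and disj: "disjoint_family_on F S"
    and P: "\<And>i f g. i \<in> S \<Longrightarrow> (\<And>e. e \<in> F i \<Longrightarrow> f e = g e) \<Longrightarrow> P i f \<Longrightarrow> P i g"
  shows "measure_pmf.prob (Pi_pmf A d p) {f. \<forall>i\<in>S. P i f} =
         (\<Prod>i\<in>S. measure_pmf.prob (Pi_pmf A d p) {f. P i f})"
  using S disj P
proof (induction S rule: finite_induct)
  case (insert i S)
  have "measure_pmf.prob (Pi_pmf A d p) {f. P i f \<and> (\<forall>j\<in>S. P j f)} =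
      measure_pmf.prob (Pi_pmf A d p) {f. P i f} * measure_pmf.prob (Pi_pmf A d p) {f. \<forall>j\<in>S. P j f}"
  proof (rule prob_Pi_pmf_indep[OF A, of "F i" "\<Union>j\<in>S. F j"])
    show "F i \<inter> (\<Union>j\<in>S. F j) = {}"
      using insert.prems(1) insert.hyps(2) by (fastforce simp: disjoint_family_on_def)
    show "P i g" if "\<And>e. e \<in> F i \<Longrightarrow> f e = g e" "P i f" for f g
      using insert.prems(2) that by blast
    show "\<forall>j\<in>S. P j g" if "\<And>e. e \<in> (\<Union>j\<in>S. F j) \<Longrightarrow> f e = g e" "\<forall>j\<in>S. P j f" for f g
    proof
      fix j assume "j \<in> S"
      show "P j g"
        by (rule insert.prems(2)[of j f g]) (use that \<open>j \<in> S\<close> in auto)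
    qed
  qed
  moreover have "measure_pmf.prob (Pi_pmf A d p) {f. \<forall>i\<in>S. P i f} =
         (\<Prod>i\<in>S. measure_pmf.prob (Pi_pmf A d p) {f. P i f})"
    by (rule insert.IH)
      (use insert.prems in \<open>auto simp: disjoint_family_on_def\<close>)
  ultimately show ?case using insert.hyps by simp
qed simp

section \<open>Thinning couplings\<close>

text \<open>A Bernoulli variable with parameter \<open>q * r\<close> is the conjunction of
  independent ones with parameters \<open>q\<close> and \<open>r\<close>. Coordinatewise this
  couples two laws on one space: \<open>Z\<close> deletes entries of \<open>Y\<close>
  independently.\<close>

lemma Pi_pmf_bernoulli_thinning:
  fixes p q r :: "'a \<Rightarrow> real"
  assumes A: "finite A"
    and q: "\<And>e. e \<in> A \<Longrightarrow> 0 \<le> q e \<and> q e \<le> 1"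
    and r: "\<And>e. e \<in> A \<Longrightarrow> 0 \<le> r e \<and> r e \<le> 1"
    and p: "\<And>e. e \<in> A \<Longrightarrow> p e = q e * r e"
  shows "Pi_pmf A False (\<lambda>e. bernoulli_pmf (p e)) =
     map_pmf (\<lambda>(Y, Z) e. Y e \<and> Z e)
       (pair_pmf (Pi_pmf A False (\<lambda>e. bernoulli_pmf (q e))) (Pi_pmf A False (\<lambda>e. bernoulli_pmf (r e))))"
proof -
  have one: "bernoulli_pmf (p e) =
      bind_pmf (bernoulli_pmf (q e)) (\<lambda>y. bind_pmf (bernoulli_pmf (r e)) (\<lambda>z. return_pmf (y \<and> z)))"
    if "e \<in> A" for e
  proof -
    have "0 \<le> p e" "p e \<le> 1" using q[OF that] r[OF that] p[OF that] by (auto simp: mult_le_one)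
    then have "pmf (bernoulli_pmf (p e)) True = pmf (bind_pmf (bernoulli_pmf (q e))
        (\<lambda>y. bind_pmf (bernoulli_pmf (r e)) (\<lambda>z. return_pmf (y \<and> z)))) True"
      using q[OF that] r[OF that] p[OF that] by (simp add: pmf_bind indicator_def)
    moreover from this have "pmf (bernoulli_pmf (p e)) False = pmf (bind_pmf (bernoulli_pmf (q e))
        (\<lambda>y. bind_pmf (bernoulli_pmf (r e)) (\<lambda>z. return_pmf (y \<and> z)))) False"
      by (simp only: pmf_False_conv_True)
    ultimately show ?thesis by (intro pmf_eqI) (metis (full_types))
  qed
  have "Pi_pmf A False (\<lambda>e. bernoulli_pmf (p e)) = Pi_pmf A False (\<lambda>e.
      bind_pmf (bernoulli_pmf (q e)) (\<lambda>y. bind_pmf (bernoulli_pmf (r e)) (\<lambda>z. return_pmf (y \<and> z))))"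
    by (rule Pi_pmf_cong) (use one in auto)
  also have "\<dots> = bind_pmf (Pi_pmf A False (\<lambda>e. bernoulli_pmf (q e))) (\<lambda>Y.
      bind_pmf (Pi_pmf A False (\<lambda>e. bernoulli_pmf (r e))) (\<lambda>Z. return_pmf (\<lambda>e. if e \<in> A then Y e \<and> Z e else False)))"
    using A by (simp add: Pi_pmf_bind[where d' = False])
  \<comment> \<open>Off \<open>A\<close> the sampled \<open>Y\<close> is already
    \<open>False\<close>, so the case distinction disappears.\<close>
  also have "\<dots> = bind_pmf (Pi_pmf A False (\<lambda>e. bernoulli_pmf (q e))) (\<lambda>Y.
      bind_pmf (Pi_pmf A False (\<lambda>e. bernoulli_pmf (r e))) (\<lambda>Z. return_pmf (\<lambda>e. Y e \<and> Z e)))"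
    using set_Pi_pmf_subset[OF A, of False "\<lambda>e. bernoulli_pmf (q e)"]
    by (intro bind_pmf_cong refl arg_cong[of _ _ return_pmf] ext) auto
  finally show ?thesis by (simp add: pair_pmf_def map_pmf_def bind_assoc_pmf bind_return_pmf)
qed

lemma prob_Pi_pmf_bernoulli_mono:
  fixes p q :: "'a \<Rightarrow> real"
  assumes A: "finite A" and pq: "\<And>e. e \<in> A \<Longrightarrow> 0 \<le> p e \<and> p e \<le> q e \<and> q e \<le> 1"
    and P: "\<And>f g. (\<And>e. f e \<Longrightarrow> g e) \<Longrightarrow> P f \<Longrightarrow> P g"
  shows "measure_pmf.prob (Pi_pmf A False (\<lambda>e. bernoulli_pmf (p e))) {f. P f} \<le>
         measure_pmf.prob (Pi_pmf A False (\<lambda>e. bernoulli_pmf (q e))) {f. P f}"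
proof -
  \<comment> \<open>Where \<open>q e = 0\<close> also \<open>p e = 0\<close>, and
    \<open>x / 0 = 0\<close> keeps \<open>p e = q e * r e\<close> true.\<close>
  define r where "r = (\<lambda>e. p e / q e)"
  define M where "M = Pi_pmf A False (\<lambda>e. bernoulli_pmf (q e))"
  define N where "N = Pi_pmf A False (\<lambda>e. bernoulli_pmf (r e))"
  have "Pi_pmf A False (\<lambda>e. bernoulli_pmf (p e)) = map_pmf (\<lambda>(Y, Z) e. Y e \<and> Z e) (pair_pmf M N)"
    unfolding M_def N_def
  proof (rule Pi_pmf_bernoulli_thinning[OF A])
    fix e assume "e \<in> A"
    from pq[OF this] show "0 \<le> q e \<and> q e \<le> 1" "0 \<le> r e \<and> r e \<le> 1" "p e = q e * r e"
      by (auto simp: r_def divide_simps)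
  qed
  then have "measure_pmf.prob (Pi_pmf A False (\<lambda>e. bernoulli_pmf (p e))) {f. P f} =
      measure_pmf.prob (pair_pmf M N) {(Y, Z). P (\<lambda>e. Y e \<and> Z e)}"
    by (simp add: vimage_def case_prod_unfold)
  also have "\<dots> \<le> measure_pmf.prob (pair_pmf M N) {(Y, Z). P Y}"
  proof (intro measure_pmf.finite_measure_mono subsetI)
    fix x assume "x \<in> {(Y, Z). P (\<lambda>e. Y e \<and> Z e)}"
    then show "x \<in> {(Y, Z). P Y}" using P[of "\<lambda>e. fst x e \<and> snd x e" "fst x"] by auto
  qed auto
  also have "\<dots> = measure_pmf.prob (map_pmf fst (pair_pmf M N)) {f. P f}"
    by (simp add: vimage_def case_prod_unfold)
  finally show ?thesis by (simp only: map_fst_pair_pmf M_def)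
qed

text \<open>
  The set \<open>F\<close> is a certificate for \<open>P Y\<close>: if no edge of \<open>F\<close> is lost when \<open>Y\<close> is thinned from the
  law with parameters \<open>q\<close> to the law with parameters \<open>p\<close>, then \<open>P\<close> survives.
\<close>
lemma prob_Pi_pmf_bernoulli_certificate:
  fixes p q :: "'a \<Rightarrow> real"
  assumes A: "finite A" and pq: "\<And>e. e \<in> A \<Longrightarrow> 0 < p e \<and> p e \<le> q e \<and> q e \<le> 1"
    and cert: "\<And>Y. P Y \<Longrightarrow> \<not> Bad Y \<Longrightarrow> (\<And>e. Y e \<Longrightarrow> e \<in> A) \<Longrightarrow>
      \<exists>F\<subseteq>A. (\<forall>e\<in>F. Y e) \<and> (\<forall>Y'. (\<forall>e\<in>F. Y' e) \<longrightarrow> P Y') \<and> (\<Sum>e\<in>F. 1 - p e / q e) \<le> \<delta>"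
    and \<delta>: "0 \<le> \<delta>"
  shows "measure_pmf.prob (Pi_pmf A False (\<lambda>e. bernoulli_pmf (q e))) {f. P f} \<le>
         measure_pmf.prob (Pi_pmf A False (\<lambda>e. bernoulli_pmf (p e))) {f. P f} + \<delta> +
         measure_pmf.prob (Pi_pmf A False (\<lambda>e. bernoulli_pmf (q e))) {f. Bad f}"
proof -
  define r where "r = (\<lambda>e. p e / q e)"
  define M where "M = Pi_pmf A False (\<lambda>e. bernoulli_pmf (q e))"
  define N where "N = Pi_pmf A False (\<lambda>e. bernoulli_pmf (r e))"
  have r: "0 \<le> r e \<and> r e \<le> 1" if "e \<in> A" for e
    using pq[OF that] by (auto simp: r_def divide_simps)
  have pm: "Pi_pmf A False (\<lambda>e. bernoulli_pmf (p e)) = map_pmf (\<lambda>(Y, Z) e. Y e \<and> Z e) (pair_pmf M N)"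
    unfolding M_def N_def
  proof (rule Pi_pmf_bernoulli_thinning[OF A _ r])
    fix e assume "e \<in> A"
    from pq[OF this] show "0 \<le> q e \<and> q e \<le> 1" "p e = q e * r e"
      by (auto simp: r_def divide_simps)
  qed
  define X where "X = {(Y, Z). P (\<lambda>e. Y e \<and> Z e)}"
  define XP where "XP = {(Y::'a \<Rightarrow> bool, Z::'a \<Rightarrow> bool). P Y}"
  define XB where "XB = {(Y::'a \<Rightarrow> bool, Z::'a \<Rightarrow> bool). Bad Y}"
  \<comment> \<open>The failure event of the coupling: a property certified in \<open>Y\<close> is
    lost by thinning.\<close>
  define W where "W = {(Y, Z). P Y \<and> \<not> Bad Y \<and> \<not> P (\<lambda>e. Y e \<and> Z e)}"
  have comp: "measure_pmf.prob N {f. f e} = r e" if "e \<in> A" for e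
  proof -
    have "measure_pmf.prob N {f. f e} = measure_pmf.prob (map_pmf (\<lambda>f. f e) N) {True}"
      by (simp add: vimage_def)
    also have "\<dots> = r e"
      using that r[OF that] A by (simp add: N_def Pi_pmf_component measure_pmf_single)
    finally show ?thesis .
  qed
  have W: "measure_pmf.prob (pair_pmf M N) W \<le> \<delta>"
  proof -
    have "measure_pmf.prob N {Z. (Y, Z) \<in> W} \<le> \<delta>" if Y: "Y \<in> set_pmf M" for Y
    proof (cases "P Y \<and> \<not> Bad Y")
      case False
      then have "{Z. (Y, Z) \<in> W} = {}" by (auto simp: W_def)
      then show ?thesis using \<delta> by simp
    next
      case True
      have "e \<in> A" if "Y e" for e
        using set_Pi_pmf_subset[OF A, of False "\<lambda>e. bernoulli_pmf (q e)"] Y that by (auto simp: M_def)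
      with True cert[of Y] obtain F where F: "F \<subseteq> A" "\<forall>e\<in>F. Y e"
        "\<And>Y'. (\<forall>e\<in>F. Y' e) \<Longrightarrow> P Y'" "(\<Sum>e\<in>F. 1 - p e / q e) \<le> \<delta>" by blast
      have fin: "finite F" using F(1) A finite_subset by blast
      \<comment> \<open>The certificate \<open>F\<close> depends on \<open>Y\<close> only, and
        \<open>Z\<close> is independent of \<open>Y\<close>; so for fixed \<open>Y\<close> a union
        bound over the deletions in \<open>F\<close> applies.\<close>
      have "{Z. (Y, Z) \<in> W} \<subseteq> (\<Union>e\<in>F. {Z. \<not> Z e})"
      proof safe
        fix Z assume Z: "(Y, Z) \<in> W"
        show "Z \<in> (\<Union>e\<in>F. {Z. \<not> Z e})"
        proof (rule ccontr)
          assume "Z \<notin> (\<Union>e\<in>F. {Z. \<not> Z e})"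
          then have "\<forall>e\<in>F. Y e \<and> Z e" using F(2) by auto
          then have "P (\<lambda>e. Y e \<and> Z e)" by (rule F(3))
          then show False using Z by (auto simp: W_def)
        qed
      qed
      then have "measure_pmf.prob N {Z. (Y, Z) \<in> W} \<le> measure_pmf.prob N (\<Union>e\<in>F. {Z. \<not> Z e})"
        by (intro measure_pmf.finite_measure_mono) auto
      also have "\<dots> \<le> (\<Sum>e\<in>F. measure_pmf.prob N {Z. \<not> Z e})"
        by (rule measure_pmf.finite_measure_subadditive_finite) (use fin in auto)
      also have "\<dots> = (\<Sum>e\<in>F. 1 - r e)"
      proof (rule sum.cong[OF refl])
        fix e assume "e \<in> F"
        have "measure_pmf.prob N {Z. \<not> Z e} = 1 - measure_pmf.prob N {Z. Z e}"
          using measure_pmf.prob_compl[of "{Z. Z e}" N] by (simp add: Compl_eq_Diff_UNIV[symmetric] Collect_neg_eq)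
        then show "measure_pmf.prob N {Z. \<not> Z e} = 1 - r e" using comp \<open>e \<in> F\<close> F(1) by auto
      qed
      finally show ?thesis using F(4) by (simp add: r_def)
    qed
    then have "measure_pmf.prob (pair_pmf M N) W \<le> measure_pmf.expectation M (\<lambda>_. \<delta>)"
      unfolding prob_pair_pmf by (intro expectation_mono_pmf[where B = "max 1 \<delta>"]) (use \<delta> in \<open>auto simp: le_max_iff_disj\<close>)
    then show ?thesis by simp
  qed
  have fs: "measure_pmf.prob M Q = measure_pmf.prob (pair_pmf M N) {(Y, Z). Y \<in> Q}" for Q
  proof -
    have "measure_pmf.prob M Q = measure_pmf.prob (map_pmf fst (pair_pmf M N)) Q"
      by (simp only: map_fst_pair_pmf)
    then show ?thesis by (simp add: vimage_def case_prod_unfold)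
  qed
  have "measure_pmf.prob (pair_pmf M N) XP \<le> measure_pmf.prob (pair_pmf M N) (X \<union> W \<union> XB)"
    by (intro measure_pmf.finite_measure_mono) (auto simp: X_def W_def XB_def XP_def)
  also have "\<dots> \<le> measure_pmf.prob (pair_pmf M N) X + measure_pmf.prob (pair_pmf M N) W
      + measure_pmf.prob (pair_pmf M N) XB"
    using measure_Un_le[of "X \<union> W" "pair_pmf M N" XB] measure_Un_le[of X "pair_pmf M N" W] by simp
  also have "measure_pmf.prob (pair_pmf M N) X = measure_pmf.prob (Pi_pmf A False (\<lambda>e. bernoulli_pmf (p e))) {f. P f}"
    unfolding pm X_def by (simp add: vimage_def case_prod_unfold)
  finally show ?thesis
    unfolding M_def[symmetric] using W fs[of "{f. P f}"] fs[of "{f. Bad f}"] by (simp add: XP_def XB_def)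
qed

section \<open>Tail bounds for sums of Bernoulli variables\<close>

text \<open>In the expansion of the exponential the linear term averages to 0 and the quadratic one
  to the variance \<open>p * (1 - p)\<close>. Keeping the factor \<open>1 - p\<close> is what later
  produces \<open>1 - \<theta>\<close> in the constant.\<close>

lemma bernoulli_mgf_le:
  fixes p t :: real
  assumes p: "0 \<le> p" "p \<le> 1" and t: "\<bar>t\<bar> \<le> 1"
  shows "measure_pmf.expectation (bernoulli_pmf p) (\<lambda>y. exp (t * (of_bool y - p)))
          \<le> exp (t\<^sup>2 / 2 * (1 + \<bar>t\<bar>) * (p * (1 - p)))"
proof -
  have *: "exp (t * x) \<le> 1 + t * x + t\<^sup>2 / 2 * (1 + \<bar>t\<bar>) * x\<^sup>2" if "\<bar>x\<bar> \<le> 1" for x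
  proof -
    have le: "\<bar>t * x\<bar> \<le> \<bar>t\<bar>" using that by (simp add: abs_mult mult_left_le)
    then have "exp (t * x) \<le> 1 + t * x + (t * x)\<^sup>2 / 2 * (1 + \<bar>t * x\<bar>)"
      using t by (intro exp_le_quadratic_cubic) auto
    also have "\<dots> \<le> 1 + t * x + (t * x)\<^sup>2 / 2 * (1 + \<bar>t\<bar>)"
      using le by (intro add_left_mono mult_left_mono) auto
    also have "\<dots> = 1 + t * x + t\<^sup>2 / 2 * (1 + \<bar>t\<bar>) * x\<^sup>2" by (simp add: power_mult_distrib)
    finally show ?thesis .
  qed
  let ?c = "t\<^sup>2 / 2 * (1 + \<bar>t\<bar>)"
  have "measure_pmf.expectation (bernoulli_pmf p) (\<lambda>y. exp (t * (of_bool y - p)))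
      = p * exp (t * (1 - p)) + (1 - p) * exp (t * (- p))"
    using p by simp
  also have "\<dots> \<le> p * (1 + t * (1 - p) + ?c * (1 - p)\<^sup>2) + (1 - p) * (1 + t * (- p) + ?c * (- p)\<^sup>2)"
    using p by (intro add_mono mult_left_mono *) auto
  also have "\<dots> = 1 + ?c * (p * (1 - p))"
    by (simp add: field_simps power2_eq_square)
  also have "\<dots> \<le> exp (?c * (p * (1 - p)))"
    by (rule exp_ge_add_one_self)
  finally show ?thesis .
qed

lemma card_filter_eq_sum: "finite F \<Longrightarrow> real (card {e\<in>F. f e}) = (\<Sum>e\<in>F. of_bool (f e))"
  by (simp add: of_bool_def sum.If_cases Int_def)

text \<open>Markov's inequality for the exponential moment. The deviation is multiplied by
  \<open>t\<close> inside the event, so positive \<open>t\<close> yields upper tails and negative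
  \<open>t\<close> lower tails.\<close>

lemma chernoff_Pi_pmf:
  fixes p :: "'a \<Rightarrow> real"
  assumes A: "finite A" "F \<subseteq> A" and p: "\<And>e. e \<in> A \<Longrightarrow> 0 \<le> p e \<and> p e \<le> 1"
    and t: "\<bar>t\<bar> \<le> 1" and V: "(\<Sum>e\<in>F. p e * (1 - p e)) \<le> V"
  shows "measure_pmf.prob (Pi_pmf A False (\<lambda>e. bernoulli_pmf (p e)))
           {f. y \<le> t * (real (card {e\<in>F. f e}) - (\<Sum>e\<in>F. p e))}
         \<le> exp (t\<^sup>2 / 2 * (1 + \<bar>t\<bar>) * V - y)"
proof -
  define M where "M = Pi_pmf A False (\<lambda>e. bernoulli_pmf (p e))"
  define g where "g = (\<lambda>e y. if e \<in> F then exp (t * (of_bool y - p e)) else 1)"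
  let ?X = "\<lambda>f. exp (t * (real (card {e\<in>F. f e}) - (\<Sum>e\<in>F. p e)))"
  have F: "finite F" using A finite_subset by auto
  have X: "?X f = (\<Prod>e\<in>A. g e (f e))" for f
  proof -
    have "?X f = (\<Prod>e\<in>F. exp (t * (of_bool (f e) - p e)))"
      by (simp add: card_filter_eq_sum[OF F] sum_subtractf[symmetric] sum_distrib_left exp_sum[OF F, symmetric])
    also have "\<dots> = (\<Prod>e\<in>A. g e (f e))"
      using A by (intro prod.mono_neutral_cong_left) (auto simp: g_def)
    finally show ?thesis .
  qed
  have int: "integrable (measure_pmf (bernoulli_pmf (p e))) (g e)" for e
    by (rule integrable_measure_pmf_finite) auto
  have Xint: "integrable (measure_pmf M) ?X"
    unfolding X M_def by (rule integrable_prod_Pi_pmf[OF A(1) int])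
  have "measure_pmf.prob M {f. y \<le> t * (real (card {e\<in>F. f e}) - (\<Sum>e\<in>F. p e))}
      = measure_pmf.prob M {f \<in> space M. exp y \<le> ?X f}"
    by simp
  also have "\<dots> \<le> measure_pmf.expectation M ?X / exp y"
    by (rule integral_Markov_inequality_measure[where A = "{}"]) (use Xint in auto)
  also have "measure_pmf.expectation M ?X = (\<Prod>e\<in>A. measure_pmf.expectation (bernoulli_pmf (p e)) (g e))"
    unfolding X M_def by (rule expectation_prod_Pi_pmf) (use A int in \<open>auto simp: g_def\<close>)
  also have "\<dots> \<le> (\<Prod>e\<in>A. if e \<in> F then exp (t\<^sup>2 / 2 * (1 + \<bar>t\<bar>) * (p e * (1 - p e))) else 1)"
  proof (rule prod_mono, safe)
    fix e assume "e \<in> A"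
    show "0 \<le> measure_pmf.expectation (bernoulli_pmf (p e)) (g e)"
      by (rule integral_nonneg_AE) (auto simp: g_def)
    show "measure_pmf.expectation (bernoulli_pmf (p e)) (g e)
        \<le> (if e \<in> F then exp (t\<^sup>2 / 2 * (1 + \<bar>t\<bar>) * (p e * (1 - p e))) else 1)"
      using bernoulli_mgf_le[OF _ _ t, of "p e"] p[OF \<open>e \<in> A\<close>] by (auto simp: g_def)
  qed
  also have "\<dots> = (\<Prod>e\<in>F. exp (t\<^sup>2 / 2 * (1 + \<bar>t\<bar>) * (p e * (1 - p e))))"
    using A by (intro prod.mono_neutral_cong_right) auto
  also have "\<dots> = exp (t\<^sup>2 / 2 * (1 + \<bar>t\<bar>) * (\<Sum>e\<in>F. p e * (1 - p e)))"
    by (simp add: exp_sum[OF F, symmetric] sum_distrib_left)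
  also have "\<dots> \<le> exp (t\<^sup>2 / 2 * (1 + \<bar>t\<bar>) * V)"
    using V by (simp add: mult_left_mono)
  finally show ?thesis
    by (simp add: M_def divide_right_mono exp_diff)
qed

text \<open>Parameters have to be constant on \<open>F\<close> alone, because the remaining
  coordinates are marginalized out.\<close>

lemma prob_Pi_pmf_card_eq_binomial:
  fixes p :: "'a \<Rightarrow> real"
  assumes A: "finite A" "F \<subseteq> A" and q: "q \<in> {0..1}" and p: "\<And>e. e \<in> F \<Longrightarrow> p e = q"
  shows "measure_pmf.prob (Pi_pmf A False (\<lambda>e. bernoulli_pmf (p e))) {f. Q (card {e\<in>F. f e})}
       = measure_pmf.prob (binomial_pmf (card F) q) {k. Q k}"
proof -
  have F: "finite F" using A finite_subset by auto
  have cong: "Pi_pmf F False (\<lambda>e. bernoulli_pmf (p e)) = Pi_pmf F False (\<lambda>e. bernoulli_pmf q)"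
    by (rule Pi_pmf_cong) (use p in auto)
  have "measure_pmf.prob (binomial_pmf (card F) q) {k. Q k} =
     measure_pmf.prob (Pi_pmf F False (\<lambda>e. bernoulli_pmf (p e))) {f. Q (card {e\<in>F. f e})}"
    by (simp add: binomial_pmf_altdef'[OF F refl q, of False] cong vimage_def)
  also have "\<dots> = measure_pmf.prob (Pi_pmf A False (\<lambda>e. bernoulli_pmf (p e)))
      {f. Q (card {e\<in>F. if e \<in> F then f e else False})}"
    by (simp add: Pi_pmf_subset[OF A] vimage_def)
  also have "(\<lambda>f. {e\<in>F. if e \<in> F then f e else False}) = (\<lambda>f. {e\<in>F. f e})" by auto
  then have "{f. Q (card {e\<in>F. if e \<in> F then f e else False})} = {f. Q (card {e\<in>F. f e})}" by metis
  finally show ?thesis by simp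
qed

lemma chernoff_binomial:
  assumes q: "q \<in> {0..1}" and t: "\<bar>t\<bar> \<le> 1" and V: "real m * (q * (1 - q)) \<le> V"
  shows "measure_pmf.prob (binomial_pmf m q) {k. y \<le> t * (real k - real m * q)}
         \<le> exp (t\<^sup>2 / 2 * (1 + \<bar>t\<bar>) * V - y)"
proof -
  have "measure_pmf.prob (Pi_pmf {..<m} False (\<lambda>e. bernoulli_pmf q))
        {f. y \<le> t * (real (card {e\<in>{..<m}. f e}) - (\<Sum>e\<in>{..<m}. q))}
       \<le> exp (t\<^sup>2 / 2 * (1 + \<bar>t\<bar>) * V - y)"
    by (rule chernoff_Pi_pmf) (use q t V in auto)
  also have "measure_pmf.prob (Pi_pmf {..<m} False (\<lambda>e. bernoulli_pmf q))
        {f. y \<le> t * (real (card {e\<in>{..<m}. f e}) - (\<Sum>e\<in>{..<m}. q))}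
      = measure_pmf.prob (binomial_pmf (card {..<m}) q) {k. y \<le> t * (real k - (\<Sum>e\<in>{..<m}. q))}"
    by (rule prob_Pi_pmf_card_eq_binomial) (use q in auto)
  finally show ?thesis by simp
qed

text \<open>The choice \<open>t = sqrt (2 * c * L / V)\<close> minimizes the Gaussian part of the
  exponent, with value \<open>- c * L\<close>. The correction factor \<open>1 + t\<close> costs
  \<open>c * t * L\<close>, which is below \<open>\<epsilon> * L\<close> once \<open>V / L\<close>
  is large.\<close>

lemma chernoff_moderate:
  fixes c \<epsilon> :: real
  assumes c: "0 < c" and \<epsilon>: "0 < \<epsilon>"
  obtains N where "N > 0" and "\<And>V L. 0 < L \<Longrightarrow> N * L \<le> V \<Longrightarrow>
    \<exists>t. 0 < t \<and> t \<le> 1 \<and> t\<^sup>2 / 2 * (1 + t) * V - t * sqrt (2 * c * V * L) \<le> - (c - \<epsilon>) * L"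
proof
  define \<eta> where "\<eta> = min 1 (\<epsilon> / c)"
  have \<eta>: "0 < \<eta>" "\<eta> \<le> 1" "c * \<eta> \<le> \<epsilon>" using c \<epsilon> by (auto simp: \<eta>_def min_def field_simps)
  \<comment> \<open>Makes \<open>N * L \<le> V\<close> force \<open>t \<le> \<eta>\<close>.\<close>
  define N where "N = 2 * c / \<eta>\<^sup>2"
  show N: "N > 0" using c \<eta> by (simp add: N_def)
  fix V L :: real
  assume L: "0 < L" and NV: "N * L \<le> V"
  have V: "V > 0" using N L NV by (smt (verit) mult_pos_pos)
  define t where "t = sqrt (2 * c * L / V)"
  have t: "0 < t" using c L V by (simp add: t_def)
  have t2: "t\<^sup>2 * V = 2 * c * L" using c L V by (simp add: t_def)
  have "2 * c * L / V \<le> \<eta>\<^sup>2" using NV V \<eta> by (simp add: N_def field_simps)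
  then have t\<eta>: "t \<le> \<eta>" using \<eta> by (simp add: t_def real_le_lsqrt)
  have "t * sqrt (2 * c * V * L) = sqrt ((2 * c * L)\<^sup>2)"
    unfolding t_def real_sqrt_mult[symmetric] using V by (simp add: power2_eq_square)
  also have "\<dots> = 2 * c * L" using c L by simp
  finally have tx: "t * sqrt (2 * c * V * L) = 2 * c * L" .
  have "t\<^sup>2 / 2 * (1 + t) * V = c * L * (1 + t)" using t2 by (simp add: field_simps)
  then have "t\<^sup>2 / 2 * (1 + t) * V - t * sqrt (2 * c * V * L) = - (c - c * t) * L"
    unfolding tx by (simp add: field_simps)
  also have "\<dots> \<le> - (c - \<epsilon>) * L"
  proof (rule mult_right_mono)
    have "c * t \<le> c * \<eta>" using t\<eta> c by simp
    then show "- (c - c * t) \<le> - (c - \<epsilon>)" using \<eta> by simp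
  qed (use L in auto)
  finally show "\<exists>t. 0 < t \<and> t \<le> 1 \<and> t\<^sup>2 / 2 * (1 + t) * V - t * sqrt (2 * c * V * L) \<le> - (c - \<epsilon>) * L"
    using t t\<eta> \<eta> by force
qed

section \<open>Binomial lower bounds by change of measure\<close>

text \<open>The log likelihood ratio of the parameters \<open>q + D\<close> and \<open>q\<close> is
  affine in the count, with nonnegative slope. Within distance \<open>h\<close> of the tilted mean
  it therefore exceeds \<open>m\<close> times the relative entropy by at most \<open>h\<close> times
  the slope.\<close>

lemma binomial_tilt:
  fixes q D :: real
  assumes q: "0 < q" "q < 1" and D: "0 \<le> D" "q + D < 1"
    and I: "I \<subseteq> {k. \<bar>real k - real m * (q + D)\<bar> \<le> h}"
  shows "measure_pmf.prob (binomial_pmf m (q + D)) I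
     * exp (- (real m * ((q + D) * ln ((q + D) / q) + (1 - q - D) * ln ((1 - q - D) / (1 - q)))
              + h * (ln ((q + D) / q) - ln ((1 - q - D) / (1 - q)))))
   \<le> measure_pmf.prob (binomial_pmf m q) I" (is "_ * exp (- ?e) \<le> _")
proof -
  define a where "a = ln ((q + D) / q)"
  define b where "b = ln ((1 - q - D) / (1 - q))"
  have ea: "exp a = (q + D) / q" and eb: "exp b = (1 - q - D) / (1 - q)"
    using q D by (auto simp: a_def b_def)
  have ab: "a \<ge> 0" "b \<le> 0" using q D by (auto simp: a_def b_def ln_le_zero_iff)
  have pw: "pmf (binomial_pmf m (q + D)) k * exp (- ?e) \<le> pmf (binomial_pmf m q) k"
    if k: "k \<in> I" "k \<le> m" for k
  proof -
    have "real k * a + real (m - k) * b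
        = real m * ((q + D) * a + (1 - q - D) * b) + (real k - real m * (q + D)) * (a - b)"
      using k by (simp add: of_nat_diff algebra_simps)
    also have "\<dots> \<le> real m * ((q + D) * a + (1 - q - D) * b) + h * (a - b)"
      using I k ab by (intro add_left_mono mult_right_mono) force+
    also have "\<dots> = ?e" by (simp add: a_def b_def)
    finally have "exp (real k * a + real (m - k) * b) * exp (- ?e) \<le> 1"
      by (simp add: exp_add[symmetric])
    moreover have "exp (real k * a + real (m - k) * b) = ((q + D) / q) ^ k * ((1 - q - D) / (1 - q)) ^ (m - k)"
      by (simp add: exp_add exp_of_nat_mult ea eb)
    moreover have "pmf (binomial_pmf m (q + D)) k
        = pmf (binomial_pmf m q) k * (((q + D) / q) ^ k * ((1 - q - D) / (1 - q)) ^ (m - k))"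
      using q D by (simp add: power_divide diff_diff_eq)
    ultimately have "pmf (binomial_pmf m (q + D)) k * exp (- ?e)
        = pmf (binomial_pmf m q) k * (exp (real k * a + real (m - k) * b) * exp (- ?e))"
      by (simp only: mult.assoc)
    also have "\<dots> \<le> pmf (binomial_pmf m q) k * 1"
      using \<open>exp (real k * a + real (m - k) * b) * exp (- ?e) \<le> 1\<close>
      by (rule mult_left_mono) simp
    finally show ?thesis by simp
  qed
  have fin: "measure_pmf.prob (binomial_pmf m r) I = sum (pmf (binomial_pmf m r)) (I \<inter> {..m})"
    if "0 < r" "r < 1" for r
  proof -
    have "measure_pmf.prob (binomial_pmf m r) I = measure_pmf.prob (binomial_pmf m r) (I \<inter> set_pmf (binomial_pmf m r))"
      by (rule measure_Int_set_pmf[symmetric])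
    then show ?thesis using that by (simp add: measure_measure_pmf_finite)
  qed
  show ?thesis
    using q D pw by (auto simp: fin sum_distrib_right intro!: sum_mono simp del: pmf_binomial)
qed

text \<open>The tilt moves the mean to \<open>4 * sqrt V\<close> above the target level, so a window
  of that radius around the new mean lies beyond the target. The window has tilted probability at
  least 1/2, and the tilt costs \<open>c * L\<close> up to a term of order \<open>sqrt L\<close>;
  hence \<open>L\<close> itself must be large, not only \<open>V / L\<close>.\<close>

lemma binomial_moderate_lower:
  fixes c \<epsilon> :: real
  assumes c: "0 < c" and \<epsilon>: "0 < \<epsilon>"
  obtains N where "N > 0" and "\<And>m q V L. 0 < q \<Longrightarrow> q < 1 \<Longrightarrow> V = real m * (q * (1 - q)) \<Longrightarrow>
    N \<le> L \<Longrightarrow> N * L \<le> V \<Longrightarrow>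
    exp (- (c + \<epsilon>) * L) \<le> measure_pmf.prob (binomial_pmf m q) {k. real m * q + sqrt (2 * c * V * L) < real k}"
proof -
  define \<eta> where "\<eta> = min (1/2) (\<epsilon> / (2 * c))"
  have \<eta>: "0 < \<eta>" "\<eta> \<le> 1/2" "c * \<eta> \<le> \<epsilon> / 2"
    using c \<epsilon> by (auto simp: \<eta>_def min_def field_simps)
  \<comment> \<open>Collects the lower-order costs: \<open>6 * sqrt (2 * c * L) + 12\<close> from
    the entropy, \<open>8 * z\<close> from the window, and 1 to absorb the factor 1/2. The other
    half of \<open>\<epsilon> * L\<close> pays for \<open>c * \<eta> * L\<close>.\<close>
  have "eventually (\<lambda>L. 14 * sqrt (2 * c * L) + 46 \<le> \<epsilon> / 2 * L) at_top"
    using c \<epsilon> by real_asymp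
  then obtain N1 where N1: "\<And>L. N1 \<le> L \<Longrightarrow> 14 * sqrt (2 * c * L) + 46 \<le> \<epsilon> / 2 * L"
    by (auto simp: eventually_at_top_linorder)
  \<comment> \<open>The last entry ensures \<open>z \<le> \<eta> * sqrt V\<close>, that is, a small
    relative tilt.\<close>
  define N where "N = max (max 1 N1) ((4 * c + 32) / \<eta>\<^sup>2)"
  have N: "1 \<le> N" "N1 \<le> N" "4 * c + 32 \<le> \<eta>\<^sup>2 * N"
  proof -
    have "(4 * c + 32) / \<eta>\<^sup>2 \<le> N" by (simp add: N_def)
    then show "4 * c + 32 \<le> \<eta>\<^sup>2 * N" using \<eta> by (simp add: field_simps)
  qed (auto simp: N_def)
  show ?thesis
  proof (rule that[of N])
    show "N > 0" using N by simp
    fix m :: nat and q V L :: real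
    assume q: "0 < q" "q < 1" and V: "V = real m * (q * (1 - q))" and L: "N \<le> L" and NV: "N * L \<le> V"
    have L1: "1 \<le> L" using L N by simp
    have "1 * 1 \<le> N * L" using N L1 by (intro mult_mono) auto
    then have V1: "1 \<le> V" using NV by simp
    then have m: "real m > 0" using V by (cases m) auto
    have q': "0 < q * (1 - q)" "q * (1 - q) \<le> q" "q * (1 - q) \<le> 1 - q" using q by auto
    define z where "z = sqrt (2 * c * L) + 4"
    have z: "4 \<le> z" using c L1 by (simp add: z_def)
    have z2: "z\<^sup>2 = 2 * c * L + 8 * sqrt (2 * c * L) + 16"
      using c L1 by (simp add: z_def power2_sum)
    have "8 * sqrt (2 * c * L) \<le> 2 * c * L + 16"
    proof -
      have "0 \<le> (sqrt (2 * c * L) - 4)\<^sup>2" by simp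
      also have "(sqrt (2 * c * L) - 4)\<^sup>2 = 2 * c * L + 16 - 8 * sqrt (2 * c * L)"
        using c L1 by (simp add: power2_diff)
      finally show ?thesis by simp
    qed
    then have "z\<^sup>2 \<le> 4 * c * L + 32" using z2 by linarith
    also have "\<dots> \<le> (4 * c + 32) * L" using L1 by (simp add: field_simps)
    also have "\<dots> \<le> (\<eta>\<^sup>2 * N) * L" using N L1 by (intro mult_right_mono) auto
    also have "\<dots> = \<eta>\<^sup>2 * (N * L)" by simp
    also have "\<dots> \<le> \<eta>\<^sup>2 * V" using NV by (intro mult_left_mono) auto
    finally have "z\<^sup>2 \<le> \<eta>\<^sup>2 * V" .
    moreover have "(\<eta> * sqrt V)\<^sup>2 = \<eta>\<^sup>2 * V" using V1 by (simp add: power_mult_distrib)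
    ultimately have "z\<^sup>2 \<le> (\<eta> * sqrt V)\<^sup>2" by (simp only:)
    then have zV: "z \<le> \<eta> * sqrt V" by (rule power2_le_imp_le) (use \<eta> V1 in simp)
    define x where "x = sqrt (2 * c * V * L)"
    define h where "h = 4 * sqrt V"
    define D where "D = (x + h) / real m"
    have xh: "x + h = z * sqrt V"
      by (simp add: x_def h_def z_def real_sqrt_mult algebra_simps)
    have D0: "0 \<le> D" using m z V1 unfolding D_def xh by simp
    have Dq: "D / (q * (1 - q)) = z / sqrt V"
    proof -
      have "D / (q * (1 - q)) = z * sqrt V / V" unfolding D_def xh V by simp
      also have "\<dots> = z / sqrt V"
        using V1 real_sqrt_mult_self[of V] by (simp add: field_simps)
      finally show ?thesis .
    qed
    have Dq\<eta>: "D / (q * (1 - q)) \<le> \<eta>"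
      unfolding Dq using zV V1 by (simp add: field_simps)
    then have "D \<le> \<eta> * (q * (1 - q))" using q' by (simp add: field_simps)
    also have "\<dots> \<le> 1/2 * (q * (1 - q))" using \<eta> q' by (intro mult_right_mono) auto
    finally have Dle: "D \<le> q / 2" "D \<le> (1 - q) / 2" using q' by auto
    have D1: "q + D < 1" using Dle q by argo
    \<comment> \<open>The strict inequality places every point of the window strictly above the
      target.\<close>
    define I where "I = {k::nat. \<bar>real k - real m * (q + D)\<bar> < h}"
    have mD: "real m * (q + D) = real m * q + x + h" using m by (simp add: D_def field_simps)
    define a where "a = ln ((q + D) / q)"
    define b where "b = ln ((1 - q - D) / (1 - q))"
    have ab: "a - b \<le> 2 * (z / sqrt V)"
    proof -
      have "(q + D) / q = 1 + D / q" using q by (simp add: field_simps)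
      then have "a \<le> D / q" unfolding a_def using D0 q by (simp add: ln_add_one_self_le_self)
      moreover have "- b \<le> 2 * D / (1 - q)"
      proof -
        have "- b = ln ((1 - q) / (1 - q - D))" unfolding b_def using q D1 by (simp add: ln_div)
        also have "\<dots> \<le> (1 - q) / (1 - q - D) - 1" using q D1 by (intro ln_le_minus_one) auto
        also have "\<dots> = D / (1 - q - D)" using D1 by (simp add: field_simps)
        also have "\<dots> \<le> D / ((1 - q) / 2)" using D0 D1 Dle q by (intro divide_left_mono) auto
        finally show ?thesis by (simp add: field_simps)
      qed
      ultimately have "a - b \<le> D / q + 2 * D / (1 - q)" by simp
      also have "\<dots> \<le> 2 * D / q + 2 * D / (1 - q)" using D0 q by (simp add: divide_right_mono)
      also have "\<dots> = 2 * (D / (q * (1 - q)))" using q by (simp add: divide_simps) (simp add: algebra_simps)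
      finally show ?thesis unfolding Dq .
    qed
    have kl: "real m * ((q + D) * a + (1 - q - D) * b) \<le> z\<^sup>2 / 2 * (1 + \<eta>)"
    proof -
      have "real m * ((q + D) * a + (1 - q - D) * b) \<le> real m * (D\<^sup>2 / (2 * (q * (1 - q))) * (1 + \<eta>))"
        unfolding a_def b_def using bernoulli_kl_le[OF q D0 Dq\<eta> \<eta>(2)] by (intro mult_left_mono) auto
      also have "\<dots> = (D / (q * (1 - q)))\<^sup>2 * V / 2 * (1 + \<eta>)"
        unfolding V using q by (simp add: power2_eq_square mult_ac)
      also have "\<dots> = z\<^sup>2 / 2 * (1 + \<eta>)"
        unfolding Dq using V1 by (simp add: power_divide)
      finally show ?thesis .
    qed
    have hab: "h * (a - b) \<le> 8 * z"
    proof -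
      have "h * (a - b) \<le> h * (2 * (z / sqrt V))" using ab V1 by (intro mult_left_mono) (auto simp: h_def)
      also have "\<dots> = 8 * z" using V1 by (simp add: h_def)
      finally show ?thesis .
    qed
    have e: "real m * ((q + D) * a + (1 - q - D) * b) + h * (a - b) + 1 \<le> (c + \<epsilon>) * L"
    proof -
      have "z\<^sup>2 / 2 * (1 + \<eta>) = c * L + (c * \<eta>) * L + (4 * sqrt (2 * c * L) + 8) * (1 + \<eta>)"
        unfolding z2 by (simp add: field_simps)
      also have "\<dots> \<le> c * L + \<epsilon> / 2 * L + (4 * sqrt (2 * c * L) + 8) * (1 + 1/2)"
        using \<eta> L1 c by (intro add_mono mult_left_mono mult_right_mono) auto
      finally have "z\<^sup>2 / 2 * (1 + \<eta>) \<le> c * L + \<epsilon> / 2 * L + (6 * sqrt (2 * c * L) + 12)" by argo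
      moreover have "14 * sqrt (2 * c * L) + 46 \<le> \<epsilon> / 2 * L" using N1 N L by simp
      moreover have "(c + \<epsilon>) * L = c * L + \<epsilon> * L" by (rule distrib_right)
      ultimately show ?thesis using kl hab unfolding z_def by argo
    qed
    have PI: "1 / 2 \<le> measure_pmf.prob (binomial_pmf m (q + D)) I"
    proof -
      let ?B = "binomial_pmf m (q + D)"
      have "(q + D) * (1 - (q + D)) \<le> (2 * q) * (1 - q)"
        using q D0 Dle D1 by (intro mult_mono) auto
      then have V': "real m * ((q + D) * (1 - (q + D))) \<le> 2 * V"
        using V mult_left_mono[of "(q + D) * (1 - (q + D))" "2 * q * (1 - q)" "real m"] by simp
      \<comment> \<open>The tilted variance is at most \<open>2 * V\<close>, so \<open>t\<close> of
        size \<open>1 / sqrt V\<close> gives the exponent at most 2 - 4 on each side.\<close>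
      have one: "measure_pmf.prob ?B {k. 4 \<le> t * (real k - real m * (q + D))} \<le> 1 / 4"
        if t: "\<bar>t\<bar> = 1 / sqrt V" for t
      proof -
        have t1: "\<bar>t\<bar> \<le> 1" using t V1 by simp
        have "\<bar>t\<bar>\<^sup>2 = 1 / V" unfolding t using V1 by (simp add: power_divide)
        then have t2: "t\<^sup>2 = 1 / V" by simp
        have "measure_pmf.prob ?B {k. 4 \<le> t * (real k - real m * (q + D))}
            \<le> exp (t\<^sup>2 / 2 * (1 + \<bar>t\<bar>) * (2 * V) - 4)"
          by (rule chernoff_binomial) (use q D0 D1 t1 V' in auto)
        also have "\<dots> \<le> exp (- 2)" using t1 t2 V1 by simp
        also have "\<dots> \<le> 1 / 4"
        proof -
          have "2 \<le> exp (1::real)" using exp_ge_add_one_self[of 1] by simp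
          then have "2 * 2 \<le> exp (1::real) * exp 1" by (intro mult_mono) auto
          then have "4 \<le> exp (2::real)" by (simp add: exp_add[symmetric])
          then show ?thesis by (simp add: exp_minus field_simps)
        qed
        finally show ?thesis .
      qed
      have "UNIV - I \<subseteq> {k. 4 \<le> (1 / sqrt V) * (real k - real m * (q + D))} \<union>
          {k. 4 \<le> (- 1 / sqrt V) * (real k - real m * (q + D))}"
        using V1 by (auto simp: I_def h_def abs_if not_less field_simps split: if_splits)
      then have "measure_pmf.prob ?B (UNIV - I) \<le> measure_pmf.prob ?B
          ({k. 4 \<le> (1 / sqrt V) * (real k - real m * (q + D))} \<union>
          {k. 4 \<le> (- 1 / sqrt V) * (real k - real m * (q + D))})"
        by (rule measure_pmf.finite_measure_mono) auto
      also have "\<dots> \<le> 1 / 4 + 1 / 4"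
        by (rule order_trans[OF measure_Un_le add_mono[OF one one]]) (use V1 in auto)
      finally show ?thesis using measure_pmf.prob_compl[of I ?B] by simp
    qed
    let ?e = "real m * ((q + D) * a + (1 - q - D) * b) + h * (a - b)"
    have "exp (- (c + \<epsilon>) * L) \<le> exp (- ?e - 1)"
      using e by (simp only: exp_le_cancel_iff mult_minus_left)
    also have "\<dots> = exp (- 1) * exp (- ?e)" by (simp add: exp_add[symmetric])
    also have "\<dots> \<le> 1 / 2 * exp (- ?e)"
      using exp_ge_add_one_self[of 1] by (intro mult_right_mono) (auto simp: exp_minus field_simps)
    also have "\<dots> \<le> measure_pmf.prob (binomial_pmf m (q + D)) I * exp (- ?e)"
      using PI by (intro mult_right_mono) auto
    also have "\<dots> \<le> measure_pmf.prob (binomial_pmf m q) I"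
      unfolding a_def b_def by (rule binomial_tilt) (use q D0 D1 in \<open>auto simp: I_def\<close>)
    also have "\<dots> \<le> measure_pmf.prob (binomial_pmf m q) {k. real m * q + sqrt (2 * c * V * L) < real k}"
      by (rule measure_pmf.finite_measure_mono) (auto simp: I_def mD x_def[symmetric])
    finally show "exp (- (c + \<epsilon>) * L) \<le>
        measure_pmf.prob (binomial_pmf m q) {k. real m * q + sqrt (2 * c * V * L) < real k}" .
  qed
qed

section \<open>Degrees in inhomogeneous random graphs\<close>

definition edge_between :: "nat \<Rightarrow> nat \<Rightarrow> nat \<times> nat" where
  "edge_between i j = (min i j, max i j)"

definition random_graph :: "nat \<Rightarrow> (nat \<times> nat \<Rightarrow> real) \<Rightarrow> (nat \<times> nat \<Rightarrow> bool) pmf" where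
  "random_graph n P = Pi_pmf (vertex_pairs n) False (\<lambda>e. bernoulli_pmf (P e))"

text \<open>Removing \<open>i\<close> allows the same notion for vertices inside and outside
  \<open>T\<close>: the full degree, the degree within a block, and the degree across a cut.\<close>

definition degree_in :: "nat set \<Rightarrow> (nat \<times> nat \<Rightarrow> bool) \<Rightarrow> nat \<Rightarrow> nat" where
  "degree_in T E i = card {j\<in>T - {i}. E (edge_between i j)}"

lemma finite_vertex_pairs [simp]: "finite (vertex_pairs n)"
  by (rule finite_subset[of _ "{1..n} \<times> {1..n}"]) (auto simp: vertex_pairs_def)

lemma edge_between_inj: "edge_between i j = edge_between i' j' \<longleftrightarrow> (i = i' \<and> j = j') \<or> (i = j' \<and> j = i')"
  by (auto simp: edge_between_def min_def max_def split: if_splits)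

lemma edge_between_vertex_pairs:
  "i \<in> {1..n} \<Longrightarrow> j \<in> {1..n} \<Longrightarrow> i \<noteq> j \<Longrightarrow> edge_between i j \<in> vertex_pairs n"
  by (auto simp: edge_between_def vertex_pairs_def)

lemma edge_between_image_subset:
  assumes "i \<in> {1..n}" "T \<subseteq> {1..n}" "i \<notin> T"
  shows "edge_between i ` T \<subseteq> vertex_pairs n"
proof (rule image_subsetI)
  fix j assume "j \<in> T"
  with assms show "edge_between i j \<in> vertex_pairs n"
    by (intro edge_between_vertex_pairs) auto
qed

lemma vertex_pairs_edge_between:
  assumes "e \<in> vertex_pairs n"
  obtains i j where "e = edge_between i j" "i \<in> {1..n}" "j \<in> {1..n}" "i < j"
proof -
  obtain i j where "e = (i, j)" by force
  then show ?thesis using assms by (intro that[of i j]) (auto simp: edge_between_def vertex_pairs_def)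
qed

lemma inj_on_edge_between: "inj_on (edge_between i) T"
  by (auto simp: inj_on_def edge_between_inj)

lemma degree_in_alt: "degree_in T E i = card {e \<in> edge_between i ` (T - {i}). E e}"
proof -
  have "{e \<in> edge_between i ` (T - {i}). E e} = edge_between i ` {j\<in>T - {i}. E (edge_between i j)}" by auto
  then show ?thesis by (simp add: degree_in_def card_image inj_on_edge_between)
qed

lemma degree_in_Un:
  "finite T \<Longrightarrow> finite U \<Longrightarrow> T \<inter> U = {} \<Longrightarrow> degree_in (T \<union> U) E i = degree_in T E i + degree_in U E i"
proof -
  assume "finite T" "finite U" "T \<inter> U = {}"
  moreover have "{j\<in>T \<union> U - {i}. E (edge_between i j)} =
      {j\<in>T - {i}. E (edge_between i j)} \<union> {j\<in>U - {i}. E (edge_between i j)}" by auto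
  ultimately show ?thesis unfolding degree_in_def by (simp only:) (rule card_Un_disjoint, auto)
qed

lemma degree_in_mono:
  assumes "finite T" "T' \<subseteq> T" "\<And>e. E' e \<Longrightarrow> E e"
  shows "degree_in T' E' i \<le> degree_in T E i"
  unfolding degree_in_def
proof (rule card_mono)
  show "{j \<in> T' - {i}. E' (edge_between i j)} \<subseteq> {j \<in> T - {i}. E (edge_between i j)}"
    using assms(2,3) by (auto simp: edge_between_def)
qed (use assms(1) in auto)

lemma chernoff_degree:
  assumes P: "\<And>e. e \<in> vertex_pairs n \<Longrightarrow> 0 \<le> P e \<and> P e \<le> 1"
    and i: "i \<in> {1..n}" and T: "T \<subseteq> {1..n}" and t: "\<bar>t\<bar> \<le> 1"
    and V: "(\<Sum>j\<in>T - {i}. P (edge_between i j) * (1 - P (edge_between i j))) \<le> V"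
  shows "measure_pmf.prob (random_graph n P)
           {E. y \<le> t * (real (degree_in T E i) - (\<Sum>j\<in>T - {i}. P (edge_between i j)))}
         \<le> exp (t\<^sup>2 / 2 * (1 + \<bar>t\<bar>) * V - y)"
proof -
  have sub: "edge_between i ` (T - {i}) \<subseteq> vertex_pairs n"
    by (rule edge_between_image_subset) (use i T in auto)
  have "measure_pmf.prob (random_graph n P)
           {E. y \<le> t * (real (card {e \<in> edge_between i ` (T - {i}). E e}) - (\<Sum>e\<in>edge_between i ` (T - {i}). P e))}
         \<le> exp (t\<^sup>2 / 2 * (1 + \<bar>t\<bar>) * V - y)"
    unfolding random_graph_def
    by (rule chernoff_Pi_pmf) (use sub P t V in \<open>auto simp: sum.reindex inj_on_edge_between\<close>)
  then show ?thesis by (simp add: degree_in_alt sum.reindex inj_on_edge_between)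
qed

text \<open>Only edges between \<open>S\<close> and \<open>T\<close> are counted, so the degrees of the vertices in \<open>S\<close> are independent.\<close>
lemma bipartite_max_degree:
  assumes q: "q \<in> {0..1}" and S: "S \<subseteq> {1..n}" and T: "T \<subseteq> {1..n}" and ST: "S \<inter> T = {}"
    and P: "\<And>i j. i \<in> S \<Longrightarrow> j \<in> T \<Longrightarrow> P (edge_between i j) = q"
  shows "measure_pmf.prob (random_graph n P) {E. \<forall>i\<in>S. real (degree_in T E i) \<le> k}
       \<le> exp (- (real (card S) * measure_pmf.prob (binomial_pmf (card T) q) {x. k < real x}))"
proof -
  define F where "F = (\<lambda>i. edge_between i ` (T - {i}))"
  have F: "F i = edge_between i ` T" if "i \<in> S" for i using that ST by (auto simp: F_def)
  define b where "b = measure_pmf.prob (binomial_pmf (card T) q) {x. k < real x}"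
  have one: "measure_pmf.prob (random_graph n P) {E. real (card {e\<in>F i. E e}) \<le> k} = 1 - b" if i: "i \<in> S" for i
  proof -
    have "measure_pmf.prob (random_graph n P) {E. real (card {e\<in>F i. E e}) \<le> k}
        = measure_pmf.prob (binomial_pmf (card (F i)) q) {x. real x \<le> k}"
      unfolding random_graph_def
    proof (rule prob_Pi_pmf_card_eq_binomial)
      show "F i \<subseteq> vertex_pairs n"
        unfolding F[OF i] by (rule edge_between_image_subset) (use i S T ST in auto)
    qed (use i P q in \<open>auto simp: F\<close>)
    also have "card (F i) = card T" unfolding F[OF i] by (rule card_image[OF inj_on_edge_between])
    also have "{x. real x \<le> k} = UNIV - {x::nat. k < real x}" by auto
    finally show ?thesis using measure_pmf.prob_compl[of "{x. k < real x}" "binomial_pmf (card T) q"]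
      by (simp add: b_def)
  qed
  have "measure_pmf.prob (random_graph n P) {E. \<forall>i\<in>S. real (degree_in T E i) \<le> k}
      = measure_pmf.prob (random_graph n P) {E. \<forall>i\<in>S. real (card {e\<in>F i. E e}) \<le> k}"
    by (simp add: degree_in_alt F_def)
  also have "\<dots> = (\<Prod>i\<in>S. measure_pmf.prob (random_graph n P) {E. real (card {e\<in>F i. E e}) \<le> k})"
    unfolding random_graph_def
  proof (rule prob_Pi_pmf_indep_family[where F = F])
    show "finite S" using S finite_subset by auto
    \<comment> \<open>An edge shared by the stars of two different vertices of \<open>S\<close>
      would put one of these vertices in \<open>T\<close>.\<close>
    show "disjoint_family_on F S"
      using ST by (auto simp: disjoint_family_on_def F edge_between_inj)
    fix i and f g :: "nat \<times> nat \<Rightarrow> bool"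
    assume "\<And>e. e \<in> F i \<Longrightarrow> f e = g e" and *: "real (card {e \<in> F i. f e}) \<le> k"
    then have "{e \<in> F i. f e} = {e \<in> F i. g e}" by auto
    with * show "real (card {e \<in> F i. g e}) \<le> k" by simp
  qed simp
  also have "\<dots> = (1 - b) ^ card S" by (simp add: one)
  also have "\<dots> \<le> exp (- b) ^ card S"
    using exp_ge_add_one_self[of "- b"] by (intro power_mono) (auto simp: b_def)
  also have "\<dots> = exp (- (real (card S) * b))" by (simp add: exp_of_nat_mult[symmetric])
  finally show ?thesis by (simp add: b_def)
qed

section \<open>Rejection events and the risk\<close>

text \<open>The rejection event localized to \<open>S\<close>. Degrees are still taken in the whole
  graph and only the witness is restricted, so the event splits into signal and null
  witnesses.\<close>

definition exceeds :: "nat \<Rightarrow> real \<Rightarrow> nat set \<Rightarrow> (nat \<times> nat \<Rightarrow> bool) set" where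
  "exceeds n k S = {E. \<exists>i\<in>S. k < real (degree_in {1..n} E i)}"

definition beta_graph :: "nat \<Rightarrow> real \<Rightarrow> (nat \<Rightarrow> real) \<Rightarrow> (nat \<times> nat \<Rightarrow> bool) pmf" where
  "beta_graph n lam \<beta> = random_graph n (\<lambda>(i, j). edge_prob n lam \<beta> i j)"

lemma vertex_degree_adjacency: "vertex_degree n (adjacency_matrix E) i = degree_in {1..n} E i"
proof -
  have "vertex_degree n (adjacency_matrix E) i = (\<Sum>j\<in>{1..n} - {i}. of_bool (E (edge_between i j)))"
    unfolding vertex_degree_def by (rule sum.cong) (auto simp: adjacency_matrix_def edge_between_def)
  also have "\<dots> = degree_in {1..n} E i"
    by (simp add: degree_in_def of_bool_def sum.If_cases Int_def)
  finally show ?thesis .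
qed

lemma max_degree_test_eq_1_iff:
  assumes "n \<ge> 1"
  shows "max_degree_test n k (adjacency_matrix E) = 1 \<longleftrightarrow> E \<in> exceeds n k {1..n}"
    and "max_degree_test n k (adjacency_matrix E) = 0 \<longleftrightarrow> E \<notin> exceeds n k {1..n}"
proof -
  let ?D = "vertex_degree n (adjacency_matrix E) ` {1..n}"
  have D: "finite ?D" "?D \<noteq> {}" using assms by auto
  have "k < real (Max ?D) \<longleftrightarrow> (\<exists>d\<in>?D. k < real d)"
  proof
    show "k < real (Max ?D) \<Longrightarrow> \<exists>d\<in>?D. k < real d" using Max_in[OF D] by blast
    show "\<exists>d\<in>?D. k < real d \<Longrightarrow> k < real (Max ?D)"
      using Max_ge[OF D(1)] by (meson less_le_trans of_nat_mono)
  qed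
  then show "max_degree_test n k (adjacency_matrix E) = 1 \<longleftrightarrow> E \<in> exceeds n k {1..n}"
    "max_degree_test n k (adjacency_matrix E) = 0 \<longleftrightarrow> E \<notin> exceeds n k {1..n}"
    by (auto simp: max_degree_test_def exceeds_def vertex_degree_adjacency)
qed

lemma beta_model_prob:
  "measure_pmf.prob (beta_model n lam \<beta>) X = measure_pmf.prob (beta_graph n lam \<beta>) {E. adjacency_matrix E \<in> X}"
  by (simp add: beta_model_def beta_graph_def random_graph_def vimage_def case_prod_unfold)

lemma risk_max_degree_test:
  assumes "n \<ge> 1"
  shows "risk n lam (max_degree_test n k) B =
     measure_pmf.prob (beta_graph n lam (\<lambda>_. 0)) (exceeds n k {1..n}) +
     (SUP \<beta>\<in>B. 1 - measure_pmf.prob (beta_graph n lam \<beta>) (exceeds n k {1..n}))"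
proof -
  have "measure_pmf.prob (beta_graph n lam \<beta>) {E. E \<notin> exceeds n k {1..n}} =
      1 - measure_pmf.prob (beta_graph n lam \<beta>) (exceeds n k {1..n})" for \<beta>
    using measure_pmf.prob_compl[of "exceeds n k {1..n}" "beta_graph n lam \<beta>"]
    by (simp add: Compl_eq_Diff_UNIV[symmetric] Compl_eq)
  then show ?thesis
    by (simp only: risk_def beta_model_prob max_degree_test_eq_1_iff[OF assms] mem_Collect_eq Collect_mem_eq)
qed

section \<open>Tails of the extreme degrees\<close>

lemma prob_Bex_le_card:
  assumes S: "finite S" and b: "\<And>i. i \<in> S \<Longrightarrow> measure_pmf.prob M {E. Q i E} \<le> b"
  shows "measure_pmf.prob M {E. \<exists>i\<in>S. Q i E} \<le> real (card S) * b"
proof -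
  have "measure_pmf.prob M {E. \<exists>i\<in>S. Q i E} = measure_pmf.prob M (\<Union>i\<in>S. {E. Q i E})"
    by (rule arg_cong[of _ _ "measure_pmf.prob M"]) auto
  also have "\<dots> \<le> (\<Sum>i\<in>S. measure_pmf.prob M {E. Q i E})"
    by (rule measure_pmf.finite_measure_subadditive_finite) (use S in auto)
  also have "\<dots> \<le> (\<Sum>i\<in>S. b)" by (rule sum_mono) (rule b)
  finally show ?thesis by simp
qed

text \<open>A union bound over \<open>S\<close> with the optimal Chernoff parameter.
  \<open>N\<close> depends on \<open>c\<close> and \<open>\<epsilon>\<close> alone, so the bound can
  be used along a sequence of graphs.\<close>

lemma max_degree_upper_tail:
  fixes c \<epsilon> :: real
  assumes c: "0 < c" and \<epsilon>: "0 < \<epsilon>"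
  obtains N where "N > 0" and "\<And>n P S \<mu> V L k.
    \<lbrakk>\<And>e. e \<in> vertex_pairs n \<Longrightarrow> 0 \<le> P e \<and> P e \<le> 1; S \<subseteq> {1..n};
     \<And>i. i \<in> S \<Longrightarrow> (\<Sum>j\<in>{1..n} - {i}. P (edge_between i j)) \<le> \<mu>;
     \<And>i. i \<in> S \<Longrightarrow> (\<Sum>j\<in>{1..n} - {i}. P (edge_between i j) * (1 - P (edge_between i j))) \<le> V;
     0 < L; N * L \<le> V; \<mu> + sqrt (2 * c * V * L) \<le> k\<rbrakk> \<Longrightarrow>
     measure_pmf.prob (random_graph n P) (exceeds n k S) \<le> real (card S) * exp (- (c - \<epsilon>) * L)"
proof -
  obtain N where N: "N > 0" and t: "\<And>V L. 0 < L \<Longrightarrow> N * L \<le> V \<Longrightarrow>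
    \<exists>t. 0 < t \<and> t \<le> 1 \<and> t\<^sup>2 / 2 * (1 + t) * V - t * sqrt (2 * c * V * L) \<le> - (c - \<epsilon>) * L"
    using chernoff_moderate[OF c \<epsilon>] by blast
  show ?thesis
  proof (rule that[OF N])
    fix n P S \<mu> V L k
    assume P: "\<And>e. e \<in> vertex_pairs n \<Longrightarrow> 0 \<le> P e \<and> P e \<le> 1" and S: "S \<subseteq> {1..n}"
      and \<mu>: "\<And>i. i \<in> S \<Longrightarrow> (\<Sum>j\<in>{1..n} - {i}. P (edge_between i j)) \<le> \<mu>"
      and V: "\<And>i. i \<in> S \<Longrightarrow> (\<Sum>j\<in>{1..n} - {i}. P (edge_between i j) * (1 - P (edge_between i j))) \<le> V"
      and L: "0 < L" "N * L \<le> V" and k: "\<mu> + sqrt (2 * c * V * L) \<le> k"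
    obtain t where t: "0 < t" "t \<le> 1" "t\<^sup>2 / 2 * (1 + t) * V - t * sqrt (2 * c * V * L) \<le> - (c - \<epsilon>) * L"
      using t[OF L] by blast
    show "measure_pmf.prob (random_graph n P) (exceeds n k S) \<le> real (card S) * exp (- (c - \<epsilon>) * L)"
      unfolding exceeds_def
    proof (rule prob_Bex_le_card)
      show "finite S" using S finite_subset by auto
      fix i assume i: "i \<in> S"
      let ?m = "\<Sum>j\<in>{1..n} - {i}. P (edge_between i j)"
      have "measure_pmf.prob (random_graph n P) {E. k < real (degree_in {1..n} E i)}
          \<le> measure_pmf.prob (random_graph n P) {E. t * sqrt (2 * c * V * L) \<le> t * (real (degree_in {1..n} E i) - ?m)}"
        using \<mu>[OF i] k t(1) by (intro measure_pmf.finite_measure_mono) auto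
      also have "\<dots> \<le> exp (t\<^sup>2 / 2 * (1 + \<bar>t\<bar>) * V - t * sqrt (2 * c * V * L))"
        by (rule chernoff_degree) (use i S t V P in auto)
      also have "\<dots> \<le> exp (- (c - \<epsilon>) * L)" using t by simp
      finally show "measure_pmf.prob (random_graph n P) {E. k < real (degree_in {1..n} E i)} \<le> exp (- (c - \<epsilon>) * L)" .
    qed
  qed
qed

text \<open>The counterpart with the tilt \<open>- t\<close>. It controls the edges inside a block,
  whose complement supplies the independent part of the degrees.\<close>

lemma min_degree_lower_tail:
  fixes c \<epsilon> :: real
  assumes c: "0 < c" and \<epsilon>: "0 < \<epsilon>"
  obtains N where "N > 0" and "\<And>n p W V L.
    \<lbrakk>0 \<le> p; p \<le> 1; W \<subseteq> {1..n}; real (card W - 1) * (p * (1 - p)) \<le> V; 0 < L; N * L \<le> V\<rbrakk> \<Longrightarrow>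
     measure_pmf.prob (random_graph n (\<lambda>_. p))
       {E. \<exists>i\<in>W. real (degree_in W E i) \<le> real (card W - 1) * p - sqrt (2 * c * V * L)}
     \<le> real (card W) * exp (- (c - \<epsilon>) * L)"
proof -
  obtain N where N: "N > 0" and t: "\<And>V L. 0 < L \<Longrightarrow> N * L \<le> V \<Longrightarrow>
    \<exists>t. 0 < t \<and> t \<le> 1 \<and> t\<^sup>2 / 2 * (1 + t) * V - t * sqrt (2 * c * V * L) \<le> - (c - \<epsilon>) * L"
    using chernoff_moderate[OF c \<epsilon>] by blast
  show ?thesis
  proof (rule that[OF N])
    fix n p and W :: "nat set" and V L :: real
    assume p: "0 \<le> p" "p \<le> (1::real)" and W: "W \<subseteq> {1..n}"
      and V: "real (card W - 1) * (p * (1 - p)) \<le> V" and L: "0 < L" "N * L \<le> V"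
    obtain t where t: "0 < t" "t \<le> 1" "t\<^sup>2 / 2 * (1 + t) * V - t * sqrt (2 * c * V * L) \<le> - (c - \<epsilon>) * L"
      using t[OF L] by blast
    have fin: "finite W" using W finite_subset by auto
    show "measure_pmf.prob (random_graph n (\<lambda>_. p))
       {E. \<exists>i\<in>W. real (degree_in W E i) \<le> real (card W - 1) * p - sqrt (2 * c * V * L)}
     \<le> real (card W) * exp (- (c - \<epsilon>) * L)"
    proof (rule prob_Bex_le_card[OF fin])
      fix i assume i: "i \<in> W"
      have cW: "card (W - {i}) = card W - 1" using i fin by simp
      have "measure_pmf.prob (random_graph n (\<lambda>_. p))
            {E. real (degree_in W E i) \<le> real (card W - 1) * p - sqrt (2 * c * V * L)}
          = measure_pmf.prob (random_graph n (\<lambda>_. p))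
            {E. t * sqrt (2 * c * V * L) \<le> (- t) * (real (degree_in W E i) - (\<Sum>j\<in>W - {i}. p))}"
      proof (rule arg_cong[of _ _ "measure_pmf.prob _"])
        have "t * sqrt (2 * c * V * L) \<le> (- t) * (real (degree_in W E i) - (\<Sum>j\<in>W - {i}. p)) \<longleftrightarrow>
            sqrt (2 * c * V * L) \<le> real (card W - 1) * p - real (degree_in W E i)" for E
          using mult_le_cancel_left_pos[OF t(1), of "sqrt (2 * c * V * L)" "real (card W - 1) * p - real (degree_in W E i)"]
          by (simp only: sum_constant cW mult_minus_left right_diff_distrib) linarith
        then show "{E. real (degree_in W E i) \<le> real (card W - 1) * p - sqrt (2 * c * V * L)} =
            {E. t * sqrt (2 * c * V * L) \<le> (- t) * (real (degree_in W E i) - (\<Sum>j\<in>W - {i}. p))}"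
          by (auto simp only: le_diff_eq add.commute)
      qed
      also have "\<dots> \<le> exp ((- t)\<^sup>2 / 2 * (1 + \<bar>- t\<bar>) * V - t * sqrt (2 * c * V * L))"
        by (rule chernoff_degree) (use i W p t V cW in auto)
      also have "\<dots> \<le> exp (- (c - \<epsilon>) * L)" using t by simp
      finally show "measure_pmf.prob (random_graph n (\<lambda>_. p))
            {E. real (degree_in W E i) \<le> real (card W - 1) * p - sqrt (2 * c * V * L)} \<le> exp (- (c - \<epsilon>) * L)" .
    qed
  qed
qed

text \<open>Independence across the cut makes the failure probability exponentially small in a lower
  bound for the expected number of exceedances.\<close>

lemma bipartite_max_degree_moderate:
  fixes c \<epsilon> :: real
  assumes c: "0 < c" and \<epsilon>: "0 < \<epsilon>"
  obtains N where "N > 0" and "\<And>n P q S V L k.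
    \<lbrakk>0 < q; q < 1; S \<subseteq> {1..n}; \<And>i j. i \<in> S \<Longrightarrow> j \<in> {1..n} - S \<Longrightarrow> P (edge_between i j) = q;
     V = real (n - card S) * (q * (1 - q)); N \<le> L; N * L \<le> V;
     k \<le> real (n - card S) * q + sqrt (2 * c * V * L)\<rbrakk> \<Longrightarrow>
     measure_pmf.prob (random_graph n P) {E. \<forall>i\<in>S. real (degree_in ({1..n} - S) E i) \<le> k}
       \<le> exp (- (real (card S) * exp (- (c + \<epsilon>) * L)))"
proof -
  obtain N where N: "N > 0" and low: "\<And>m q V L. 0 < q \<Longrightarrow> q < 1 \<Longrightarrow> V = real m * (q * (1 - q)) \<Longrightarrow>
    N \<le> L \<Longrightarrow> N * L \<le> V \<Longrightarrow>
    exp (- (c + \<epsilon>) * L) \<le> measure_pmf.prob (binomial_pmf m q) {k. real m * q + sqrt (2 * c * V * L) < real k}"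
    using binomial_moderate_lower[OF c \<epsilon>] by blast
  show ?thesis
  proof (rule that[OF N])
    fix n P q S V L k
    assume q: "0 < q" "q < (1::real)" and S: "S \<subseteq> {1..n}"
      and P: "\<And>i j. i \<in> S \<Longrightarrow> j \<in> {1..n} - S \<Longrightarrow> P (edge_between i j) = q"
      and V: "V = real (n - card S) * (q * (1 - q))" and L: "N \<le> L" "N * L \<le> V"
      and k: "k \<le> real (n - card S) * q + sqrt (2 * c * V * L)"
    have cT: "card ({1..n} - S) = n - card S" using S by (simp add: card_Diff_subset finite_subset)
    have "measure_pmf.prob (random_graph n P) {E. \<forall>i\<in>S. real (degree_in ({1..n} - S) E i) \<le> k}
       \<le> exp (- (real (card S) * measure_pmf.prob (binomial_pmf (card ({1..n} - S)) q) {x. k < real x}))"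
      by (rule bipartite_max_degree) (use q S P in auto)
    also have "\<dots> \<le> exp (- (real (card S) * exp (- (c + \<epsilon>) * L)))"
    proof -
      have "exp (- (c + \<epsilon>) * L) \<le> measure_pmf.prob (binomial_pmf (n - card S) q)
          {x. real (n - card S) * q + sqrt (2 * c * V * L) < real x}"
        by (rule low[OF q V L])
      also have "\<dots> \<le> measure_pmf.prob (binomial_pmf (n - card S) q) {x. k < real x}"
        using k by (intro measure_pmf.finite_measure_mono) auto
      finally show ?thesis unfolding cT exp_le_cancel_iff neg_le_iff_le
        by (rule mult_left_mono) simp
    qed
    finally show "measure_pmf.prob (random_graph n P) {E. \<forall>i\<in>S. real (degree_in ({1..n} - S) E i) \<le> k}
       \<le> exp (- (real (card S) * exp (- (c + \<epsilon>) * L)))" .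
  qed
qed

section \<open>Monotonicity and thinning of exceedances\<close>

lemma exceeds_mono:
  assumes "\<And>e. E e \<Longrightarrow> E' e" "E \<in> exceeds n k S"
  shows "E' \<in> exceeds n k S"
proof -
  have "real (degree_in {1..n} E i) \<le> real (degree_in {1..n} E' i)" for i
    using degree_in_mono[OF finite_atLeastAtMost order_refl assms(1)] by (rule of_nat_mono)
  then show ?thesis
    using assms(2) less_le_trans unfolding exceeds_def mem_Collect_eq by blast
qed

lemma prob_exceeds_mono:
  assumes "\<And>e. e \<in> vertex_pairs n \<Longrightarrow> 0 \<le> P e \<and> P e \<le> Q e \<and> Q e \<le> 1"
  shows "measure_pmf.prob (random_graph n P) (exceeds n k S) \<le> measure_pmf.prob (random_graph n Q) (exceeds n k S)"
proof -
  have "measure_pmf.prob (random_graph n P) {f. f \<in> exceeds n k S}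
      \<le> measure_pmf.prob (random_graph n Q) {f. f \<in> exceeds n k S}"
    unfolding random_graph_def
  proof (rule prob_Pi_pmf_bernoulli_mono)
    fix f g :: "nat \<times> nat \<Rightarrow> bool"
    assume "\<And>e. f e \<Longrightarrow> g e" "f \<in> exceeds n k S"
    then show "g \<in> exceeds n k S" by (rule exceeds_mono)
  qed (use assms in auto)
  then show ?thesis by (simp only: Collect_mem_eq)
qed

text \<open>
  The degree of a single vertex \<open>j \<notin> S\<close> that exceeds \<open>k\<close> loses an edge under thinning only with
  small probability, even though the total number of edges lost between \<open>S\<close> and its complement
  is typically large.
\<close>
lemma prob_exceeds_outside:
  assumes p: "0 < p" and P: "\<And>e. e \<in> vertex_pairs n \<Longrightarrow> p \<le> P e \<and> P e \<le> 1"
    and S: "S \<subseteq> {1..n}"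
    and out: "\<And>i j. i \<in> {1..n} - S \<Longrightarrow> j \<in> {1..n} - S \<Longrightarrow> i \<noteq> j \<Longrightarrow> P (edge_between i j) = p"
    and cross: "\<And>i j. i \<in> {1..n} - S \<Longrightarrow> j \<in> S \<Longrightarrow> 1 - p / P (edge_between i j) \<le> \<rho>"
    and \<rho>: "0 \<le> \<rho>" and B: "0 \<le> B"
  shows "measure_pmf.prob (random_graph n P) (exceeds n k ({1..n} - S)) \<le>
         measure_pmf.prob (random_graph n (\<lambda>_. p)) (exceeds n k ({1..n} - S)) + \<rho> * B +
         measure_pmf.prob (random_graph n P) {E. \<exists>j\<in>{1..n} - S. B < real (degree_in S E j)}"
proof -
  have "measure_pmf.prob (Pi_pmf (vertex_pairs n) False (\<lambda>e. bernoulli_pmf (P e))) {f. f \<in> exceeds n k ({1..n} - S)} \<le>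
         measure_pmf.prob (Pi_pmf (vertex_pairs n) False (\<lambda>e. bernoulli_pmf p)) {f. f \<in> exceeds n k ({1..n} - S)} + \<rho> * B +
         measure_pmf.prob (Pi_pmf (vertex_pairs n) False (\<lambda>e. bernoulli_pmf (P e))) {f. \<exists>j\<in>{1..n} - S. B < real (degree_in S f j)}"
  proof (rule prob_Pi_pmf_bernoulli_certificate)
    show "finite (vertex_pairs n)" by simp
    show "0 < p \<and> p \<le> P e \<and> P e \<le> 1" if "e \<in> vertex_pairs n" for e using P[OF that] p by simp
    show "0 \<le> \<rho> * B" using \<rho> B by simp
    fix Y
    assume "Y \<in> exceeds n k ({1..n} - S)" and notbad: "\<not> (\<exists>j\<in>{1..n} - S. B < real (degree_in S Y j))"
    then obtain j where j: "j \<in> {1..n} - S" and kj: "k < real (degree_in {1..n} Y j)"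
      by (auto simp: exceeds_def)
    \<comment> \<open>The present edges at the single vertex \<open>j\<close> certify the
      exceedance; every other edge may be lost.\<close>
    define D where "D = {i\<in>{1..n} - {j}. Y (edge_between j i)}"
    define F where "F = edge_between j ` D"
    have "F \<subseteq> vertex_pairs n"
      unfolding F_def by (rule edge_between_image_subset) (use j in \<open>auto simp: D_def\<close>)
    moreover have "\<forall>e\<in>F. Y e" by (auto simp: F_def D_def)
    moreover have "Y' \<in> exceeds n k ({1..n} - S)" if Y': "\<forall>e\<in>F. Y' e" for Y'
    proof -
      have "degree_in {1..n} Y j \<le> degree_in {1..n} Y' j"
        unfolding degree_in_def by (rule card_mono) (use Y' in \<open>auto simp: F_def D_def\<close>)
      then have "k < real (degree_in {1..n} Y' j)" using kj by linarith
      then show ?thesis using j by (auto simp: exceeds_def)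
    qed
    moreover have "(\<Sum>e\<in>F. 1 - p / P e) \<le> \<rho> * B"
    proof -
      have "(\<Sum>e\<in>F. 1 - p / P e) = (\<Sum>i\<in>D. 1 - p / P (edge_between j i))"
        unfolding F_def by (subst sum.reindex[OF inj_on_edge_between]) simp
      \<comment> \<open>Edges from \<open>j\<close> to vertices outside \<open>S\<close> have the
        same probability in both models and cost nothing; the others number at most
        \<open>B\<close>.\<close>
      also have "\<dots> \<le> (\<Sum>i\<in>D. if i \<in> S then \<rho> else 0)"
      proof (rule sum_mono)
        fix i assume "i \<in> D"
        then show "1 - p / P (edge_between j i) \<le> (if i \<in> S then \<rho> else 0)"
          using out[of j i] cross[of j i] j p by (auto simp: D_def)
      qed
      also have "\<dots> = real (card (D \<inter> S)) * \<rho>"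
        by (simp add: sum.If_cases D_def)
      also have "D \<inter> S = {i\<in>S - {j}. Y (edge_between j i)}" using S by (auto simp: D_def)
      also have "real (card \<dots>) = real (degree_in S Y j)" by (simp add: degree_in_def)
      also have "real (degree_in S Y j) * \<rho> \<le> B * \<rho>"
        using notbad j \<rho> by (intro mult_right_mono) (simp_all add: not_less)
      finally show ?thesis by (simp add: mult.commute)
    qed
    ultimately show "\<exists>F\<subseteq>vertex_pairs n. (\<forall>e\<in>F. Y e) \<and>
        (\<forall>Y'. (\<forall>e\<in>F. Y' e) \<longrightarrow> Y' \<in> exceeds n k ({1..n} - S)) \<and> (\<Sum>e\<in>F. 1 - p / P e) \<le> \<rho> * B"
      by blast
  qed
  then show ?thesis by (simp add: random_graph_def)
qed

section \<open>Edge probabilities and the baseline model\<close>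

text \<open>The logistic function is \<open>(1 + tanh (x / 2)) / 2\<close>. A signal thus perturbs
  the null probability by a relative amount \<open>tanh\<close>, which is why the detection boundary
  is expressed through \<open>tanh A\<close>.\<close>

lemma edge_prob_alt:
  "edge_prob n lam \<beta> i j = lam / (2 * real n) * (1 + tanh ((\<beta> i + \<beta> j) / 2))"
proof -
  have "exp x / (1 + exp x) = (1 + tanh (x / 2)) / 2" for x :: real
  proof -
    have e: "exp x = exp (x / 2) * exp (x / 2)" by (simp add: exp_add[symmetric])
    define y where "y = exp (x / 2)"
    have y: "y > 0" by (simp add: y_def)
    have "tanh (x / 2) = (y - inverse y) / (y + inverse y)"
      by (simp add: tanh_altdef y_def exp_minus)
    also have "\<dots> = (y * (y - inverse y)) / (y * (y + inverse y))" using y by simp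
    also have "\<dots> = (y * y - 1) / (y * y + 1)" using y by (simp add: right_diff_distrib distrib_left)
    finally have t: "tanh (x / 2) = (y * y - 1) / (y * y + 1)" .
    have "y * y + 1 \<noteq> 0" using y by (smt (verit) mult_pos_pos)
    then show ?thesis unfolding e y_def[symmetric] t by (simp add: field_simps)
  qed
  note * = this
  show ?thesis unfolding edge_prob_def * by simp
qed

lemma edge_prob_commute: "edge_prob n lam \<beta> i j = edge_prob n lam \<beta> j i"
  unfolding edge_prob_def
  by (rule arg_cong[where f = "\<lambda>x. lam / real n * (exp x / (1 + exp x))"]) (rule add.commute)

lemma edge_prob_edge_between:
  "(case edge_between i j of (i, j) \<Rightarrow> edge_prob n lam \<beta> i j) = edge_prob n lam \<beta> i j"
proof (cases "i \<le> j")
  case False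
  then have "edge_between i j = (j, i)" by (simp add: edge_between_def)
  then show ?thesis unfolding edge_prob_commute[of n lam \<beta> i j] by simp
qed (simp add: edge_between_def)

lemma edge_prob_bounds:
  assumes lam: "0 \<le> lam" "lam \<le> real n" and \<beta>: "0 \<le> \<beta> i" "0 \<le> \<beta> j"
  shows "lam / (2 * real n) \<le> edge_prob n lam \<beta> i j" "edge_prob n lam \<beta> i j \<le> lam / real n"
    "edge_prob n lam \<beta> i j \<le> 1"
proof -
  have t: "0 \<le> tanh ((\<beta> i + \<beta> j) / 2)" "tanh ((\<beta> i + \<beta> j) / 2) \<le> 1"
    using \<beta> tanh_real_lt_1[of "(\<beta> i + \<beta> j) / 2"] by auto
  show "lam / (2 * real n) \<le> edge_prob n lam \<beta> i j"
    unfolding edge_prob_alt using t lam mult_left_mono[of 1 "1 + tanh ((\<beta> i + \<beta> j) / 2)" "lam / (2 * real n)"] by simp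
  show *: "edge_prob n lam \<beta> i j \<le> lam / real n"
    unfolding edge_prob_alt using t lam mult_left_mono[of "1 + tanh ((\<beta> i + \<beta> j) / 2)" 2 "lam / (2 * real n)"] by simp
  have "lam / real n \<le> 1" using lam by (cases n) auto
  with * show "edge_prob n lam \<beta> i j \<le> 1" by simp
qed

lemma beta_graph_0: "beta_graph n lam (\<lambda>_. 0) = random_graph n (\<lambda>_. lam / (2 * real n))"
  unfolding beta_graph_def edge_prob_alt by (simp add: case_prod_unfold)

section \<open>Asymptotics of the thresholds\<close>

text \<open>The common setting of both parts, with \<open>C\<close> in the role of
  \<open>C_star\<close>. Conditions on \<open>A\<close>, on the side of the boundary and on the
  stronger growth of \<open>lam\<close> differ between the parts and stay outside.\<close>

locale sparse_signals =
  fixes \<alpha> \<theta> C :: real and s :: "nat \<Rightarrow> nat" and lam :: "nat \<Rightarrow> real"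
  assumes alpha: "1 / 2 < \<alpha>" "\<alpha> < 1"
    and s: "\<And>n. n \<ge> 1 \<Longrightarrow> \<bar>real (s n) - real n powr (1 - \<alpha>)\<bar> < 1"
    and lam: "\<And>n. n \<ge> 1 \<Longrightarrow> 1 \<le> lam n" "\<And>n. n \<ge> 1 \<Longrightarrow> lam n \<le> real n"
    and theta: "(\<lambda>n. lam n / (2 * real n)) \<longlonglongrightarrow> \<theta>"
    and C: "C > 0"
    and lam_ln: "dominates lam (\<lambda>n. ln (real n))"
begin

text \<open>\<open>p\<close> is the null edge probability, \<open>R\<close> the common scale of
  fluctuations and mean shifts, \<open>\<tau>\<close> the boundary value for \<open>tanh A\<close>.
  \<open>V0\<close> counts n neighbours instead of n - 1, a difference of lower order.\<close>

definition p :: "nat \<Rightarrow> real" where "p n = lam n / (2 * real n)"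
definition R :: "nat \<Rightarrow> real" where "R n = sqrt (lam n * ln (real n))"
definition \<tau> :: "nat \<Rightarrow> real" where "\<tau> n = sqrt (C * ln (real n) / lam n)"
definition V0 :: "nat \<Rightarrow> real" where "V0 n = real n * (p n * (1 - p n))"

lemma ln_at_top: "filterlim (\<lambda>n. ln (real n)) at_top sequentially"
  by real_asymp

lemma ev_ge: "\<forall>\<^sub>F n in sequentially. n \<ge> 3 \<and> 1 \<le> ln (real n) \<and> 1 \<le> lam n \<and> lam n \<le> real n"
proof -
  have "\<forall>\<^sub>F n in sequentially. n \<ge> 3 \<and> 1 \<le> ln (real n)"
    using ln_at_top eventually_ge_at_top[of 3] by (auto simp: filterlim_at_top eventually_conj_iff)
  then show ?thesis by eventually_elim (use lam in auto)
qed

lemma p_bounds: "n \<ge> 1 \<Longrightarrow> 0 < p n" "n \<ge> 1 \<Longrightarrow> p n \<le> 1 / 2"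
  using lam[of n] by (auto simp: p_def field_simps)

lemma n_p: "n \<ge> 1 \<Longrightarrow> real n * p n = lam n / 2"
  by (simp add: p_def)

lemma p_tendsto: "p \<longlonglongrightarrow> \<theta>"
  using theta by (simp add: p_def[abs_def])

lemma theta_bounds: "0 \<le> \<theta>" "\<theta> \<le> 1 / 2"
proof -
  show "0 \<le> \<theta>"
    by (rule LIMSEQ_le_const[OF p_tendsto]) (use p_bounds in \<open>force intro: exI[of _ 1] less_imp_le\<close>)
  show "\<theta> \<le> 1 / 2"
    by (rule LIMSEQ_le_const2[OF p_tendsto]) (use p_bounds in \<open>force intro: exI[of _ 1]\<close>)
qed

lemma ln_over_lam: "(\<lambda>n. ln (real n) / lam n) \<longlonglongrightarrow> 0"
proof -
  have "(\<lambda>n. inverse (lam n / ln (real n))) \<longlonglongrightarrow> 0"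
    using lam_ln unfolding dominates_def by (rule tendsto_inverse_0_at_top)
  then show ?thesis by simp
qed

lemma tau_tendsto: "\<tau> \<longlonglongrightarrow> 0"
proof -
  have "(\<lambda>n. sqrt (C * (ln (real n) / lam n))) \<longlonglongrightarrow> sqrt (C * 0)"
    by (intro tendsto_intros ln_over_lam)
  then show ?thesis by (simp add: \<tau>_def[abs_def])
qed

lemma R_pos: "\<forall>\<^sub>F n in sequentially. 0 < R n"
  using ev_ge by eventually_elim (auto simp: R_def)

lemma lam_tau: "\<forall>\<^sub>F n in sequentially. lam n * \<tau> n = sqrt C * R n"
  using ev_ge
proof eventually_elim
  case (elim n)
  have "lam n * \<tau> n = sqrt ((lam n)\<^sup>2) * sqrt (C * ln (real n) / lam n)"
    using elim by (simp add: \<tau>_def)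
  also have "\<dots> = sqrt (C * (lam n * ln (real n)))"
    unfolding real_sqrt_mult[symmetric] using elim by (simp add: power2_eq_square mult_ac)
  finally show ?case by (simp add: R_def real_sqrt_mult)
qed

lemma R_tendsto: "(\<lambda>n. 1 / R n) \<longlonglongrightarrow> 0"
proof (rule tendsto_sandwich[OF _ _ tendsto_const])
  show "\<forall>\<^sub>F n in sequentially. 0 \<le> 1 / R n" using R_pos by eventually_elim auto
  show "\<forall>\<^sub>F n in sequentially. 1 / R n \<le> 1 / sqrt (ln (real n))"
    using ev_ge
  proof eventually_elim
    case (elim n)
    have "1 * ln (real n) \<le> lam n * ln (real n)" using elim by (intro mult_right_mono) auto
    then show ?case unfolding R_def using elim by (intro divide_left_mono) auto
  qed
  show "(\<lambda>n. 1 / sqrt (ln (real n))) \<longlonglongrightarrow> 0" by real_asymp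
qed

text \<open>This turns a strict inequality between limit constants into an eventual inequality
  between thresholds; every gap condition below enters through it.\<close>

lemma eventually_le_scaled:
  assumes "(\<lambda>n. f n / R n) \<longlonglongrightarrow> a" "(\<lambda>n. g n / R n) \<longlonglongrightarrow> b" "a < b"
  shows "\<forall>\<^sub>F n in sequentially. f n \<le> g n"
proof -
  obtain c where c: "a < c" "c < b" using assms(3) dense by blast
  have "\<forall>\<^sub>F n in sequentially. f n / R n < c" "\<forall>\<^sub>F n in sequentially. c < g n / R n"
    using assms c by (auto intro: order_tendstoD)
  with R_pos show ?thesis
  proof eventually_elim
    case (elim n)
    then have "f n / R n < g n / R n" by simp
    then show ?case using elim(1) by (simp add: divide_less_cancel)
  qed
qed

text \<open>The limit is written as \<open>v / 2\<close> because \<open>n p = lam / 2\<close>; the 2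
  then cancels against the one in \<open>2 * c * V\<close>.\<close>

lemma sqrt_scaled:
  assumes "(\<lambda>n. V n / lam n) \<longlonglongrightarrow> v / 2"
  shows "(\<lambda>n. sqrt (2 * c * V n * ln (real n)) / R n) \<longlonglongrightarrow> sqrt (c * v)"
proof (rule Lim_transform_eventually)
  have "(\<lambda>n. sqrt (2 * c * (V n / lam n))) \<longlonglongrightarrow> sqrt (2 * c * (v / 2))"
    by (intro tendsto_intros assms)
  then show "(\<lambda>n. sqrt (2 * c * (V n / lam n))) \<longlonglongrightarrow> sqrt (c * v)" by simp
  show "\<forall>\<^sub>F n in sequentially. sqrt (2 * c * (V n / lam n)) = sqrt (2 * c * V n * ln (real n)) / R n"
    using ev_ge
    by eventually_elim (simp add: R_def real_sqrt_divide[symmetric])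
qed

text \<open>Variances of order \<open>lam\<close> dominate \<open>ln n\<close>, as the tail bounds
  require for \<open>V / L\<close>.\<close>

lemma eventually_ln_le:
  assumes "(\<lambda>n. V n / lam n) \<longlonglongrightarrow> v" "0 < v"
  shows "\<forall>\<^sub>F n in sequentially. N * ln (real n) \<le> V n"
proof -
  have "filterlim (\<lambda>n. (V n / lam n) * (lam n / ln (real n))) at_top sequentially"
    using assms lam_ln unfolding dominates_def by (intro filterlim_tendsto_pos_mult_at_top)
  then have "\<forall>\<^sub>F n in sequentially. N \<le> (V n / lam n) * (lam n / ln (real n))"
    by (auto simp: filterlim_at_top)
  with ev_ge show ?thesis
    by eventually_elim (auto simp: field_simps)
qed

lemma V0_scaled: "(\<lambda>n. V0 n / lam n) \<longlonglongrightarrow> (1 - \<theta>) / 2"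
proof (rule Lim_transform_eventually)
  show "(\<lambda>n. (1 - p n) / 2) \<longlonglongrightarrow> (1 - \<theta>) / 2" by (intro tendsto_intros p_tendsto) auto
  show "\<forall>\<^sub>F n in sequentially. (1 - p n) / 2 = V0 n / lam n"
    using ev_ge
  proof eventually_elim
    case (elim n)
    then have "V0 n = lam n / 2 * (1 - p n)" using n_p[of n] by (simp add: V0_def mult.assoc[symmetric])
    then show ?case using elim by simp
  qed
qed

lemma s_sqrt_tendsto: "(\<lambda>n. real (s n) / sqrt (real n) * sqrt (ln (real n))) \<longlonglongrightarrow> 0"
proof (rule tendsto_sandwich[OF _ _ tendsto_const])
  show "\<forall>\<^sub>F n in sequentially. 0 \<le> real (s n) / sqrt (real n) * sqrt (ln (real n))"
    using ev_ge by eventually_elim auto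
  show "\<forall>\<^sub>F n in sequentially. real (s n) / sqrt (real n) * sqrt (ln (real n))
      \<le> (real n powr (1 - \<alpha>) + 1) / sqrt (real n) * sqrt (ln (real n))"
    using ev_ge
  proof eventually_elim
    case (elim n)
    then show ?case using s[of n] by (intro mult_right_mono divide_right_mono) auto
  qed
  \<comment> \<open>The sparsity assumption enters here: \<open>s / sqrt n\<close> decays
    polynomially and beats the logarithm.\<close>
  have "1 - \<alpha> < 1 / 2" using alpha by simp
  then show "(\<lambda>n. (real n powr (1 - \<alpha>) + 1) / sqrt (real n) * sqrt (ln (real n))) \<longlonglongrightarrow> 0"
    using alpha by real_asymp
qed

lemma s_le: "\<forall>\<^sub>F n in sequentially. s n \<le> n"
proof -
  have "\<forall>\<^sub>F n in sequentially. real n powr (1 - \<alpha>) + 1 \<le> real n" using alpha by real_asymp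
  with ev_ge show ?thesis
  proof eventually_elim
    case (elim n)
    then have "real (s n) \<le> real n" using s[of n] by auto
    then show ?case by simp
  qed
qed

lemma s_over_n: "(\<lambda>n. real (s n) / real n) \<longlonglongrightarrow> 0"
proof (rule tendsto_sandwich[OF _ _ tendsto_const s_sqrt_tendsto])
  show "\<forall>\<^sub>F n in sequentially. 0 \<le> real (s n) / real n" by simp
  show "\<forall>\<^sub>F n in sequentially. real (s n) / real n \<le> real (s n) / sqrt (real n) * sqrt (ln (real n))"
    using ev_ge
  proof eventually_elim
    case (elim n)
    have "sqrt (real n) * 1 \<le> sqrt (real n) * sqrt (real n)" using elim by (intro mult_left_mono) auto
    then have "sqrt (real n) \<le> real n" by simp
    then have "real (s n) / real n \<le> real (s n) / sqrt (real n)" using elim by (intro divide_left_mono) auto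
    also have "\<dots> \<le> real (s n) / sqrt (real n) * sqrt (ln (real n))"
      using elim mult_left_mono[of 1 "sqrt (ln (real n))" "real (s n) / sqrt (real n)"] by simp
    finally show ?case .
  qed
qed

text \<open>The expression equals \<open>s / n * sqrt (lam * ln n)\<close>, and
  \<open>lam \<le> n\<close> reduces it to the previous limit. It serves both for edges inside the
  signal set and for the deletion cost of signal neighbours.\<close>

lemma sqrt_ln_s_lam: "(\<lambda>n. sqrt (ln (real n) / lam n) * (real (s n) * lam n / real n)) \<longlonglongrightarrow> 0"
proof (rule tendsto_sandwich[OF _ _ tendsto_const s_sqrt_tendsto])
  show "\<forall>\<^sub>F n in sequentially. 0 \<le> sqrt (ln (real n) / lam n) * (real (s n) * lam n / real n)"
    using ev_ge by eventually_elim auto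
  show "\<forall>\<^sub>F n in sequentially. sqrt (ln (real n) / lam n) * (real (s n) * lam n / real n)
      \<le> real (s n) / sqrt (real n) * sqrt (ln (real n))"
    using ev_ge
  proof eventually_elim
    case (elim n)
    have a: "sqrt (ln (real n) / lam n) * lam n = sqrt (ln (real n)) * sqrt (lam n)"
      using elim real_sqrt_mult_self[of "lam n"] by (simp add: real_sqrt_divide field_simps)
    have "sqrt (ln (real n) / lam n) * (real (s n) * lam n / real n)
        = real (s n) / real n * (sqrt (ln (real n) / lam n) * lam n)" by simp
    also have "\<dots> = real (s n) / real n * (sqrt (ln (real n)) * sqrt (lam n))" by (simp only: a)
    also have "\<dots> \<le> real (s n) / real n * (sqrt (ln (real n)) * sqrt (real n))"
      using elim by (intro mult_left_mono) auto
    also have "\<dots> = real (s n) / sqrt (real n) * sqrt (ln (real n))"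
      using elim real_sqrt_mult_self[of "real n"] by (simp add: field_simps)
    finally show ?case .
  qed
qed

text \<open>Up to a constant, \<open>s * lam / n\<close> is the expected number of neighbours in the
  signal set; it is negligible on the scale \<open>R\<close>.\<close>

lemma s_lam_scaled: "(\<lambda>n. (real (s n) * lam n / real n) / R n) \<longlonglongrightarrow> 0"
proof (rule tendsto_sandwich[OF _ _ tendsto_const sqrt_ln_s_lam])
  show "\<forall>\<^sub>F n in sequentially. 0 \<le> (real (s n) * lam n / real n) / R n"
    using ev_ge R_pos by eventually_elim auto
  show "\<forall>\<^sub>F n in sequentially. (real (s n) * lam n / real n) / R n
      \<le> sqrt (ln (real n) / lam n) * (real (s n) * lam n / real n)"
    using ev_ge
  proof eventually_elim
    case (elim n)
    have "1 / R n \<le> sqrt (ln (real n) / lam n)"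
    proof -
      have "1 * 1 \<le> ln (real n) * ln (real n)" using elim by (intro mult_mono) auto
      then have "1 / (lam n * ln (real n)) \<le> ln (real n) / lam n" using elim by (simp add: field_simps)
      then have "sqrt (1 / (lam n * ln (real n))) \<le> sqrt (ln (real n) / lam n)" by simp
      then show ?thesis by (simp add: R_def real_sqrt_divide)
    qed
    then have "(1 / R n) * (real (s n) * lam n / real n) \<le> sqrt (ln (real n) / lam n) * (real (s n) * lam n / real n)"
      using elim by (intro mult_right_mono) auto
    then show ?case by (simp add: mult_ac)
  qed
qed

text \<open>The expected number of exceedances among \<open>s\<close> vertices diverges when the
  exponent is below 1 - \<alpha>.\<close>

lemma s_exp_at_top:
  assumes "0 < \<delta>" "\<delta> < 1 - \<alpha>"
  shows "filterlim (\<lambda>n. real (s n) * exp (- (1 - \<alpha> - \<delta>) * ln (real n))) at_top sequentially"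
proof (rule filterlim_at_top_mono)
  show "filterlim (\<lambda>n. (real n powr (1 - \<alpha>) - 1) * exp (- (1 - \<alpha> - \<delta>) * ln (real n))) at_top sequentially"
    using assms alpha by real_asymp
  show "\<forall>\<^sub>F n in sequentially. (real n powr (1 - \<alpha>) - 1) * exp (- (1 - \<alpha> - \<delta>) * ln (real n))
     \<le> real (s n) * exp (- (1 - \<alpha> - \<delta>) * ln (real n))"
    using ev_ge
  proof eventually_elim
    case (elim n)
    then show ?case using s[of n] by (intro mult_right_mono) auto
  qed
qed

lemma s_exp_tendsto:
  assumes "0 < \<delta>"
  shows "(\<lambda>n. real (s n) * exp (- (1 - \<alpha> + \<delta>) * ln (real n))) \<longlonglongrightarrow> 0"
proof (rule tendsto_sandwich[OF _ _ tendsto_const])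
  show "(\<lambda>n. (real n powr (1 - \<alpha>) + 1) * exp (- (1 - \<alpha> + \<delta>) * ln (real n))) \<longlonglongrightarrow> 0"
    using assms alpha by real_asymp
  show "\<forall>\<^sub>F n in sequentially. real (s n) * exp (- (1 - \<alpha> + \<delta>) * ln (real n))
     \<le> (real n powr (1 - \<alpha>) + 1) * exp (- (1 - \<alpha> + \<delta>) * ln (real n))"
    using ev_ge
  proof eventually_elim
    case (elim n)
    then show ?case using s[of n] by (intro mult_right_mono) auto
  qed
qed auto

text \<open>The level has exponent \<open>1 + 2 * \<delta>\<close>, the Chernoff bound gives up
  \<open>\<delta>\<close>, and the union over n vertices still leaves n^(-\<delta>).\<close>

lemma null_upper_tail:
  assumes \<delta>: "0 < \<delta>"
  shows "(\<lambda>n. measure_pmf.prob (random_graph n (\<lambda>_. p n))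
     (exceeds n (real n * p n + sqrt (2 * (1 + 2 * \<delta>) * V0 n * ln (real n))) {1..n})) \<longlonglongrightarrow> 0"
proof -
  have c: "0 < 1 + 2 * \<delta>" using \<delta> by simp
  obtain N where N: "N > 0" and up: "\<And>n P S \<mu> V L k.
    \<lbrakk>\<And>e. e \<in> vertex_pairs n \<Longrightarrow> 0 \<le> P e \<and> P e \<le> 1; S \<subseteq> {1..n};
     \<And>i. i \<in> S \<Longrightarrow> (\<Sum>j\<in>{1..n} - {i}. P (edge_between i j)) \<le> \<mu>;
     \<And>i. i \<in> S \<Longrightarrow> (\<Sum>j\<in>{1..n} - {i}. P (edge_between i j) * (1 - P (edge_between i j))) \<le> V;
     0 < L; N * L \<le> V; \<mu> + sqrt (2 * (1 + 2 * \<delta>) * V * L) \<le> k\<rbrakk> \<Longrightarrow>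
     measure_pmf.prob (random_graph n P) (exceeds n k S) \<le> real (card S) * exp (- ((1 + 2 * \<delta>) - \<delta>) * L)"
    using max_degree_upper_tail[OF c \<delta>] by blast
  have V: "\<forall>\<^sub>F n in sequentially. N * ln (real n) \<le> V0 n"
    by (rule eventually_ln_le[OF V0_scaled]) (use theta_bounds in auto)
  show ?thesis
  proof (rule tendsto_sandwich[OF _ _ tendsto_const])
    show "(\<lambda>n. real n * exp (- (1 + \<delta>) * ln (real n))) \<longlonglongrightarrow> 0" using \<delta> by real_asymp
    show "\<forall>\<^sub>F n in sequentially. measure_pmf.prob (random_graph n (\<lambda>_. p n))
     (exceeds n (real n * p n + sqrt (2 * (1 + 2 * \<delta>) * V0 n * ln (real n))) {1..n})
     \<le> real n * exp (- (1 + \<delta>) * ln (real n))"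
      using ev_ge V
    proof eventually_elim
      case (elim n)
      have pn: "0 < p n" "p n \<le> 1 / 2" using p_bounds[of n] elim by auto
      have "measure_pmf.prob (random_graph n (\<lambda>_. p n))
          (exceeds n (real n * p n + sqrt (2 * (1 + 2 * \<delta>) * V0 n * ln (real n))) {1..n})
          \<le> real (card {1..n}) * exp (- ((1 + 2 * \<delta>) - \<delta>) * ln (real n))"
        by (rule up[where \<mu> = "real n * p n" and V = "V0 n"])
          (use elim pn in \<open>auto simp: V0_def intro!: mult_right_mono\<close>)
      then show ?case by (simp add: algebra_simps)
    qed
  qed auto
qed

end

section \<open>Powerful regime\<close>

text \<open>Follows from \<open>tanh x = 2 t / (1 + t^2)\<close> for
  \<open>t = tanh (x / 2)\<close>. Edges between a signal vertex at level \<open>A\<close> and a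
  null vertex see \<open>tanh (A / 2)\<close>, while the hypotheses bound
  \<open>tanh A\<close>.\<close>

lemma tanh_half_ge: "tanh x / 2 \<le> tanh (x / 2)" if "0 \<le> x" for x :: real
proof -
  let ?t = "tanh (x / 2)"
  have t: "0 \<le> ?t" using that by simp
  have "tanh x = tanh (x / 2 + x / 2)" by simp
  also have "\<dots> = (?t + ?t) / (1 + ?t * ?t)"
    by (rule tanh_add) (use cosh_real_pos in \<open>auto intro: less_imp_neq[symmetric]\<close>)
  also have "\<dots> \<le> (?t + ?t) / 1" using t by (intro divide_left_mono) (auto intro: add_pos_nonneg)
  finally show ?thesis by simp
qed

text \<open>The converse of the half-angle bound: the loss \<open>1 + y\<^sup>2\<close> tends to 1
  as \<open>y\<close> tends to 0, so the constant stays sharp.\<close>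

lemma tanh_half_le:
  fixes x :: real
  assumes x: "0 \<le> x" and le: "tanh x \<le> y"
  shows "tanh (x / 2) \<le> y * (1 + y\<^sup>2) / 2" "tanh (x / 2) \<le> y"
proof -
  let ?t = "tanh (x / 2)"
  have t: "0 \<le> ?t" using x by simp
  have "tanh (x / 2) \<le> tanh x" using x by simp
  from this le show ty: "?t \<le> y" by (rule order_trans)
  have y: "0 \<le> y" using t ty by (rule order_trans)
  have "tanh x = tanh (x / 2 + x / 2)" by simp
  also have "\<dots> = (?t + ?t) / (1 + ?t * ?t)"
    by (rule tanh_add) (use cosh_real_pos in \<open>auto intro: less_imp_neq[symmetric]\<close>)
  finally have "tanh x * (1 + ?t * ?t) = ?t + ?t"
    using t by (simp add: add_nonneg_eq_0_iff field_simps)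
  then have "?t = tanh x * (1 + ?t * ?t) / 2" by simp
  also have "\<dots> \<le> y * (1 + y * y) / 2"
    using le t ty x y by (intro divide_right_mono mult_mono add_mono) auto
  finally show "?t \<le> y * (1 + y\<^sup>2) / 2" by (simp add: power2_eq_square)
qed

text \<open>Source of the slack parameters: a strict inequality at 0 persists for small positive
  arguments.\<close>

lemma eventually_at_right_gap:
  fixes f g :: "real \<Rightarrow> real"
  assumes "isCont f 0" "isCont g 0" "f 0 < g 0" "0 < d"
  obtains \<delta> where "0 < \<delta>" "\<delta> < d" "f \<delta> < g \<delta>"
proof -
  have "((\<lambda>x. g x - f x) \<longlongrightarrow> g 0 - f 0) (at_right 0)"
    using assms(1,2) by (intro tendsto_intros) (auto simp: isCont_def intro: tendsto_within_subset)
  then have "\<forall>\<^sub>F x in at_right 0. 0 < g x - f x" using assms(3) by (intro order_tendstoD) auto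
  moreover have "\<forall>\<^sub>F x in at_right 0. x \<in> {0<..<d}" using assms(4) by (rule eventually_at_right_real)
  ultimately have "\<forall>\<^sub>F x in at_right 0. 0 < x \<and> x < d \<and> f x < g x"
    by eventually_elim auto
  then show ?thesis using that eventually_happens[of _ "at_right (0::real)"] trivial_limit_at_right_real by blast
qed

lemma Xi_D:
  assumes "\<beta> \<in> Xi n k A"
  shows "supp \<beta> \<subseteq> {1..n}" "card (supp \<beta>) = k" "0 \<le> \<beta> i" "i \<in> supp \<beta> \<Longrightarrow> A \<le> \<beta> i"
  using assms by (auto simp: Xi_def)

lemma planted_in_Xi:
  assumes "k \<le> n" "0 < A"
  shows "(\<lambda>i. if i \<in> {1..k} then A else 0) \<in> Xi n k A"
proof -
  have "supp (\<lambda>i. if i \<in> {1..k} then A else 0) = {1..k}" using assms by (auto simp: supp_def)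
  then show ?thesis using assms by (auto simp: Xi_def)
qed

lemma risk_le:
  assumes n: "n \<ge> 1" and ne: "B \<noteq> {}"
    and b: "\<And>\<beta>. \<beta> \<in> B \<Longrightarrow> 1 - measure_pmf.prob (beta_graph n lam \<beta>) (exceeds n k {1..n}) \<le> b"
  shows "risk n lam (max_degree_test n k) B \<le>
    measure_pmf.prob (beta_graph n lam (\<lambda>_. 0)) (exceeds n k {1..n}) + b"
  unfolding risk_max_degree_test[OF n] by (intro add_left_mono cSUP_least[OF ne] b)

lemma risk_ge:
  assumes n: "n \<ge> 1" and \<beta>: "\<beta> \<in> B"
  shows "measure_pmf.prob (beta_graph n lam (\<lambda>_. 0)) (exceeds n k {1..n}) +
    (1 - measure_pmf.prob (beta_graph n lam \<beta>) (exceeds n k {1..n})) \<le> risk n lam (max_degree_test n k) B"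
  unfolding risk_max_degree_test[OF n]
  by (intro add_left_mono cSUP_upper[OF \<beta>]) (auto intro!: bdd_aboveI2[where M = 1])

lemma risk_nonneg:
  assumes "n \<ge> 1" "B \<noteq> {}"
  shows "0 \<le> risk n lam (max_degree_test n k) B"
proof -
  obtain \<beta> where "\<beta> \<in> B" using assms by blast
  have "0 \<le> measure_pmf.prob (beta_graph n lam (\<lambda>_. 0)) (exceeds n k {1..n}) +
    (1 - measure_pmf.prob (beta_graph n lam \<beta>) (exceeds n k {1..n}))" by simp
  also have "\<dots> \<le> risk n lam (max_degree_test n k) B" by (rule risk_ge) (use assms \<open>\<beta> \<in> B\<close> in auto)
  finally show ?thesis .
qed

lemma prob_exceeds_beta_0_le:
  assumes lam: "0 \<le> lam" "lam \<le> real n" and \<beta>: "\<And>i. 0 \<le> \<beta> i"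
  shows "measure_pmf.prob (beta_graph n lam (\<lambda>_. 0)) (exceeds n k S)
       \<le> measure_pmf.prob (beta_graph n lam \<beta>) (exceeds n k S)"
  unfolding beta_graph_0 unfolding beta_graph_def
proof (rule prob_exceeds_mono, clarify)
  fix i j
  have "lam / (2 * real n) \<le> edge_prob n lam \<beta> i j" "edge_prob n lam \<beta> i j \<le> 1"
    using edge_prob_bounds[of lam n \<beta> i j] lam \<beta> by auto
  then show "0 \<le> lam / (2 * real n) \<and> lam / (2 * real n) \<le> edge_prob n lam \<beta> i j \<and> edge_prob n lam \<beta> i j \<le> 1"
    using lam by simp
qed

text \<open>Every alternative rejects at least as often as the null, so the second error is at most
  1 minus the first. Powerlessness thus only needs a lower bound on the risk.\<close>

lemma risk_le_1:
  assumes n: "n \<ge> 1" and lam: "0 \<le> lam" "lam \<le> real n" and ne: "Xi n s A \<noteq> {}"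
  shows "risk n lam (max_degree_test n k) (Xi n s A) \<le> 1"
proof -
  have "risk n lam (max_degree_test n k) (Xi n s A) \<le>
    measure_pmf.prob (beta_graph n lam (\<lambda>_. 0)) (exceeds n k {1..n}) +
    (1 - measure_pmf.prob (beta_graph n lam (\<lambda>_. 0)) (exceeds n k {1..n}))"
  proof (rule risk_le[OF n ne])
    fix \<beta> assume "\<beta> \<in> Xi n s A"
    then show "1 - measure_pmf.prob (beta_graph n lam \<beta>) (exceeds n k {1..n})
        \<le> 1 - measure_pmf.prob (beta_graph n lam (\<lambda>_. 0)) (exceeds n k {1..n})"
      using prob_exceeds_beta_0_le[OF lam, of \<beta> k "{1..n}"] Xi_D(3) by simp
  qed
  then show ?thesis by simp
qed

context sparse_signals
begin

lemma asymp_powerfulI: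
  assumes A: "\<And>n. n \<ge> 1 \<Longrightarrow> A n > 0" and b: "b \<longlonglongrightarrow> 0"
    and le: "\<forall>\<^sub>F n in sequentially. risk n (lam n) (max_degree_test n (k n)) (Xi n (s n) (A n)) \<le> b n"
  shows "asymp_powerful lam s A (\<lambda>n. max_degree_test n (k n))"
proof -
  have "(\<lambda>n. risk n (lam n) (max_degree_test n (k n)) (Xi n (s n) (A n))) \<longlonglongrightarrow> 0"
  proof (rule tendsto_sandwich[OF _ le tendsto_const b])
    show "\<forall>\<^sub>F n in sequentially. 0 \<le> risk n (lam n) (max_degree_test n (k n)) (Xi n (s n) (A n))"
      using ev_ge s_le
    proof eventually_elim
      case (elim n)
      \<comment> \<open>The supremum is meaningful because the planted vector makes the class
        nonempty.\<close>
      then show ?case using planted_in_Xi[of "s n" n "A n"] A[of n] by (intro risk_nonneg) auto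
    qed
  qed
  then have "(\<lambda>n. ereal (risk n (lam n) (max_degree_test n (k n)) (Xi n (s n) (A n)))) \<longlonglongrightarrow> ereal 0"
    by (rule tendsto_ereal)
  then have "limsup (\<lambda>n. ereal (risk n (lam n) (max_degree_test n (k n)) (Xi n (s n) (A n)))) = ereal 0"
    by (intro lim_imp_Limsup) auto
  then show ?thesis by (simp add: asymp_powerful_def zero_ereal_def)
qed

lemma asymp_powerlessI:
  assumes A: "\<And>n. n \<ge> 1 \<Longrightarrow> A n > 0" and b: "b \<longlonglongrightarrow> 0"
    and le: "\<forall>\<^sub>F n in sequentially. 1 - b n \<le> risk n (lam n) (max_degree_test n (k n)) (Xi n (s n) (A n))"
  shows "asymp_powerless lam s A (\<lambda>n. max_degree_test n (k n))"
proof -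
  have "(\<lambda>n. 1 - b n) \<longlonglongrightarrow> 1 - 0" by (intro tendsto_intros b)
  then have b1: "(\<lambda>n. 1 - b n) \<longlonglongrightarrow> 1" by simp
  have "(\<lambda>n. risk n (lam n) (max_degree_test n (k n)) (Xi n (s n) (A n))) \<longlonglongrightarrow> 1"
  proof (rule tendsto_sandwich[OF le _ b1 tendsto_const])
    show "\<forall>\<^sub>F n in sequentially. risk n (lam n) (max_degree_test n (k n)) (Xi n (s n) (A n)) \<le> 1"
      using ev_ge s_le
    proof eventually_elim
      case (elim n)
      then show ?case using planted_in_Xi[of "s n" n "A n"] A[of n] by (intro risk_le_1) auto
    qed
  qed
  then have "(\<lambda>n. ereal (risk n (lam n) (max_degree_test n (k n)) (Xi n (s n) (A n)))) \<longlonglongrightarrow> ereal 1"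
    by (rule tendsto_ereal)
  then have "liminf (\<lambda>n. ereal (risk n (lam n) (max_degree_test n (k n)) (Xi n (s n) (A n)))) = ereal 1"
    by (intro lim_imp_Liminf) auto
  then show ?thesis by (simp add: asymp_powerless_def one_ereal_def)
qed

text \<open>A lower bound for the edge probability between a signal and a null vertex when
  \<open>\<tau> \<le> tanh A\<close>, by the half-angle inequality.\<close>

definition q :: "nat \<Rightarrow> real" where "q n = p n * (1 + \<tau> n / 2)"

lemma q_tendsto: "q \<longlonglongrightarrow> \<theta>"
proof -
  have "(\<lambda>n. p n * (1 + \<tau> n / 2)) \<longlonglongrightarrow> \<theta> * (1 + 0 / 2)"
    by (intro tendsto_intros p_tendsto tau_tendsto) auto
  then show ?thesis by (simp add: q_def[abs_def])
qed

lemma q_bounds: "\<forall>\<^sub>F n in sequentially. p n \<le> q n \<and> 0 < q n \<and> q n < 1"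
proof -
  have "\<forall>\<^sub>F n in sequentially. q n < 1"
    using q_tendsto theta_bounds by (intro order_tendstoD) auto
  with ev_ge show ?thesis
  proof eventually_elim
    case (elim n)
    have "0 \<le> \<tau> n" using elim C by (simp add: \<tau>_def)
    moreover have pn: "0 < p n" using p_bounds[of n] elim by simp
    ultimately have "p n * 1 \<le> q n" unfolding q_def by (intro mult_left_mono) auto
    then show ?case using pn elim by simp
  qed
qed

text \<open>Signal vertices reach fluctuation exponent \<open>1 - \<alpha> - 2 * \<delta>\<close>
  with a loss of \<open>\<delta>\<close>, which leaves a diverging expected number of exceedances.
  The bound is uniform in \<open>\<beta>\<close>, as the supremum in the risk requires.\<close>

lemma alternative_max_degree:
  assumes \<delta>: "0 < \<delta>" "2 * \<delta> < 1 - \<alpha>"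
    and gap: "sqrt ((1 + 2 * \<delta>) * (1 - \<theta>)) < sqrt C / 4 + sqrt ((1 - \<alpha> - 2 * \<delta>) * (1 - \<theta>))"
    and A: "\<And>n. n \<ge> 1 \<Longrightarrow> A n > 0" "\<forall>\<^sub>F n in sequentially. \<tau> n \<le> tanh (A n)"
  shows "\<forall>\<^sub>F n in sequentially. \<forall>\<beta>\<in>Xi n (s n) (A n). 1 - measure_pmf.prob (beta_graph n (lam n) \<beta>)
     (exceeds n (real n * p n + sqrt (2 * (1 + 2 * \<delta>) * V0 n * ln (real n))) {1..n})
     \<le> exp (- (real (s n) * exp (- (1 - \<alpha> - \<delta>) * ln (real n))))"
proof -
  define k where "k = (\<lambda>n. real n * p n + sqrt (2 * (1 + 2 * \<delta>) * V0 n * ln (real n)))"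
  define V where "V = (\<lambda>n. real (n - s n) * (q n * (1 - q n)))"
  have c: "0 < 1 - \<alpha> - 2 * \<delta>" using \<delta> by simp
  obtain N where N: "N > 0" and low: "\<And>n P q S V L k.
    \<lbrakk>0 < q; q < 1; S \<subseteq> {1..n}; \<And>i j. i \<in> S \<Longrightarrow> j \<in> {1..n} - S \<Longrightarrow> P (edge_between i j) = q;
     V = real (n - card S) * (q * (1 - q)); N \<le> L; N * L \<le> V;
     k \<le> real (n - card S) * q + sqrt (2 * (1 - \<alpha> - 2 * \<delta>) * V * L)\<rbrakk> \<Longrightarrow>
     measure_pmf.prob (random_graph n P) {E. \<forall>i\<in>S. real (degree_in ({1..n} - S) E i) \<le> k}
       \<le> exp (- (real (card S) * exp (- (1 - \<alpha> - 2 * \<delta> + \<delta>) * L)))"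
    using bipartite_max_degree_moderate[OF c \<delta>(1)] by blast
  have Vlam: "(\<lambda>n. V n / lam n) \<longlonglongrightarrow> (1 - \<theta>) / 2"
  proof (rule Lim_transform_eventually)
    show "(\<lambda>n. (1 - real (s n) / real n) * (1 / 2 * (1 + \<tau> n / 2)) * (1 - q n)) \<longlonglongrightarrow> (1 - \<theta>) / 2"
      by (rule tendsto_eq_intros s_over_n tau_tendsto q_tendsto refl | simp)+
    show "\<forall>\<^sub>F n in sequentially. (1 - real (s n) / real n) * (1 / 2 * (1 + \<tau> n / 2)) * (1 - q n) = V n / lam n"
      using ev_ge s_le
    proof eventually_elim
      case (elim n)
      have "V n = real n * (1 - real (s n) / real n) * (q n * (1 - q n))"
        using elim by (simp add: V_def of_nat_diff field_simps)
      also have "\<dots> = (real n * p n) * ((1 - real (s n) / real n) * (1 + \<tau> n / 2) * (1 - q n))"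
        by (simp add: q_def mult_ac)
      also have "real n * p n = lam n / 2" using elim by (intro n_p) auto
      finally show ?case using elim by simp
    qed
  qed
  have VL: "\<forall>\<^sub>F n in sequentially. N * ln (real n) \<le> V n"
    by (rule eventually_ln_le[OF Vlam]) (use theta_bounds in auto)
  have NL: "\<forall>\<^sub>F n in sequentially. N \<le> ln (real n)"
    using ln_at_top by (auto simp: filterlim_at_top)
  \<comment> \<open>The centring \<open>n * p\<close> is moved to the right: it may be far larger
    than \<open>R\<close>, and only differences of means have limits on that scale.\<close>
  have kle: "\<forall>\<^sub>F n in sequentially. sqrt (2 * (1 + 2 * \<delta>) * V0 n * ln (real n))
      \<le> real (n - s n) * q n - real n * p n + sqrt (2 * (1 - \<alpha> - 2 * \<delta>) * V n * ln (real n))"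
  proof (rule eventually_le_scaled)
    show "(\<lambda>n. sqrt (2 * (1 + 2 * \<delta>) * V0 n * ln (real n)) / R n) \<longlonglongrightarrow> sqrt ((1 + 2 * \<delta>) * (1 - \<theta>))"
      by (rule sqrt_scaled[OF V0_scaled])
    \<comment> \<open>The mean gains \<open>n * p * \<tau> / 2 = sqrt C * R / 4\<close> from the
      signal and loses \<open>s * q\<close> by ignoring the edges inside the signal set.\<close>
    have 1: "(\<lambda>n. (real (n - s n) * q n - real n * p n) / R n) \<longlonglongrightarrow> sqrt C / 4"
    proof (rule Lim_transform_eventually)
      show "(\<lambda>n. sqrt C / 4 - (1 / 2 * (1 + \<tau> n / 2)) * ((real (s n) * lam n / real n) / R n)) \<longlonglongrightarrow> sqrt C / 4"
        by (rule tendsto_eq_intros s_lam_scaled tau_tendsto refl | simp)+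
      show "\<forall>\<^sub>F n in sequentially. sqrt C / 4 - (1 / 2 * (1 + \<tau> n / 2)) * ((real (s n) * lam n / real n) / R n)
          = (real (n - s n) * q n - real n * p n) / R n"
        using ev_ge s_le R_pos lam_tau
      proof eventually_elim
        case (elim n)
        have "real (n - s n) * q n - real n * p n = real n * p n * (\<tau> n / 2) - real (s n) * q n"
          using elim by (simp add: of_nat_diff q_def field_simps)
        also have "\<dots> = lam n * \<tau> n / 4 - real (s n) * (lam n / (2 * real n) * (1 + \<tau> n / 2))"
          using elim n_p[of n] by (simp add: q_def p_def)
        also have "\<dots> = sqrt C * R n / 4 - (1 / 2 * (1 + \<tau> n / 2)) * (real (s n) * lam n / real n)"
          using elim by simp
        finally show ?case using elim by (simp add: diff_divide_distrib)
      qed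
    qed
    show "(\<lambda>n. (real (n - s n) * q n - real n * p n + sqrt (2 * (1 - \<alpha> - 2 * \<delta>) * V n * ln (real n))) / R n)
      \<longlonglongrightarrow> sqrt C / 4 + sqrt ((1 - \<alpha> - 2 * \<delta>) * (1 - \<theta>))"
      unfolding add_divide_distrib by (intro tendsto_add 1 sqrt_scaled Vlam)
    show "sqrt ((1 + 2 * \<delta>) * (1 - \<theta>)) < sqrt C / 4 + sqrt ((1 - \<alpha> - 2 * \<delta>) * (1 - \<theta>))"
      by (rule gap)
  qed
  show ?thesis
    using ev_ge s_le VL NL kle A(2) q_bounds
  proof eventually_elim
    case (elim n)
    show ?case
    proof
      fix \<beta> assume "\<beta> \<in> Xi n (s n) (A n)"
      note \<beta> = Xi_D[OF this]
      define S where "S = supp \<beta>"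
      have S: "S \<subseteq> {1..n}" "card S = s n" using \<beta> by (auto simp: S_def)
      \<comment> \<open>A minorant of all alternatives with support \<open>S\<close>: probability
        \<open>q\<close> across the cut and 0 elsewhere. Monotonicity makes it sufficient.\<close>
      define P where "P = (\<lambda>e. if \<exists>i\<in>S. \<exists>j\<in>{1..n} - S. e = edge_between i j then q n else 0)"
      have Pq: "P (edge_between i j) = q n" if "i \<in> S" "j \<in> {1..n} - S" for i j
        unfolding P_def by (rule if_P) (use that in blast)
      have An: "0 < A n" using A(1)[of n] elim by simp
      have "measure_pmf.prob (random_graph n P) (exceeds n (k n) {1..n})
          \<le> measure_pmf.prob (beta_graph n (lam n) \<beta>) (exceeds n (k n) {1..n})"
        unfolding beta_graph_def
      proof (rule prob_exceeds_mono)
        fix e assume "e \<in> vertex_pairs n"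
        then obtain a b where e: "e = edge_between a b" by (rule vertex_pairs_edge_between)
        have bd: "0 \<le> p n" "p n \<le> edge_prob n (lam n) \<beta> a b" "edge_prob n (lam n) \<beta> a b \<le> 1" for a b
          using edge_prob_bounds[of "lam n" n \<beta> a b] elim \<beta>(3) by (auto simp: p_def)
        have "P e \<le> (case e of (i, j) \<Rightarrow> edge_prob n (lam n) \<beta> i j)"
        proof (cases "\<exists>i\<in>S. \<exists>j\<in>{1..n} - S. e = edge_between i j")
          case False
          then have "P e = 0" by (simp add: P_def)
          then show ?thesis using bd(1) bd(2,3)[of a b] unfolding e edge_prob_edge_between by simp
        next
          case True
          then obtain i j where ij: "i \<in> S" "j \<in> {1..n} - S" "e = edge_between i j" by blast
          have "\<tau> n / 2 \<le> tanh (A n) / 2" using elim by simp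
          also have "\<dots> \<le> tanh (A n / 2)" using An by (intro tanh_half_ge) simp
          also have "\<dots> \<le> tanh ((\<beta> i + \<beta> j) / 2)"
            using \<beta>(3)[of j] \<beta>(4)[of i] ij(1) by (simp add: S_def)
          finally have "q n \<le> p n * (1 + tanh ((\<beta> i + \<beta> j) / 2))"
            unfolding q_def using bd(1) by (intro mult_left_mono) auto
          then show ?thesis unfolding ij(3) edge_prob_edge_between Pq[OF ij(1,2)]
            by (simp add: edge_prob_alt p_def)
        qed
        moreover have "0 \<le> P e" using elim by (simp add: P_def)
        ultimately show "0 \<le> P e \<and> P e \<le> (case e of (i, j) \<Rightarrow> edge_prob n (lam n) \<beta> i j) \<and>
            (case e of (i, j) \<Rightarrow> edge_prob n (lam n) \<beta> i j) \<le> 1"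
          using bd(1) bd(2,3)[of a b] unfolding e edge_prob_edge_between by simp
      qed
      then have "1 - measure_pmf.prob (beta_graph n (lam n) \<beta>) (exceeds n (k n) {1..n})
          \<le> 1 - measure_pmf.prob (random_graph n P) (exceeds n (k n) {1..n})" by simp
      also have "\<dots> = measure_pmf.prob (random_graph n P) (UNIV - exceeds n (k n) {1..n})"
        using measure_pmf.prob_compl[of "exceeds n (k n) {1..n}" "random_graph n P"] by simp
      also have "\<dots> \<le> measure_pmf.prob (random_graph n P) {E. \<forall>i\<in>S. real (degree_in ({1..n} - S) E i) \<le> k n}"
      proof (rule measure_pmf.finite_measure_mono)
        have "real (degree_in ({1..n} - S) E i) \<le> k n" if "E \<notin> exceeds n (k n) {1..n}" "i \<in> S" for E i
        proof -
          have "real (degree_in ({1..n} - S) E i) \<le> real (degree_in {1..n} E i)"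
            by (intro of_nat_mono degree_in_mono) auto
          also have "\<dots> \<le> k n" using that S by (auto simp: exceeds_def not_less)
          finally show ?thesis .
        qed
        then show "UNIV - exceeds n (k n) {1..n} \<subseteq> {E. \<forall>i\<in>S. real (degree_in ({1..n} - S) E i) \<le> k n}" by auto
      qed simp
      also have "\<dots> \<le> exp (- (real (card S) * exp (- (1 - \<alpha> - 2 * \<delta> + \<delta>) * ln (real n))))"
        by (rule low[where q = "q n" and V = "V n"])
          (use elim S Pq in \<open>auto simp: V_def k_def\<close>)
      finally show "1 - measure_pmf.prob (beta_graph n (lam n) \<beta>)
          (exceeds n (real n * p n + sqrt (2 * (1 + 2 * \<delta>) * V0 n * ln (real n))) {1..n})
          \<le> exp (- (real (s n) * exp (- (1 - \<alpha> - \<delta>) * ln (real n))))"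
        unfolding k_def S by simp
    qed
  qed
qed

lemma max_degree_powerful:
  assumes gt: "C > C_max \<alpha> \<theta>"
    and A: "\<And>n. n \<ge> 1 \<Longrightarrow> A n > 0" "\<forall>\<^sub>F n in sequentially. \<tau> n \<le> tanh (A n)"
  shows "\<exists>k. asymp_powerful lam s A (\<lambda>n. max_degree_test n (k n))"
proof -
  have w: "0 < 1 - \<theta>" using theta_bounds by simp
  \<comment> \<open>\<open>C_max\<close> is the square of
    \<open>4 * (1 - sqrt (1 - \<alpha>)) * sqrt (1 - \<theta>)\<close>; taking roots yields the gap
    between the two maxima on the scale \<open>R\<close>.\<close>
  have "(4 * x * sqrt (1 - \<theta>))\<^sup>2 = 16 * (1 - \<theta>) * x\<^sup>2" for x
    using w by (simp add: power_mult_distrib mult_ac)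
  then have "(4 * (1 - sqrt (1 - \<alpha>)) * sqrt (1 - \<theta>))\<^sup>2 < (sqrt C)\<^sup>2"
    using gt C unfolding C_max_def by (simp only: real_sqrt_pow2 less_imp_le)
  then have "4 * (1 - sqrt (1 - \<alpha>)) * sqrt (1 - \<theta>) < sqrt C"
    by (rule power_less_imp_less_base) (use C in simp)
  then have gap0: "sqrt (1 - \<theta>) < sqrt C / 4 + sqrt ((1 - \<alpha>) * (1 - \<theta>))"
    unfolding real_sqrt_mult by (simp add: algebra_simps)
  obtain \<delta> where \<delta>: "0 < \<delta>" "\<delta> < (1 - \<alpha>) / 2"
    "sqrt ((1 + 2 * \<delta>) * (1 - \<theta>)) < sqrt C / 4 + sqrt ((1 - \<alpha> - 2 * \<delta>) * (1 - \<theta>))"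
    by (rule eventually_at_right_gap[of "\<lambda>\<delta>. sqrt ((1 + 2 * \<delta>) * (1 - \<theta>))"
        "\<lambda>\<delta>. sqrt C / 4 + sqrt ((1 - \<alpha> - 2 * \<delta>) * (1 - \<theta>))" "(1 - \<alpha>) / 2"])
      (use gap0 alpha in \<open>auto intro!: continuous_intros\<close>)
  define k where "k = (\<lambda>n. real n * p n + sqrt (2 * (1 + 2 * \<delta>) * V0 n * ln (real n)))"
  define b1 where "b1 = (\<lambda>n. measure_pmf.prob (random_graph n (\<lambda>_. p n)) (exceeds n (k n) {1..n}))"
  define b2 where "b2 = (\<lambda>n. exp (- (real (s n) * exp (- (1 - \<alpha> - \<delta>) * ln (real n)))))"
  have "b1 \<longlonglongrightarrow> 0" unfolding b1_def k_def by (rule null_upper_tail[OF \<delta>(1)])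
  moreover have "b2 \<longlonglongrightarrow> 0"
    unfolding b2_def
    by (rule filterlim_compose[OF exp_at_bot]) (use \<delta> s_exp_at_top in \<open>auto simp: filterlim_uminus_at_bot\<close>)
  ultimately have b: "(\<lambda>n. b1 n + b2 n) \<longlonglongrightarrow> 0" by (rule tendsto_add_zero)
  have alt: "\<forall>\<^sub>F n in sequentially. \<forall>\<beta>\<in>Xi n (s n) (A n).
      1 - measure_pmf.prob (beta_graph n (lam n) \<beta>) (exceeds n (k n) {1..n}) \<le> b2 n"
    unfolding k_def b2_def by (rule alternative_max_degree) (use \<delta> A in auto)
  have "asymp_powerful lam s A (\<lambda>n. max_degree_test n (k n))"
  proof (rule asymp_powerfulI[OF A(1) b])
    show "\<forall>\<^sub>F n in sequentially. risk n (lam n) (max_degree_test n (k n)) (Xi n (s n) (A n)) \<le> b1 n + b2 n"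
      using ev_ge s_le alt
    proof eventually_elim
      case (elim n)
      have "Xi n (s n) (A n) \<noteq> {}" using planted_in_Xi[of "s n" n "A n"] A(1)[of n] elim by auto
      then have "risk n (lam n) (max_degree_test n (k n)) (Xi n (s n) (A n)) \<le>
          measure_pmf.prob (beta_graph n (lam n) (\<lambda>_. 0)) (exceeds n (k n) {1..n}) + b2 n"
        by (intro risk_le) (use elim in auto)
      then show ?case by (simp add: beta_graph_0 b1_def p_def)
    qed
  qed
  then show ?thesis by blast
qed

end

section \<open>Powerless regime\<close>

context sparse_signals
begin

text \<open>A separating level: for small \<open>\<delta>\<close> it lies below the null maximum
  and, when \<open>C\<close> is below the boundary, above the signal maximum.\<close>

definition K :: "real \<Rightarrow> nat \<Rightarrow> real" where
  "K \<delta> n = real n * p n + sqrt (2 * (1 - \<delta>) * V0 n * ln (real n))"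

text \<open>One member of the class with the least allowed signal strength; any support of size
  \<open>s\<close> would serve equally.\<close>

definition planted :: "(nat \<Rightarrow> real) \<Rightarrow> nat \<Rightarrow> nat \<Rightarrow> real" where
  "planted A n i = (if i \<in> {1..s n} then A n else 0)"

definition planted_prob :: "(nat \<Rightarrow> real) \<Rightarrow> nat \<Rightarrow> nat \<times> nat \<Rightarrow> real" where
  "planted_prob A n e = (case e of (i, j) \<Rightarrow> edge_prob n (lam n) (planted A n) i j)"

lemma beta_graph_planted: "beta_graph n (lam n) (planted A n) = random_graph n (planted_prob A n)"
  by (simp add: beta_graph_def planted_prob_def[abs_def])

lemma beta_graph_null: "beta_graph n (lam n) (\<lambda>_. 0) = random_graph n (\<lambda>_. p n)"
  by (simp add: beta_graph_0 p_def)

lemma planted_prob_edge_between: "planted_prob A n (edge_between i j) = edge_prob n (lam n) (planted A n) i j"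
  unfolding planted_prob_def by (rule edge_prob_edge_between)

lemma planted_prob_bounds:
  assumes "n \<ge> 1" "0 < A n"
  shows "p n \<le> planted_prob A n (edge_between i j)" "planted_prob A n (edge_between i j) \<le> lam n / real n"
    "planted_prob A n (edge_between i j) \<le> 1"
  unfolding planted_prob_edge_between p_def
  by (rule edge_prob_bounds; use assms lam[of n] in \<open>simp add: planted_def\<close>)+

lemma planted_prob_bounds':
  assumes "n \<ge> 1" "0 < A n" "e \<in> vertex_pairs n"
  shows "p n \<le> planted_prob A n e \<and> planted_prob A n e \<le> 1"
  using vertex_pairs_edge_between[OF assms(3)] planted_prob_bounds[of n A, OF assms(1,2)] by metis

lemma planted_prob_outside:
  assumes "i \<notin> {1..s n}" "j \<notin> {1..s n}"
  shows "planted_prob A n (edge_between i j) = p n"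
proof -
  have "planted A n i + planted A n j = 0" using assms by (simp add: planted_def del: atLeastAtMost_iff)
  then show ?thesis unfolding planted_prob_edge_between edge_prob_alt p_def by simp
qed

lemma planted_prob_cross:
  assumes "i \<in> {1..s n} \<and> j \<notin> {1..s n} \<or> j \<in> {1..s n} \<and> i \<notin> {1..s n}"
  shows "planted_prob A n (edge_between i j) = p n * (1 + tanh (A n / 2))"
proof -
  have "planted A n i + planted A n j = A n" using assms by (auto simp: planted_def)
  then show ?thesis unfolding planted_prob_edge_between edge_prob_alt p_def by simp
qed

text \<open>Degrees in the null model are dependent, so the witness is sought in a block of
  \<open>\<eta> * n\<close> vertices. Edges leaving the block give independent counts with variance
  reduced by the factor \<open>1 - \<eta>\<close>, and edges inside fall short of their mean by at
  most a multiple of \<open>sqrt \<eta>\<close> on the scale \<open>R\<close>.\<close>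

lemma null_lower_tail:
  assumes \<delta>: "0 < \<delta>" "\<delta> < 1"
  shows "(\<lambda>n. 1 - measure_pmf.prob (random_graph n (\<lambda>_. p n)) (exceeds n (K \<delta> n) {1..n})) \<longlonglongrightarrow> 0"
proof -
  have w: "0 < 1 - \<theta>" using theta_bounds by simp
  \<comment> \<open>\<open>sqrt (3 * \<eta>)\<close> is the shortfall inside the block. It must fit
    between the level 1 - \<delta> and the level 1 - \<delta>/2 attained across the cut.\<close>
  obtain \<eta> where \<eta>: "0 < \<eta>" "\<eta> < 1 / 2" "sqrt (1 - \<delta>) + sqrt (3 * \<eta>) < sqrt ((1 - \<delta> / 2) * (1 - \<eta>))"
    by (rule eventually_at_right_gap[of "\<lambda>\<eta>. sqrt (1 - \<delta>) + sqrt (3 * \<eta>)" "\<lambda>\<eta>. sqrt ((1 - \<delta> / 2) * (1 - \<eta>))" "1 / 2"])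
      (use \<delta> in \<open>auto intro!: continuous_intros\<close>)
  define m where "m = (\<lambda>n. nat \<lfloor>\<eta> * real n\<rfloor>)"
  have m: "real (m n) \<le> \<eta> * real n" "\<eta> * real n - 1 \<le> real (m n)" for n
  proof -
    have "0 \<le> \<lfloor>\<eta> * real n\<rfloor>" using \<eta> by simp
    then have "real (m n) = of_int \<lfloor>\<eta> * real n\<rfloor>" by (simp add: m_def)
    then show "real (m n) \<le> \<eta> * real n" "\<eta> * real n - 1 \<le> real (m n)" by linarith+
  qed
  have m_le: "m n \<le> n" for n
  proof -
    have "\<eta> * real n \<le> 1 * real n" using \<eta> by (intro mult_right_mono) auto
    then show ?thesis using m(1)[of n] by linarith
  qed
  have m_n: "(\<lambda>n. real (m n) / real n) \<longlonglongrightarrow> \<eta>"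
  proof (rule tendsto_sandwich)
    show "(\<lambda>n. \<eta> - 1 / real n) \<longlonglongrightarrow> \<eta>" by real_asymp
    show "(\<lambda>_. \<eta>) \<longlonglongrightarrow> \<eta>" by simp
    show "\<forall>\<^sub>F n in sequentially. \<eta> - 1 / real n \<le> real (m n) / real n"
      using ev_ge
    proof eventually_elim
      case (elim n)
      then show ?case using divide_right_mono[OF m(2)[of n], of "real n"] by (simp add: diff_divide_distrib)
    qed
    show "\<forall>\<^sub>F n in sequentially. real (m n) / real n \<le> \<eta>"
      using ev_ge by eventually_elim (use m(1) in \<open>auto simp: field_simps\<close>)
  qed
  define V where "V = (\<lambda>n. real (n - m n) * (p n * (1 - p n)))"
  have V_eq: "V n = (1 - real (m n) / real n) * V0 n" if "n \<ge> 1" for n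
    using that m_le[of n] by (simp add: V_def V0_def of_nat_diff field_simps)
  have V_lam: "(\<lambda>n. V n / lam n) \<longlonglongrightarrow> ((1 - \<eta>) * (1 - \<theta>)) / 2"
  proof (rule Lim_transform_eventually)
    show "(\<lambda>n. (1 - real (m n) / real n) * (V0 n / lam n)) \<longlonglongrightarrow> ((1 - \<eta>) * (1 - \<theta>)) / 2"
      by (rule tendsto_eq_intros m_n V0_scaled refl | simp)+
    show "\<forall>\<^sub>F n in sequentially. (1 - real (m n) / real n) * (V0 n / lam n) = V n / lam n"
      using ev_ge by eventually_elim (simp add: V_eq)
  qed
  have \<eta>V0: "(\<lambda>n. (\<eta> * V0 n) / lam n) \<longlonglongrightarrow> (\<eta> * (1 - \<theta>)) / 2"
    using tendsto_mult_left[OF V0_scaled, of \<eta>] by simp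
  have c: "0 < 1 - \<delta> / 2" "0 < \<delta> / 4" "0 < (3::real)" "0 < (1::real)" using \<delta> by auto
  obtain N1 where N1: "N1 > 0" and low: "\<And>n P q S V L k.
    \<lbrakk>0 < q; q < 1; S \<subseteq> {1..n}; \<And>i j. i \<in> S \<Longrightarrow> j \<in> {1..n} - S \<Longrightarrow> P (edge_between i j) = q;
     V = real (n - card S) * (q * (1 - q)); N1 \<le> L; N1 * L \<le> V;
     k \<le> real (n - card S) * q + sqrt (2 * (1 - \<delta> / 2) * V * L)\<rbrakk> \<Longrightarrow>
     measure_pmf.prob (random_graph n P) {E. \<forall>i\<in>S. real (degree_in ({1..n} - S) E i) \<le> k}
       \<le> exp (- (real (card S) * exp (- (1 - \<delta> / 2 + \<delta> / 4) * L)))"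
    using bipartite_max_degree_moderate[OF c(1,2)] by blast
  \<comment> \<open>With 3 and slack 1 the union over at most n block vertices leaves n *
    n^(-2).\<close>
  obtain N2 where N2: "N2 > 0" and inner: "\<And>n p W V L.
    \<lbrakk>0 \<le> p; p \<le> 1; W \<subseteq> {1..n}; real (card W - 1) * (p * (1 - p)) \<le> V; 0 < L; N2 * L \<le> V\<rbrakk> \<Longrightarrow>
     measure_pmf.prob (random_graph n (\<lambda>_. p))
       {E. \<exists>i\<in>W. real (degree_in W E i) \<le> real (card W - 1) * p - sqrt (2 * 3 * V * L)}
     \<le> real (card W) * exp (- (3 - 1) * L)"
    using min_degree_lower_tail[OF c(3,4)] by blast
  define x where "x = (\<lambda>n. sqrt (2 * 3 * (\<eta> * V0 n) * ln (real n)))"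
  \<comment> \<open>The summand \<open>p n\<close> corrects an off-by-one: the block and its
    complement offer n - 1 neighbours, while \<open>K\<close> is centred at
    \<open>n * p\<close>.\<close>
  have k_le: "\<forall>\<^sub>F n in sequentially. p n + sqrt (2 * (1 - \<delta>) * V0 n * ln (real n)) + x n
      \<le> sqrt (2 * (1 - \<delta> / 2) * V n * ln (real n))"
  proof (rule eventually_le_scaled)
    have "(\<lambda>n. p n * (1 / R n)) \<longlonglongrightarrow> \<theta> * 0" by (intro tendsto_intros p_tendsto R_tendsto)
    then have "(\<lambda>n. p n / R n) \<longlonglongrightarrow> 0" by simp
    then show "(\<lambda>n. (p n + sqrt (2 * (1 - \<delta>) * V0 n * ln (real n)) + x n) / R n)
        \<longlonglongrightarrow> 0 + sqrt ((1 - \<delta>) * (1 - \<theta>)) + sqrt (3 * (\<eta> * (1 - \<theta>)))"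
      unfolding add_divide_distrib x_def by (intro tendsto_add sqrt_scaled V0_scaled \<eta>V0)
    show "(\<lambda>n. sqrt (2 * (1 - \<delta> / 2) * V n * ln (real n)) / R n)
        \<longlonglongrightarrow> sqrt ((1 - \<delta> / 2) * ((1 - \<eta>) * (1 - \<theta>)))"
      by (rule sqrt_scaled[OF V_lam])
    have "(sqrt (1 - \<delta>) + sqrt (3 * \<eta>)) * sqrt (1 - \<theta>) < sqrt ((1 - \<delta> / 2) * (1 - \<eta>)) * sqrt (1 - \<theta>)"
      using \<eta>(3) w by (intro mult_strict_right_mono) auto
    then show "0 + sqrt ((1 - \<delta>) * (1 - \<theta>)) + sqrt (3 * (\<eta> * (1 - \<theta>)))
        < sqrt ((1 - \<delta> / 2) * ((1 - \<eta>) * (1 - \<theta>)))"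
      by (simp only: real_sqrt_mult distrib_right mult.assoc add_0)
  qed
  have VL: "\<forall>\<^sub>F n in sequentially. N1 * ln (real n) \<le> V n"
    by (rule eventually_ln_le[OF V_lam]) (use w \<eta> in auto)
  have V0L: "\<forall>\<^sub>F n in sequentially. N2 * ln (real n) \<le> \<eta> * V0 n"
    by (rule eventually_ln_le[OF \<eta>V0]) (use w \<eta> in auto)
  have NL: "\<forall>\<^sub>F n in sequentially. N1 \<le> ln (real n)"
    using ln_at_top by (auto simp: filterlim_at_top)
  have m1: "\<forall>\<^sub>F n in sequentially. 1 \<le> m n"
  proof -
    have "\<forall>\<^sub>F n in sequentially. 2 \<le> \<eta> * real n" using \<eta> by real_asymp
    then show ?thesis
    proof eventually_elim
      case (elim n)
      then have "1 \<le> real (m n)" using m(2)[of n] by linarith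
      then show ?case by simp
    qed
  qed
  define b1 where "b1 = (\<lambda>n. real n * exp (- 2 * ln (real n)))"
  \<comment> \<open>The exponent 1 - \<delta>/4 is 1 - \<delta>/2 plus the loss \<delta>/4, so the
    expected number of exceedances in the block grows like n^(\<delta>/4).\<close>
  define b2 where "b2 = (\<lambda>n. exp (- ((\<eta> * real n - 1) * exp (- (1 - \<delta> / 4) * ln (real n)))))"
  have b: "(\<lambda>n. b1 n + b2 n) \<longlonglongrightarrow> 0"
  proof (rule tendsto_add_zero)
    show "b1 \<longlonglongrightarrow> 0" unfolding b1_def by real_asymp
    show "b2 \<longlonglongrightarrow> 0" unfolding b2_def
      by (rule filterlim_compose[OF exp_at_bot]) (use \<delta> \<eta> in \<open>real_asymp\<close>)
  qed
  show ?thesis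
  proof (rule tendsto_sandwich[OF _ _ tendsto_const b])
    show "\<forall>\<^sub>F n in sequentially. 1 - measure_pmf.prob (random_graph n (\<lambda>_. p n)) (exceeds n (K \<delta> n) {1..n}) \<le> b1 n + b2 n"
      using ev_ge k_le VL V0L NL m1
    proof eventually_elim
      case (elim n)
      let ?M = "random_graph n (\<lambda>_. p n)"
      define W where "W = {1..m n}"
      have W: "W \<subseteq> {1..n}" "card W = m n" using m_le[of n] by (auto simp: W_def)
      have pn: "0 < p n" "p n \<le> 1 / 2" using p_bounds[of n] elim by auto
      \<comment> \<open>Guaranteed contribution from inside the block; the edges leaving it must
        supply the remaining \<open>K \<delta> n - y\<close>.\<close>
      define y where "y = real (m n - 1) * p n - x n"
      define X1 where "X1 = {E. \<exists>i\<in>W. real (degree_in W E i) \<le> y}"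
      define X2 where "X2 = {E. \<forall>i\<in>W. real (degree_in ({1..n} - W) E i) \<le> K \<delta> n - y}"
      have "1 - measure_pmf.prob ?M (exceeds n (K \<delta> n) {1..n}) = measure_pmf.prob ?M (UNIV - exceeds n (K \<delta> n) {1..n})"
        using measure_pmf.prob_compl[of "exceeds n (K \<delta> n) {1..n}" ?M] by simp
      also have "\<dots> \<le> measure_pmf.prob ?M (X1 \<union> X2)"
      proof (rule measure_pmf.finite_measure_mono)
        show "UNIV - exceeds n (K \<delta> n) {1..n} \<subseteq> X1 \<union> X2"
        proof
          fix E assume E: "E \<in> UNIV - exceeds n (K \<delta> n) {1..n}"
          show "E \<in> X1 \<union> X2"
          proof (cases "E \<in> X1")
            case False
            have "real (degree_in ({1..n} - W) E i) \<le> K \<delta> n - y" if i: "i \<in> W" for i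
            proof -
              have "real (degree_in {1..n} E i) \<le> K \<delta> n" using E i W by (auto simp: exceeds_def not_less)
              moreover have "degree_in {1..n} E i = degree_in W E i + degree_in ({1..n} - W) E i"
                using degree_in_Un[of W "{1..n} - W" E i] W by (simp add: Un_absorb1 finite_subset[OF W(1)])
              moreover have "y < real (degree_in W E i)" using False i by (auto simp: X1_def not_le)
              ultimately show ?thesis by simp
            qed
            then show ?thesis by (auto simp: X2_def)
          qed auto
        qed
      qed simp
      also have "\<dots> \<le> measure_pmf.prob ?M X1 + measure_pmf.prob ?M X2" by (rule measure_Un_le) auto
      also have "\<dots> \<le> b1 n + b2 n"
      proof (rule add_mono)
        have "real (m n - 1) * (p n * (1 - p n)) \<le> (\<eta> * real n) * (p n * (1 - p n))"
          using m(1)[of n] pn by (intro mult_right_mono) auto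
        then have "real (card W - 1) * (p n * (1 - p n)) \<le> \<eta> * V0 n"
          by (simp add: V0_def W)
        then have "measure_pmf.prob ?M {E. \<exists>i\<in>W. real (degree_in W E i)
              \<le> real (card W - 1) * p n - sqrt (2 * 3 * (\<eta> * V0 n) * ln (real n))}
            \<le> real (card W) * exp (- (3 - 1) * ln (real n))"
          by (intro inner) (use pn W elim in auto)
        also have "\<dots> \<le> b1 n" using m_le[of n] by (simp add: W b1_def)
        finally show "measure_pmf.prob ?M X1 \<le> b1 n" by (simp add: X1_def y_def x_def W)
        have "measure_pmf.prob ?M X2 \<le> exp (- (real (card W) * exp (- (1 - \<delta> / 2 + \<delta> / 4) * ln (real n))))"
          unfolding X2_def
        proof (rule low[where q = "p n" and V = "V n"])
          have "K \<delta> n - y = real (n - m n) * p n + p n + sqrt (2 * (1 - \<delta>) * V0 n * ln (real n)) + x n"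
            using elim m_le[of n] by (simp add: K_def y_def of_nat_diff algebra_simps)
          then show "K \<delta> n - y \<le> real (n - card W) * p n + sqrt (2 * (1 - \<delta> / 2) * V n * ln (real n))"
            using elim by (simp add: W)
        qed (use pn W elim in \<open>auto simp: V_def\<close>)
        also have "\<dots> \<le> b2 n"
        proof -
          have "1 - \<delta> / 2 + \<delta> / 4 = 1 - \<delta> / 4" by simp
          then show ?thesis
            unfolding b2_def W exp_le_cancel_iff neg_le_iff_le
            using mult_right_mono[OF m(2)[of n], of "exp (- (1 - \<delta> / 4) * ln (real n))"] by (simp only: exp_ge_zero)
        qed
        finally show "measure_pmf.prob ?M X2 \<le> b2 n" .
      qed
      finally show ?case .
    qed
  qed auto
qed

text \<open>At fluctuation exponent \<open>1 - \<alpha> + 2 * \<delta>\<close> the Chernoff bound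
  leaves \<open>1 - \<alpha> + \<delta>\<close>, so a union over the \<open>s\<close> signal
  vertices tends to 0; the gap places that level below \<open>K\<close>.\<close>

lemma planted_upper_tail:
  assumes \<delta>: "0 < \<delta>"
    and gap: "sqrt C / 4 + sqrt ((1 - \<alpha> + 2 * \<delta>) * (1 - \<theta>)) < sqrt ((1 - \<delta>) * (1 - \<theta>))"
    and A: "\<And>n. n \<ge> 1 \<Longrightarrow> A n > 0" "\<forall>\<^sub>F n in sequentially. tanh (A n) \<le> \<tau> n"
  shows "(\<lambda>n. measure_pmf.prob (random_graph n (planted_prob A n)) (exceeds n (K \<delta> n) {1..s n})) \<longlonglongrightarrow> 0"
proof -
  have c: "0 < 1 - \<alpha> + 2 * \<delta>" using \<delta> alpha by simp
  obtain N where N: "N > 0" and up: "\<And>n P S \<mu> V L k.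
    \<lbrakk>\<And>e. e \<in> vertex_pairs n \<Longrightarrow> 0 \<le> P e \<and> P e \<le> 1; S \<subseteq> {1..n};
     \<And>i. i \<in> S \<Longrightarrow> (\<Sum>j\<in>{1..n} - {i}. P (edge_between i j)) \<le> \<mu>;
     \<And>i. i \<in> S \<Longrightarrow> (\<Sum>j\<in>{1..n} - {i}. P (edge_between i j) * (1 - P (edge_between i j))) \<le> V;
     0 < L; N * L \<le> V; \<mu> + sqrt (2 * (1 - \<alpha> + 2 * \<delta>) * V * L) \<le> k\<rbrakk> \<Longrightarrow>
     measure_pmf.prob (random_graph n P) (exceeds n k S) \<le> real (card S) * exp (- ((1 - \<alpha> + 2 * \<delta>) - \<delta>) * L)"
    using max_degree_upper_tail[OF c \<delta>] by blast
  define t where "t = (\<lambda>n. \<tau> n * (1 + (\<tau> n)\<^sup>2) / 2)"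
  \<comment> \<open>All n vertices are counted as null neighbours, and each signal neighbour gets an
    additional \<open>lam / n\<close>. This crude surplus is negligible on the scale
    \<open>R\<close>.\<close>
  define \<mu> where "\<mu> = (\<lambda>n. real n * (p n * (1 + t n)) + real (s n) * lam n / real n)"
  \<comment> \<open>Valid as a variance bound because every edge probability is at least
    \<open>p\<close>.\<close>
  define V where "V = (\<lambda>n. (1 - p n) * \<mu> n)"
  have t: "t \<longlonglongrightarrow> 0" unfolding t_def by (rule tendsto_eq_intros tau_tendsto refl | simp)+
  have Vlam: "(\<lambda>n. V n / lam n) \<longlonglongrightarrow> (1 - \<theta>) / 2"
  proof (rule Lim_transform_eventually)
    show "(\<lambda>n. (1 - p n) * ((1 + t n) / 2 + real (s n) / real n)) \<longlonglongrightarrow> (1 - \<theta>) / 2"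
      by (rule tendsto_eq_intros s_over_n t p_tendsto refl | simp)+
    show "\<forall>\<^sub>F n in sequentially. (1 - p n) * ((1 + t n) / 2 + real (s n) / real n) = V n / lam n"
      using ev_ge
    proof eventually_elim
      case (elim n)
      have "\<mu> n = lam n * ((1 + t n) / 2 + real (s n) / real n)"
      proof -
        have "\<mu> n = (real n * p n) * (1 + t n) + real (s n) * lam n / real n"
          by (simp add: \<mu>_def)
        also have "real n * p n = lam n / 2" using elim by (intro n_p) auto
        finally show ?thesis by (simp add: distrib_left mult_ac)
      qed
      then show ?case using elim by (simp add: V_def)
    qed
  qed
  have VL: "\<forall>\<^sub>F n in sequentially. N * ln (real n) \<le> V n"
    by (rule eventually_ln_le[OF Vlam]) (use theta_bounds in auto)
  have kle: "\<forall>\<^sub>F n in sequentially. (\<mu> n - real n * p n) + sqrt (2 * (1 - \<alpha> + 2 * \<delta>) * V n * ln (real n))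
      \<le> sqrt (2 * (1 - \<delta>) * V0 n * ln (real n))"
  proof (rule eventually_le_scaled)
    have 1: "(\<lambda>n. (\<mu> n - real n * p n) / R n) \<longlonglongrightarrow> sqrt C / 4"
    proof (rule Lim_transform_eventually)
      show "(\<lambda>n. sqrt C / 4 * (1 + (\<tau> n)\<^sup>2) + (real (s n) * lam n / real n) / R n) \<longlonglongrightarrow> sqrt C / 4"
        by (rule tendsto_eq_intros s_lam_scaled tau_tendsto refl | simp)+
      show "\<forall>\<^sub>F n in sequentially. sqrt C / 4 * (1 + (\<tau> n)\<^sup>2) + (real (s n) * lam n / real n) / R n
          = (\<mu> n - real n * p n) / R n"
        using ev_ge R_pos lam_tau
      proof eventually_elim
        case (elim n)
        have "\<mu> n - real n * p n = (real n * p n) * t n + real (s n) * lam n / real n"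
          by (simp add: \<mu>_def algebra_simps)
        also have "(real n * p n) * t n = (lam n * \<tau> n) * (1 + (\<tau> n)\<^sup>2) / 4"
        proof -
          have "real n * p n = lam n / 2" using elim by (intro n_p) auto
          then show ?thesis unfolding t_def by (simp only:)
        qed
        also have "\<dots> = sqrt C / 4 * (1 + (\<tau> n)\<^sup>2) * R n" using elim by simp
        finally show ?case using elim by (simp add: add_divide_distrib)
      qed
    qed
    show "(\<lambda>n. ((\<mu> n - real n * p n) + sqrt (2 * (1 - \<alpha> + 2 * \<delta>) * V n * ln (real n))) / R n)
        \<longlonglongrightarrow> sqrt C / 4 + sqrt ((1 - \<alpha> + 2 * \<delta>) * (1 - \<theta>))"
      unfolding add_divide_distrib[of "\<mu> n - real n * p n" for n] by (intro tendsto_add 1 sqrt_scaled Vlam)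
    show "(\<lambda>n. sqrt (2 * (1 - \<delta>) * V0 n * ln (real n)) / R n) \<longlonglongrightarrow> sqrt ((1 - \<delta>) * (1 - \<theta>))"
      by (rule sqrt_scaled[OF V0_scaled])
  qed (rule gap)
  show ?thesis
  proof (rule tendsto_sandwich[OF _ _ tendsto_const s_exp_tendsto[OF \<delta>]])
    show "\<forall>\<^sub>F n in sequentially. measure_pmf.prob (random_graph n (planted_prob A n)) (exceeds n (K \<delta> n) {1..s n})
        \<le> real (s n) * exp (- (1 - \<alpha> + \<delta>) * ln (real n))"
      using ev_ge s_le VL kle A(2)
    proof eventually_elim
      case (elim n)
      have An: "0 < A n" using A(1)[of n] elim by simp
      have n1: "1 \<le> n" using elim by simp
      have pn: "0 < p n" "p n \<le> 1 / 2" using p_bounds[of n] elim by auto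
      have t0: "0 \<le> t n" using C elim by (simp add: t_def \<tau>_def)
      define u where "u = (\<lambda>j. p n * (1 + t n) + (if j \<in> {1..s n} then lam n / real n else 0))"
      have Pu: "planted_prob A n (edge_between i j) \<le> u j" if "i \<in> {1..s n}" for i j
      proof (cases "j \<in> {1..s n}")
        case True
        then show ?thesis using planted_prob_bounds(2)[of n A i j] An n1 pn t0 by (simp add: u_def add_increasing)
      next
        case False
        have "tanh (A n / 2) \<le> t n"
          unfolding t_def by (rule tanh_half_le) (use An elim in auto)
        then show ?thesis using planted_prob_cross[of i n j A] that False pn by (auto simp: u_def)
      qed
      have u0: "0 \<le> u j" for j using pn t0 elim by (simp add: u_def)
      have su: "(\<Sum>j\<in>{1..n} - {i}. u j) \<le> \<mu> n" for i
      proof -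
        have "(\<Sum>j\<in>{1..n} - {i}. u j) \<le> (\<Sum>j\<in>{1..n}. u j)" by (rule sum_mono2) (use u0 in auto)
        also have "\<dots> = real n * (p n * (1 + t n)) + real (card ({1..n} \<inter> {1..s n})) * (lam n / real n)"
          unfolding u_def sum.distrib sum.inter_restrict[OF finite_atLeastAtMost, symmetric] by simp
        also have "{1..n} \<inter> {1..s n} = {1..s n}" using elim by auto
        finally show ?thesis by (simp add: \<mu>_def)
      qed
      have "measure_pmf.prob (random_graph n (planted_prob A n)) (exceeds n (K \<delta> n) {1..s n})
          \<le> real (card {1..s n}) * exp (- ((1 - \<alpha> + 2 * \<delta>) - \<delta>) * ln (real n))"
      proof (rule up[where \<mu> = "\<mu> n" and V = "V n"])
        show "0 \<le> planted_prob A n e \<and> planted_prob A n e \<le> 1" if "e \<in> vertex_pairs n" for e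
          using planted_prob_bounds'[of n A e] that An n1 pn by auto
        show "\<mu> n + sqrt (2 * (1 - \<alpha> + 2 * \<delta>) * V n * ln (real n)) \<le> K \<delta> n"
          using elim by (simp add: K_def)
        fix i assume i: "i \<in> {1..s n}"
        show "(\<Sum>j\<in>{1..n} - {i}. planted_prob A n (edge_between i j)) \<le> \<mu> n"
          by (rule order_trans[OF sum_mono su]) (rule Pu[OF i])
        have "(\<Sum>j\<in>{1..n} - {i}. planted_prob A n (edge_between i j) * (1 - planted_prob A n (edge_between i j)))
            \<le> (\<Sum>j\<in>{1..n} - {i}. u j * (1 - p n))"
          using planted_prob_bounds[of n A i] An n1 u0 by (intro sum_mono mult_mono Pu[OF i]) auto
        also have "\<dots> = (1 - p n) * (\<Sum>j\<in>{1..n} - {i}. u j)" by (simp add: sum_distrib_left mult.commute)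
        also have "\<dots> \<le> V n" unfolding V_def using su pn by (intro mult_left_mono) auto
        finally show "(\<Sum>j\<in>{1..n} - {i}. planted_prob A n (edge_between i j) * (1 - planted_prob A n (edge_between i j))) \<le> V n" .
      qed (use elim in auto)
      then show ?case by (simp add: algebra_simps)
    qed
  qed auto
qed

text \<open>With \<open>v = s * lam / n\<close> bounding the mean number of signal neighbours,
  Chernoff at \<open>t = 1\<close> costs \<open>v\<close>. A deviation of
  \<open>2 * ln n + v\<close> above the mean then has probability at most n^(-2), enough for a union
  over all vertices.\<close>

definition B :: "nat \<Rightarrow> real" where
  "B n = 2 * ln (real n) + 2 * (real (s n) * lam n / real n)"

lemma planted_neighbours_bound:
  assumes A: "\<And>n. n \<ge> 1 \<Longrightarrow> A n > 0"
  shows "(\<lambda>n. measure_pmf.prob (random_graph n (planted_prob A n))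
     {E. \<exists>j\<in>{1..n} - {1..s n}. B n < real (degree_in {1..s n} E j)}) \<longlonglongrightarrow> 0"
proof (rule tendsto_sandwich[OF _ _ tendsto_const])
  show "(\<lambda>n. real n * exp (- 2 * ln (real n))) \<longlonglongrightarrow> 0" by real_asymp
  show "\<forall>\<^sub>F n in sequentially. measure_pmf.prob (random_graph n (planted_prob A n))
     {E. \<exists>j\<in>{1..n} - {1..s n}. B n < real (degree_in {1..s n} E j)} \<le> real n * exp (- 2 * ln (real n))"
    using ev_ge s_le
  proof eventually_elim
    case (elim n)
    have An: "0 < A n" using A(1)[of n] elim by simp
    have n1: "1 \<le> n" using elim by simp
    have pn: "0 < p n" "p n \<le> 1 / 2" using p_bounds[of n] elim by auto
    let ?M = "random_graph n (planted_prob A n)"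
    define v where "v = real (s n) * lam n / real n"
    have "measure_pmf.prob ?M {E. \<exists>j\<in>{1..n} - {1..s n}. B n < real (degree_in {1..s n} E j)}
        \<le> real (card ({1..n} - {1..s n})) * exp (- 2 * ln (real n))"
    proof (rule prob_Bex_le_card)
      fix j assume j: "j \<in> {1..n} - {1..s n}"
      have le: "(\<Sum>i\<in>{1..s n} - {j}. planted_prob A n (edge_between j i)) \<le> v"
      proof -
        have "(\<Sum>i\<in>{1..s n} - {j}. planted_prob A n (edge_between j i)) \<le> (\<Sum>i\<in>{1..s n} - {j}. lam n / real n)"
          by (rule sum_mono) (use planted_prob_bounds(2)[of n A] An n1 in auto)
        also have "\<dots> = v" using j by (simp add: v_def)
        finally show ?thesis .
      qed
      have "measure_pmf.prob ?M {E. B n < real (degree_in {1..s n} E j)}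
          \<le> measure_pmf.prob ?M {E. 2 * ln (real n) + v
            \<le> 1 * (real (degree_in {1..s n} E j) - (\<Sum>i\<in>{1..s n} - {j}. planted_prob A n (edge_between j i)))}"
        using le by (intro measure_pmf.finite_measure_mono) (auto simp: B_def v_def[symmetric])
      also have "\<dots> \<le> exp (1\<^sup>2 / 2 * (1 + \<bar>1\<bar>) * v - (2 * ln (real n) + v))"
      proof (rule chernoff_degree)
        show "0 \<le> planted_prob A n e \<and> planted_prob A n e \<le> 1" if "e \<in> vertex_pairs n" for e
          using planted_prob_bounds'[of n A e] that An n1 pn by auto
        have "(\<Sum>i\<in>{1..s n} - {j}. planted_prob A n (edge_between j i) * (1 - planted_prob A n (edge_between j i)))
            \<le> (\<Sum>i\<in>{1..s n} - {j}. planted_prob A n (edge_between j i))"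
        proof (rule sum_mono)
          fix i
          have "0 \<le> planted_prob A n (edge_between j i)" using planted_prob_bounds(1)[of n A j i] An n1 pn by simp
          then show "planted_prob A n (edge_between j i) * (1 - planted_prob A n (edge_between j i)) \<le> planted_prob A n (edge_between j i)"
            by (simp add: mult_left_le)
        qed
        then show "(\<Sum>i\<in>{1..s n} - {j}. planted_prob A n (edge_between j i) * (1 - planted_prob A n (edge_between j i))) \<le> v"
          using le by simp
      qed (use j elim in auto)
      finally show "measure_pmf.prob ?M {E. B n < real (degree_in {1..s n} E j)} \<le> exp (- 2 * ln (real n))"
        by simp
    qed simp
    also have "\<dots> \<le> real n * exp (- 2 * ln (real n))"
      using card_mono[of "{1..n}" "{1..n} - {1..s n}"] by (intro mult_right_mono) auto
    finally show ?case .
  qed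
qed auto

text \<open>The logarithmic part of \<open>B\<close> contributes a multiple of
  \<open>sqrt (ln n ^ 3 / lam)\<close>, which is the origin of the cubic growth condition; the other
  part vanishes by sparsity.\<close>

lemma tau_B_tendsto:
  assumes "dominates lam (\<lambda>n. ln (real n) ^ 3)"
  shows "(\<lambda>n. \<tau> n * B n) \<longlonglongrightarrow> 0"
proof -
  have "(\<lambda>n. inverse (lam n / ln (real n) ^ 3)) \<longlonglongrightarrow> 0"
    using assms unfolding dominates_def by (rule tendsto_inverse_0_at_top)
  then have l3: "(\<lambda>n. ln (real n) ^ 3 / lam n) \<longlonglongrightarrow> 0" by simp
  show ?thesis
  proof (rule Lim_transform_eventually)
    show "(\<lambda>n. 2 * sqrt C * sqrt (ln (real n) ^ 3 / lam n) +
        2 * sqrt C * (sqrt (ln (real n) / lam n) * (real (s n) * lam n / real n))) \<longlonglongrightarrow> 0"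
      by (rule tendsto_eq_intros l3 sqrt_ln_s_lam refl | simp)+
    show "\<forall>\<^sub>F n in sequentially. 2 * sqrt C * sqrt (ln (real n) ^ 3 / lam n) +
        2 * sqrt C * (sqrt (ln (real n) / lam n) * (real (s n) * lam n / real n)) = \<tau> n * B n"
      using ev_ge
    proof eventually_elim
      case (elim n)
      have "sqrt (ln (real n) ^ 3 / lam n) = sqrt ((ln (real n))\<^sup>2 * (ln (real n) / lam n))"
        by (simp add: power2_eq_square power3_eq_cube)
      also have "\<dots> = ln (real n) * sqrt (ln (real n) / lam n)"
        using elim by (subst real_sqrt_mult) simp
      finally have a: "sqrt (ln (real n) ^ 3 / lam n) = ln (real n) * sqrt (ln (real n) / lam n)" .
      have "\<tau> n = sqrt C * sqrt (ln (real n) / lam n)"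
        by (simp add: \<tau>_def real_sqrt_mult[symmetric])
      then show ?case unfolding a B_def by (simp add: distrib_left mult_ac)
    qed
  qed
qed

text \<open>The rejection probability under the planted alternative exceeds the one under the null
  by at most a vanishing error. The error does not involve \<open>k\<close>, so arbitrary thresholds
  are covered.\<close>

lemma max_degree_powerless:
  assumes lam3: "dominates lam (\<lambda>n. ln (real n) ^ 3)"
    and less: "C < C_max \<alpha> \<theta>"
    and A: "\<And>n. n \<ge> 1 \<Longrightarrow> A n > 0" "\<forall>\<^sub>F n in sequentially. tanh (A n) \<le> \<tau> n"
  shows "asymp_powerless lam s A (\<lambda>n. max_degree_test n (k n))"
proof -
  have w: "0 < 1 - \<theta>" using theta_bounds by simp
  have sa: "0 < sqrt (1 - \<alpha>)" "sqrt (1 - \<alpha>) < 1" using alpha by auto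
  have "(4 * x * sqrt (1 - \<theta>))\<^sup>2 = 16 * (1 - \<theta>) * x\<^sup>2" for x
    using w by (simp add: power_mult_distrib mult_ac)
  then have "(sqrt C)\<^sup>2 < (4 * (1 - sqrt (1 - \<alpha>)) * sqrt (1 - \<theta>))\<^sup>2"
    using less C unfolding C_max_def by (simp only: real_sqrt_pow2 less_imp_le)
  then have "sqrt C < 4 * (1 - sqrt (1 - \<alpha>)) * sqrt (1 - \<theta>)"
    by (rule power_less_imp_less_base) (use w sa in simp)
  then have gap0: "sqrt C / 4 + sqrt ((1 - \<alpha>) * (1 - \<theta>)) < sqrt (1 - \<theta>)"
    unfolding real_sqrt_mult by (simp add: algebra_simps)
  obtain \<delta> where \<delta>: "0 < \<delta>" "\<delta> < 1"
    "sqrt C / 4 + sqrt ((1 - \<alpha> + 2 * \<delta>) * (1 - \<theta>)) < sqrt ((1 - \<delta>) * (1 - \<theta>))"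
    by (rule eventually_at_right_gap[of "\<lambda>\<delta>. sqrt C / 4 + sqrt ((1 - \<alpha> + 2 * \<delta>) * (1 - \<theta>))"
        "\<lambda>\<delta>. sqrt ((1 - \<delta>) * (1 - \<theta>))" 1])
      ((intro continuous_intros)+, use gap0 in simp_all)
  let ?M0 = "\<lambda>n. random_graph n (\<lambda>_. p n)"
  let ?M1 = "\<lambda>n. random_graph n (planted_prob A n)"
  define e1 where "e1 = (\<lambda>n. measure_pmf.prob (?M1 n) (exceeds n (K \<delta> n) {1..s n}))"
  define e2 where "e2 = (\<lambda>n. measure_pmf.prob (?M1 n)
     {E. \<exists>j\<in>{1..n} - {1..s n}. B n < real (degree_in {1..s n} E j)})"
  define e3 where "e3 = (\<lambda>n. 1 - measure_pmf.prob (?M0 n) (exceeds n (K \<delta> n) {1..n}))"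
  have "(\<lambda>n. e1 n + \<tau> n * B n + e2 n + e3 n) \<longlonglongrightarrow> 0 + 0 + 0 + 0"
    unfolding e1_def e2_def e3_def
    by (intro tendsto_add planted_upper_tail \<delta> A tau_B_tendsto lam3 planted_neighbours_bound null_lower_tail)
  then have e: "(\<lambda>n. e1 n + \<tau> n * B n + e2 n + e3 n) \<longlonglongrightarrow> 0" by simp
  show ?thesis
  proof (rule asymp_powerlessI[OF A(1) e])
    show "\<forall>\<^sub>F n in sequentially. 1 - (e1 n + \<tau> n * B n + e2 n + e3 n)
        \<le> risk n (lam n) (max_degree_test n (k n)) (Xi n (s n) (A n))"
      using ev_ge s_le A(2)
    proof eventually_elim
      case (elim n)
      have An: "0 < A n" using A(1)[of n] elim by simp
      have n1: "1 \<le> n" using elim by simp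
      have pn: "0 < p n" "p n \<le> 1 / 2" using p_bounds[of n] elim by auto
      have \<tau>0: "0 \<le> \<tau> n" and B0: "0 \<le> B n" using elim C by (auto simp: \<tau>_def B_def)
      have pos: "0 \<le> e1 n" "0 \<le> \<tau> n * B n" "0 \<le> e2 n" "0 \<le> e3 n"
        using \<tau>0 B0 by (auto simp: e1_def e2_def e3_def)
      have sub: "{1..s n} \<subseteq> {1..n}" using elim by auto
      have main: "measure_pmf.prob (?M1 n) (exceeds n (k n) {1..n})
          \<le> measure_pmf.prob (?M0 n) (exceeds n (k n) {1..n}) + (e1 n + \<tau> n * B n + e2 n + e3 n)"
      proof (cases "K \<delta> n \<le> k n")
        \<comment> \<open>High threshold: signal vertices rarely exceed it, and for the others the
          thinning coupling compares the planted model with the null.\<close>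
        case True
        have "measure_pmf.prob (?M1 n) (exceeds n (k n) {1..n})
            \<le> measure_pmf.prob (?M1 n) (exceeds n (k n) {1..s n} \<union> exceeds n (k n) ({1..n} - {1..s n}))"
          by (rule measure_pmf.finite_measure_mono) (auto simp: exceeds_def)
        also have "\<dots> \<le> measure_pmf.prob (?M1 n) (exceeds n (k n) {1..s n})
            + measure_pmf.prob (?M1 n) (exceeds n (k n) ({1..n} - {1..s n}))"
          by (rule measure_Un_le) auto
        also have "\<dots> \<le> e1 n + (measure_pmf.prob (?M0 n) (exceeds n (k n) ({1..n} - {1..s n})) + \<tau> n * B n + e2 n)"
        proof (rule add_mono)
          show "measure_pmf.prob (?M1 n) (exceeds n (k n) {1..s n}) \<le> e1 n"
            unfolding e1_def using True
            by (intro measure_pmf.finite_measure_mono) (force simp: exceeds_def)+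
          show "measure_pmf.prob (?M1 n) (exceeds n (k n) ({1..n} - {1..s n}))
              \<le> measure_pmf.prob (?M0 n) (exceeds n (k n) ({1..n} - {1..s n})) + \<tau> n * B n + e2 n"
            unfolding e2_def
          proof (rule prob_exceeds_outside[OF pn(1) _ sub _ _ \<tau>0 B0])
            show "p n \<le> planted_prob A n e \<and> planted_prob A n e \<le> 1" if "e \<in> vertex_pairs n" for e
              using planted_prob_bounds'[of n A e] that An n1 by auto
            show "planted_prob A n (edge_between i j) = p n" if "i \<in> {1..n} - {1..s n}" "j \<in> {1..n} - {1..s n}" for i j
              using planted_prob_outside[of i n j A] that by auto
            fix i j assume "i \<in> {1..n} - {1..s n}" "j \<in> {1..s n}"
            then have c: "planted_prob A n (edge_between i j) = p n * (1 + tanh (A n / 2))" by (intro planted_prob_cross) auto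
            have t: "0 \<le> tanh (A n / 2)" using An by simp
            then have t': "0 < 1 + tanh (A n / 2)" by linarith
            have "1 - p n / planted_prob A n (edge_between i j) = 1 - 1 / (1 + tanh (A n / 2))"
              unfolding c using pn by simp
            also have "\<dots> = tanh (A n / 2) / (1 + tanh (A n / 2))"
              using t' by (simp add: field_simps)
            also have "\<dots> \<le> tanh (A n / 2) / 1" using t t' by (intro divide_left_mono) auto
            also have "\<dots> \<le> \<tau> n" using tanh_half_le(2)[of "A n" "\<tau> n"] An elim by simp
            finally show "1 - p n / planted_prob A n (edge_between i j) \<le> \<tau> n" .
          qed
        qed
        also have "measure_pmf.prob (?M0 n) (exceeds n (k n) ({1..n} - {1..s n}))
            \<le> measure_pmf.prob (?M0 n) (exceeds n (k n) {1..n})"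
          by (intro measure_pmf.finite_measure_mono) (auto simp: exceeds_def)
        finally show ?thesis using pos by simp
      next
        \<comment> \<open>Low threshold: the null already rejects with probability tending to 1, so
          nothing about the alternative has to be known.\<close>
        case False
        have "measure_pmf.prob (?M0 n) (exceeds n (K \<delta> n) {1..n}) \<le> measure_pmf.prob (?M0 n) (exceeds n (k n) {1..n})"
          using False by (intro measure_pmf.finite_measure_mono) (force simp: exceeds_def)+
        then have "1 \<le> measure_pmf.prob (?M0 n) (exceeds n (k n) {1..n}) + e3 n" by (simp add: e3_def)
        moreover have "measure_pmf.prob (?M1 n) (exceeds n (k n) {1..n}) \<le> 1" by simp
        ultimately show ?thesis using pos by linarith
      qed
      have mem: "planted A n \<in> Xi n (s n) (A n)"
        using planted_in_Xi[of "s n" n "A n"] elim An by (simp add: planted_def[abs_def])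
      have "1 - (e1 n + \<tau> n * B n + e2 n + e3 n)
          \<le> measure_pmf.prob (beta_graph n (lam n) (\<lambda>_. 0)) (exceeds n (k n) {1..n}) +
            (1 - measure_pmf.prob (beta_graph n (lam n) (planted A n)) (exceeds n (k n) {1..n}))"
        using main unfolding beta_graph_planted beta_graph_null by linarith
      also have "\<dots> \<le> risk n (lam n) (max_degree_test n (k n)) (Xi n (s n) (A n))"
        by (rule risk_ge[OF n1 mem])
      finally show ?case .
    qed
  qed
qed

end

lemma dominates_ln_of_cube:
  assumes "dominates lam (\<lambda>n. ln (real n) ^ 3)" and "\<And>n. n \<ge> 1 \<Longrightarrow> 0 \<le> lam n"
  shows "dominates lam (\<lambda>n. ln (real n))"
  unfolding dominates_def
proof (rule filterlim_at_top_mono[OF assms(1)[unfolded dominates_def]])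
  have "\<forall>\<^sub>F n in sequentially. 1 \<le> ln (real n)" by real_asymp
  with eventually_ge_at_top[of 1]
  show "\<forall>\<^sub>F n in sequentially. lam n / ln (real n) ^ 3 \<le> lam n / ln (real n)"
  proof eventually_elim
    case (elim n)
    have "ln (real n) ^ 1 \<le> ln (real n) ^ 3" using elim by (intro power_increasing) auto
    moreover have "0 < ln (real n)" using elim by linarith
    ultimately show ?case
      using elim assms(2)[of n] by (intro divide_left_mono mult_pos_pos zero_less_power) auto
  qed
qed

theorem theorem3p5:
  fixes \<alpha> \<theta> C_star :: real and s :: "nat \<Rightarrow> nat" and lam A :: "nat \<Rightarrow> real"
  assumes "1 / 2 < \<alpha>" and "\<alpha> < 1"
    (* s n is an integer rounding, up or down, of n powr (1 - \<alpha>) *)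
    and "\<And>n. n \<ge> 1 \<Longrightarrow> \<bar>real (s n) - real n powr (1 - \<alpha>)\<bar> < 1"
    and "\<And>n. n \<ge> 1 \<Longrightarrow> 1 \<le> lam n \<and> lam n \<le> real n"
    and "(\<lambda>n. lam n / (2 * real n)) \<longlonglongrightarrow> \<theta>"
    and "\<And>n. n \<ge> 1 \<Longrightarrow> A n > 0"
    and "C_star > 0"
    (* The bounds on tanh (A n) are required for all large n only: for small n the square root
       can be 0 or exceed 1, and they would then contradict A n > 0 or tanh < 1. *)
  shows "(dominates lam (\<lambda>n. ln (real n)) \<and>
          C_star > C_max \<alpha> \<theta> \<and>
          (\<forall>\<^sub>F n in sequentially. tanh (A n) \<ge> sqrt (C_star * ln (real n) / lam n)) \<longrightarrow>
            (\<exists>k :: nat \<Rightarrow> real. asymp_powerful lam s A (\<lambda>n. max_degree_test n (k n)))) \<and>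
         (dominates lam (\<lambda>n. ln (real n) ^ 3) \<and>
          C_star < C_max \<alpha> \<theta> \<and>
          (\<forall>\<^sub>F n in sequentially. tanh (A n) \<le> sqrt (C_star * ln (real n) / lam n)) \<longrightarrow>
            (\<forall>k :: nat \<Rightarrow> real. asymp_powerless lam s A (\<lambda>n. max_degree_test n (k n))))"
proof (intro conjI impI allI; elim conjE)
  assume ln: "dominates lam (\<lambda>n. ln (real n))" and C_gt: "C_star > C_max \<alpha> \<theta>"
    and A: "\<forall>\<^sub>F n in sequentially. tanh (A n) \<ge> sqrt (C_star * ln (real n) / lam n)"
  interpret sparse_signals \<alpha> \<theta> C_star s lam
    by unfold_locales (use assms ln in auto)
  show "\<exists>k. asymp_powerful lam s A (\<lambda>n. max_degree_test n (k n))"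
    by (rule max_degree_powerful) (use C_gt A assms(6) in \<open>auto simp: \<tau>_def\<close>)
next
  fix k :: "nat \<Rightarrow> real"
  assume ln3: "dominates lam (\<lambda>n. ln (real n) ^ 3)" and C_lt: "C_star < C_max \<alpha> \<theta>"
    and A: "\<forall>\<^sub>F n in sequentially. tanh (A n) \<le> sqrt (C_star * ln (real n) / lam n)"
  have ln: "dominates lam (\<lambda>n. ln (real n))"
    by (rule dominates_ln_of_cube[OF ln3]) (use assms(4) in force)
  interpret sparse_signals \<alpha> \<theta> C_star s lam
    by unfold_locales (use assms ln in auto)
  show "asymp_powerless lam s A (\<lambda>n. max_degree_test n (k n))"
    by (rule max_degree_powerless) (use ln3 C_lt A assms(6) in \<open>auto simp: \<tau>_def\<close>)
qed

end
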